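(* Let $V$ satisfy $(V)$ and $\eta$ satisfy $(\eta)$ (as stated in the context), and let $\rho_o\in(L^1\cap L^\infty\cap BV)(\mathbb R^n;\mathbb R^m)$. Assume: (1) for all $w\in\mathbb R^{n\times m}$, $V(w)=v(\|w\|)\,w$ with $v$ such that $v(s)>0$ for all $s>0$; (2) for all $x\in\mathbb R^n$, $\eta(x)=\tilde\eta(\|x\|)$ with $\tilde\eta'\le0$ on $\mathbb R_+$ and $\operatorname{spt}\tilde\eta=[-\ell,\ell]$; (3) for all $i\in\{1,\dots,m\}$, $\rho_{o,i}(x)\ge0$ for a.e. $x\in\mathbb R^n$. Assume that, for a suitable $i\in\{1,\dots,m\}$, there exist $x_1,\dots,x_k\in\mathbb R^n$ and $r_1,\dots,r_k\in\,]0,+\infty[$ such that $$\operatorname{spt}\rho_{o,i}\subseteq\bigcup_{h=1}^kB(x_h,r_h)\quad\text{with}\quad\|x_h-x_j\|>r_h+r_j+\ell\quad\text{for all }h,j\in\{1,\dots,k\},\ h\ne j.$$ Then the solution $\mathcal G\rho_o$ to $\partial_t \rho_i + \nabla\cdot(\rho_i V_i(\nabla\rho*\eta))=0$, $i\in\{1,\dots,m\}$, with initial datum $\rho_o$ at time $0$, satisfies for all $t\in\mathbb R_+$ (and for that $i$) $$\operatorname{spt}(\mathcal G_t\rho_o)_i\subseteq\bigcup_{h=1}^kB(x_h,r_h)$$ and $$\int_{B(x_h,r_h)}(\mathcal G_t\rho_o)_i(x)\,dx=\int_{B(x_h,r_h)}\rho_{o,i}(x)\,dx\qquad\text{for }h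\in\{1,\dots,k\}.$$
   Context: $n,m\ge1$ are integers and $\mathbb R_+=[0,+\infty[$. All spaces $\mathbb R^n$, $\mathbb R^{n\times m}$ carry the Euclidean norm. $B(x,r)$ is the open ball in $\mathbb R^n$ centered at $x$ with radius $r$. $\|u\|_{W^{1,\infty}}=\|u\|_{L^\infty}+\|Du\|_{L^\infty}$. $BV$ is the set of $L^1_{loc}$ functions whose distributional derivative is a Radon measure with finite total variation. $\nabla$ is the differential operator in the space variable $x$; $DV$ is the total derivative of $V$. The support $\operatorname{spt}\rho$ of an $L^1$ function is the complement of the union of all open sets on which $\rho=0$ a.e. The function $\tilde\eta$ is regarded as an even function on $\mathbb R$ (whence its support is $[-\ell,\ell]$, $\ell>0$ being the radius of the support of $\eta$). Assumption $(\eta)$: $\eta\in (C^3\cap W^{3,1}\cap W^{3,\infty})(\mathbb R^n;\mathbb R)$. Assumption $(V)$: $V\in C^2(\mathbb R^{n\times m};\mathbb R^{n\times m})$, $V(0)=0$ and $\|DV\|_{W^{1,\infty}(\mathbb R^{n\times m};\mathbb R^{(n\times m)^2})}\le L_V$ for an $L_V\in\mathbb R_+$. Write $V=[V_1\cdots V_m]$ with columns $V_i\in\mathbb R^n$. For $\rho=(\rho_1,\dots,\rho_m)$, $\nabla\rho*\eta$ is the $n\times m$ matrix with entries $(\nabla\rho*\eta)_{ji}=\partial_{x_j}(\rho_i*\eta)$, where $(\rho_i(t)*\eta)(x)=\int_{\mathbb R^n}\rho_i(t,\xi)\,\eta(x-\xi)\,d\xi$. Solution: for a non trivial real interval $I$,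 $\rho\in C^0(I;L^1(\mathbb R^n;\mathbb R^m))$ is a solution to the system on $I$ if, setting $v_i(t,x)=V_i\big((\nabla\rho*\eta)(t,x)\big)$, each $\rho_i$ is a solution on $I$ of the linear equation $\partial_t\rho_i+\nabla\cdot(\rho_i\,v_i(t,x))=0$, meaning the Lagrangian one: with datum $\rho_{o,i}$ at time $0\in I$, $$\rho_i(t,x)=\rho_{o,i}\big(X_i(0;t,x)\big)\exp\Big(-\int_0^t(\nabla\cdot v_i)\big(\tau,X_i(\tau;t,x)\big)\,d\tau\Big),$$ where $t\mapsto X_i(t;t_o,x_o)$ solves $\dot x=v_i(t,x)$, $x(t_o)=x_o$ (it coincides with the distributional and with the Kružkov entropy solution). Under $(\eta)$ and $(V)$, for every $\rho_o\in(L^1\cap L^\infty\cap BV)(\mathbb R^n;\mathbb R^m)$ there is a unique global solution on $\mathbb R$ with datum $\rho_o$ at time $0$; it is denoted $t\mapsto\mathcal G_t\rho_o$. *)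

theory Defs
  imports "HOL-Analysis.Analysis" "HOL-Probability.Essential_Supremum"
begin

section \<open>Function spaces\<close>

definition partial :: "'a \<Rightarrow> ('a::euclidean_space \<Rightarrow> 'b::real_normed_vector) \<Rightarrow> 'a \<Rightarrow> 'b" where
  "partial b f x = frechet_derivative f (at x) b"

definition partials :: "'a list \<Rightarrow> ('a::euclidean_space \<Rightarrow> 'b::real_normed_vector) \<Rightarrow> 'a \<Rightarrow> 'b" where
  "partials bs f = foldr partial bs f"

primrec C_k :: "nat \<Rightarrow> ('a::euclidean_space \<Rightarrow> 'b::real_normed_vector) \<Rightarrow> bool" where
  "C_k 0 f \<longleftrightarrow> continuous_on UNIV f"
| "C_k (Suc k) f \<longleftrightarrow> (\<forall>x. f differentiable (at x)) \<and> (\<forall>b\<in>Basis. C_k k (partial b f))"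

text \<open>Elements of a Lebesgue space are represented by Lebesgue measurable functions; membership in
  the spaces below and the support depend on the a.e.-class only.\<close>

definition L_one :: "('a::euclidean_space \<Rightarrow> 'b::euclidean_space) \<Rightarrow> bool" where
  "L_one f \<longleftrightarrow> integrable lebesgue f"

definition L_one_loc :: "('a::euclidean_space \<Rightarrow> 'b::euclidean_space) \<Rightarrow> bool" where
  "L_one_loc f \<longleftrightarrow> (\<forall>K. compact K \<longrightarrow> set_integrable lebesgue K f)"

definition L_infty :: "('a::euclidean_space \<Rightarrow> 'b::euclidean_space) \<Rightarrow> bool" where
  "L_infty f \<longleftrightarrow> f \<in> borel_measurable lebesgue \<and> (\<exists>C. AE x in lebesgue. norm (f x) \<le> C)"

definition test_function :: "('a::euclidean_space \<Rightarrow> real) \<Rightarrow> bool" where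
  "test_function \<phi> \<longleftrightarrow> (\<forall>k. C_k k \<phi>) \<and> compact (closure {x. \<phi> x \<noteq> 0})"

definition weak_partials ::
  "'a list \<Rightarrow> ('a::euclidean_space \<Rightarrow> real) \<Rightarrow> ('a \<Rightarrow> real) \<Rightarrow> bool" where
  "weak_partials bs f g \<longleftrightarrow> (\<forall>\<phi>. test_function \<phi> \<longrightarrow>
     (LINT x|lebesgue. f x * partials bs \<phi> x) = (-1) ^ length bs * (LINT x|lebesgue. g x * \<phi> x))"

text \<open>The Sobolev space of order \<open>k\<close> over a Lebesgue space \<open>L\<close>, which is \<^const>\<open>L_one\<close> or
  \<^const>\<open>L_infty\<close>.\<close>

definition sobolev ::
  "nat \<Rightarrow> (('a::euclidean_space \<Rightarrow> real) \<Rightarrow> bool) \<Rightarrow> ('a \<Rightarrow> real) \<Rightarrow> bool" where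
  "sobolev k L f \<longleftrightarrow> L f \<and>
     (\<forall>bs. set bs \<subseteq> Basis \<and> length bs \<le> k \<longrightarrow> (\<exists>g. L g \<and> weak_partials bs f g))"

text \<open>A Radon measure with finite total variation is a difference \<open>\<mu> - \<nu>\<close> of two finite positive
  Borel measures (Jordan decomposition).\<close>

definition BV :: "('a::euclidean_space \<Rightarrow> real) \<Rightarrow> bool" where
  "BV f \<longleftrightarrow> L_one_loc f \<and>
     (\<forall>b\<in>Basis. \<exists>\<mu> \<nu>. finite_measure \<mu> \<and> sets \<mu> = sets borel \<and> finite_measure \<nu> \<and> sets \<nu> = sets borel \<and>
        (\<forall>\<phi>. test_function \<phi> \<longrightarrow>
           (LINT x|lebesgue. f x * partial b \<phi> x) = - ((LINT x|\<mu>. \<phi> x) - (LINT x|\<nu>. \<phi> x))))"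

definition spt :: "('a::euclidean_space \<Rightarrow> real) \<Rightarrow> 'a set" where
  "spt f = - \<Union>{U. open U \<and> (AE x in lebesgue. x \<in> U \<longrightarrow> f x = 0)}"

text \<open>Euclidean norm of the array of all partial derivatives of order \<open>k\<close>.\<close>

definition deriv_norm :: "nat \<Rightarrow> ('a::euclidean_space \<Rightarrow> 'b::real_normed_vector) \<Rightarrow> 'a \<Rightarrow> real" where
  "deriv_norm k f x = L2_set (\<lambda>bs. norm (partials bs f x)) {bs. set bs \<subseteq> Basis \<and> length bs = k}"


section \<open>The assumptions on the kernel and on the velocity\<close>

definition assumption_eta :: "(real^'n \<Rightarrow> real) \<Rightarrow> bool" where
  "assumption_eta \<eta> \<longleftrightarrow> C_k 3 \<eta> \<and> sobolev 3 L_one \<eta> \<and> sobolev 3 L_infty \<eta>"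

text \<open>An \<open>n \<times> m\<close> matrix has type \<open>real^'m^'n\<close>, whose norm is the Euclidean one. The two summands
  below are the essential suprema of the norms of \<open>DV\<close> and \<open>D(DV)\<close>.\<close>

definition assumption_V :: "(real^'m^'n \<Rightarrow> real^'m^'n) \<Rightarrow> bool" where
  "assumption_V V \<longleftrightarrow> C_k 2 V \<and> V 0 = 0 \<and>
     (\<exists>L_V\<ge>0. esssup lebesgue (\<lambda>w. ereal (deriv_norm 1 V w))
             + esssup lebesgue (\<lambda>w. ereal (deriv_norm 2 V w)) \<le> ereal L_V)"


section \<open>Solutions\<close>

definition convolution :: "(real^'n \<Rightarrow> real) \<Rightarrow> (real^'n \<Rightarrow> real) \<Rightarrow> real^'n \<Rightarrow> real" where
  "convolution f g x = (LINT \<xi>|lebesgue. f \<xi> * g (x - \<xi>))"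

definition grad_convolution :: "(real^'n \<Rightarrow> real^'m) \<Rightarrow> (real^'n \<Rightarrow> real) \<Rightarrow> real^'n \<Rightarrow> real^'m^'n" where
  "grad_convolution u \<eta> x = (\<chi> j i. partial (axis j 1) (convolution (\<lambda>\<xi>. u \<xi> $ i) \<eta>) x)"

definition divergence :: "(real^'n \<Rightarrow> real^'n) \<Rightarrow> real^'n \<Rightarrow> real" where
  "divergence F x = (\<Sum>j\<in>UNIV. partial (axis j 1) F x $ j)"

definition continuous_into_L_one :: "real set \<Rightarrow> (real \<Rightarrow> real^'n \<Rightarrow> real^'m) \<Rightarrow> bool" where
  "continuous_into_L_one I \<rho> \<longleftrightarrow> (\<forall>t\<in>I. L_one (\<rho> t)) \<and>
     (\<forall>s\<in>I. ((\<lambda>t. LINT x|lebesgue. norm (\<rho> t x - \<rho> s x)) \<longlongrightarrow> 0) (at s within I))"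

text \<open>\<open>X t t0 x0\<close> is the value at time \<open>t\<close> of the characteristic starting from \<open>x0\<close> at time \<open>t0\<close>.\<close>

definition characteristics ::
  "real set \<Rightarrow> (real \<Rightarrow> real^'n \<Rightarrow> real^'n) \<Rightarrow> (real \<Rightarrow> real \<Rightarrow> real^'n \<Rightarrow> real^'n) \<Rightarrow> bool" where
  "characteristics I u X \<longleftrightarrow> (\<forall>t0\<in>I. \<forall>x0. X t0 t0 x0 = x0 \<and>
     (\<forall>t\<in>I. ((\<lambda>t. X t t0 x0) has_vector_derivative u t (X t t0 x0)) (at t within I)))"

definition lagrangian_solution ::
  "real set \<Rightarrow> (real \<Rightarrow> real^'n \<Rightarrow> real^'n) \<Rightarrow> (real^'n \<Rightarrow> real) \<Rightarrow> (real \<Rightarrow> real^'n \<Rightarrow> real) \<Rightarrow> bool" where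
  "lagrangian_solution I u r0 r \<longleftrightarrow> (\<exists>X. characteristics I u X \<and>
     (\<forall>t\<in>I. AE x in lebesgue.
        r t x = r0 (X 0 t x) * exp (- (LBINT \<tau>=0..t. divergence (u \<tau>) (X \<tau> t x)))))"

definition velocity ::
  "(real^'m^'n \<Rightarrow> real^'m^'n) \<Rightarrow> (real^'n \<Rightarrow> real) \<Rightarrow> (real \<Rightarrow> real^'n \<Rightarrow> real^'m) \<Rightarrow> 'm
     \<Rightarrow> real \<Rightarrow> real^'n \<Rightarrow> real^'n" where
  "velocity V \<eta> \<rho> i t x = column i (V (grad_convolution (\<rho> t) \<eta> x))"

definition system_solution ::
  "real set \<Rightarrow> (real^'m^'n \<Rightarrow> real^'m^'n) \<Rightarrow> (real^'n \<Rightarrow> real)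
     \<Rightarrow> (real^'n \<Rightarrow> real^'m) \<Rightarrow> (real \<Rightarrow> real^'n \<Rightarrow> real^'m) \<Rightarrow> bool" where
  "system_solution I V \<eta> \<rho>0 \<rho> \<longleftrightarrow>
     is_interval I \<and> 0 \<in> I \<and> I \<noteq> {0} \<and> continuous_into_L_one I \<rho> \<and>
     (\<forall>i. lagrangian_solution I (velocity V \<eta> \<rho> i) (\<lambda>x. \<rho>0 x $ i) (\<lambda>t x. \<rho> t x $ i))"

end

theory Submission
  imports Defs
begin

text \<open>Two facts make the statement true: the balls trap the particles of species \<open>i\<close>, and the density
of species \<open>i\<close> is carried along by the flow of its velocity.

The first one is geometric. Since \<open>V w = v (norm w) w\<close> with \<open>v > 0\<close>, the velocity of species \<open>i\<close> is
a nonnegative multiple of the gradient of \<open>\<rho>\<^sub>i * \<eta>\<close>. The kernel is radial and decreasing, so at a point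
\<open>p\<close> this gradient is a superposition, with nonnegative
weights since \<open>\<rho>\<^sub>i\<close> is nonnegative, of the vectors \<open>\<xi> - p\<close> over the points \<open>\<xi>\<close>
of the mass of \<open>\<rho>\<^sub>i\<close> at distance at most \<open>l\<close> from \<open>p\<close>. By the separation hypothesis, a particle in one of
the balls is attracted by the mass in the same ball only. If it is, among the particles that started in
a smaller concentric ball, the one farthest from the centre, then all that mass lies in the ball
through it, and it is pushed inwards. Hence the farthest distance cannot increase.

The maximum over the particles is not differentiated. Instead, let \<open>m\<close> be the supremum of the squared
distances to the centre over all particles of the ball and over a whole time interval. Lemma
\<open>inward_drift\<close> leads to a bound \<open>\<kappa> (m - b)\<close> on the derivative of every single squared distance \<open>b\<close>. A
particle that starts below the level \<open>R\<^sup>2\<close> therefore stays below \<open>m\<close> by a fixed fraction of \<open>m - R\<^sup>2\<close>,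
which contradicts the definition of \<open>m\<close> unless \<open>m \<le> R\<^sup>2\<close>. This is \<open>invariant_balls\<close>. It needs some
room in order to know in advance that, for a short time, particles do not come within the range of
another ball. The room is there because the initial support is compact: it lies in closed balls
of radius \<open>r\<^sub>h - \<epsilon>\<close>, and the length of the time step depends on \<open>\<epsilon>\<close> and on the maximal speed only.

The second fact is Liouville's formula: if \<open>X\<close> is the flow of a field \<open>u\<close>, then the image under
\<open>X 0 t\<close> of the measure with density \<open>exp (- \<integral> div u)\<close>, the exponent being taken along the characteristic
that passes through the point at time \<open>t\<close>, is Lebesgue measure (\<open>flow_pushforward\<close>). The proof does not
differentiate the flow in space. For a Lipschitz function \<open>f\<close> with bounded support put
\<open>F t = \<integral> f (X 0 t x) exp (- \<integral> div u) dx\<close>. In \<open>F (s + h)\<close> the Euler step \<open>x = z + h u s z\<close> is used as a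
change of variables, with Jacobian \<open>1 + h div u + O(h\<^sup>2)\<close>. The Euler step differs from the flow by
\<open>o(h)\<close>, and the Jacobian cancels the new factor of the exponential up to \<open>o(h)\<close>. So \<open>F\<close> has derivative
zero, and \<open>F t = F 0 = \<integral> f\<close>. Approximating indicators of boxes by Lipschitz functions gives the equality
of the measures.

Both facts require a velocity that is bounded and differentiable in space with Lipschitz derivative,
and continuous in time, uniformly in space. These properties are collected in the locale
\<open>regular_field\<close>. They hold for \<open>\<nabla>\<rho> * \<eta>\<close> because \<open>\<eta>\<close> has compact support, so that its derivatives up
to order three are bounded, and because \<open>\<rho>\<close> is continuous in time with values in \<open>L\<^sup>1\<close>
(\<open>grad_convolution_regular\<close>). They are preserved by composition with the \<open>C\<^sup>2\<close> function \<open>V\<close>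
(\<open>regular_field_compose\<close>), since \<open>\<nabla>\<rho> * \<eta>\<close> takes its values in a bounded set.\<close>

section \<open>Change of variables for maps close to the identity\<close>

lemma prod_one_plus_bound:
  fixes a :: "'i \<Rightarrow> real"
  assumes "finite S" "\<And>i. i \<in> S \<Longrightarrow> \<bar>a i\<bar> \<le> h * K" "0 \<le> h" "h \<le> 1" "0 \<le> K"
  shows "\<bar>(\<Prod>i\<in>S. 1 + a i) - 1 - (\<Sum>i\<in>S. a i)\<bar> \<le> h\<^sup>2 * K\<^sup>2 * (card S)\<^sup>2 * (1 + K) ^ card S"
  using assms(1,2)
proof (induction S rule: finite_induct)
  case empty
  then show ?case by simp
next
  case (insert j S)
  let ?P = "\<Prod>i\<in>S. 1 + a i" and ?S = "\<Sum>i\<in>S. a i" and ?c = "1 + K" and ?n = "real (card S)"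
  have aj: "\<bar>a j\<bar> \<le> h * K" using insert by auto
  have hK: "h * K \<le> K" using assms by (simp add: mult_left_le_one_le)
  have IH: "\<bar>?P - 1 - ?S\<bar> \<le> h\<^sup>2 * K\<^sup>2 * ?n\<^sup>2 * ?c ^ card S" using insert by auto
  have S: "\<bar>?S\<bar> \<le> ?n * (h * K)"
    using sum_norm_bound[of S a "h*K"] insert.prems by (auto simp: mult.commute)
  have "\<bar>(\<Prod>i\<in>insert j S. 1 + a i) - 1 - (\<Sum>i\<in>insert j S. a i)\<bar> = \<bar>(?P - 1 - ?S) * (1 + a j) + a j * ?S\<bar>"
    using insert.hyps by (simp add: algebra_simps)
  also have "\<dots> \<le> \<bar>?P - 1 - ?S\<bar> * \<bar>1 + a j\<bar> + \<bar>a j\<bar> * \<bar>?S\<bar>"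
    by (metis abs_mult abs_triangle_ineq)
  also have "\<dots> \<le> (h\<^sup>2 * K\<^sup>2 * ?n\<^sup>2 * ?c ^ card S) * ?c + (h * K) * (?n * (h * K))"
    using IH S aj hK assms by (intro add_mono mult_mono) auto
  also have "\<dots> = h\<^sup>2 * K\<^sup>2 * (?n\<^sup>2 * ?c ^ Suc (card S) + ?n)"
    by (simp add: algebra_simps power2_eq_square)
  also have "\<dots> \<le> h\<^sup>2 * K\<^sup>2 * ((?n + 1)\<^sup>2 * ?c ^ Suc (card S))"
  proof (intro mult_left_mono)
    have "1 \<le> ?c ^ Suc (card S)" using assms by (intro one_le_power) auto
    then have "?n * 1 \<le> (2 * ?n + 1) * ?c ^ Suc (card S)" by (intro mult_mono) auto
    then show "?n\<^sup>2 * ?c ^ Suc (card S) + ?n \<le> (?n + 1)\<^sup>2 * ?c ^ Suc (card S)"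
      by (simp add: power2_eq_square distrib_right distrib_left mult_ac del: power_Suc)
  qed (use assms in auto)
  finally show ?case using insert.hyps by (simp add: algebra_simps)
qed

text \<open>In the Leibniz formula a permutation other than the identity moves at least two indices, so its product
contains two off-diagonal entries, which are of order \<open>h\<close>. Only the product of the diagonal entries
contributes to first order.\<close>

lemma det_near_identity:
  fixes A :: "real^'n^'n"
  assumes A: "\<And>i j. \<bar>A $ i $ j\<bar> \<le> K" and h: "0 \<le> h" "h \<le> 1"
  shows "\<bar>det (mat 1 + h *\<^sub>R A) - 1 - h * (\<Sum>i\<in>UNIV. A $ i $ i)\<bar>
    \<le> (K\<^sup>2 * CARD('n)\<^sup>2 * (1 + K) ^ CARD('n) + fact CARD('n) * (K\<^sup>2 * (1 + K) ^ CARD('n))) * h\<^sup>2"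
proof -
  let ?U = "UNIV :: 'n set"
  let ?E = "mat 1 + h *\<^sub>R A"
  let ?c = "1 + K"
  have K: "0 \<le> K" using A[of undefined undefined] by linarith
  have hK: "h * K \<le> K" using h K by (simp add: mult_left_le_one_le)
  have hA: "\<bar>h * A $ i $ j\<bar> \<le> h * K" for i j using A h by (simp add: abs_mult mult_left_mono)
  have Eij: "\<bar>?E $ i $ j\<bar> \<le> ?c" for i j
    using hA[of i j] hK K by (auto simp: mat_def) 
  have small: "\<bar>of_int (sign p) * (\<Prod>i\<in>?U. ?E $ i $ p i)\<bar> \<le> h\<^sup>2 * (K\<^sup>2 * ?c ^ CARD('n))"
    if p: "p permutes ?U" "p \<noteq> id" for p
  proof -
    obtain i where i: "p i \<noteq> i" using p(2) by fastforce
    have pp: "p (p i) \<noteq> p i" using i p(1) permutes_inj by (metis injD)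
    have "\<bar>of_int (sign p) * (\<Prod>i\<in>?U. ?E $ i $ p i)\<bar> = (\<Prod>i\<in>?U. \<bar>?E $ i $ p i\<bar>)"
      by (simp add: abs_mult abs_prod sign_def)
    also have "\<dots> = \<bar>?E $ i $ p i\<bar> * (\<bar>?E $ p i $ p (p i)\<bar> * (\<Prod>i\<in>?U - {i} - {p i}. \<bar>?E $ i $ p i\<bar>))"
      using i by (subst prod.remove[of _ i], simp, simp, subst prod.remove[of _ "p i"], auto)
    also have "\<dots> \<le> (h * K) * ((h * K) * ?c ^ CARD('n))"
    proof (intro mult_mono)
      show "\<bar>?E $ i $ p i\<bar> \<le> h * K" using hA i by (simp add: mat_def)
      show "\<bar>?E $ p i $ p (p i)\<bar> \<le> h * K" using hA pp by (simp add: mat_def)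
      have "(\<Prod>i\<in>?U - {i} - {p i}. \<bar>?E $ i $ p i\<bar>) \<le> (\<Prod>i\<in>?U - {i} - {p i}. ?c)"
        by (intro prod_mono conjI Eij) auto
      also have "\<dots> = ?c ^ card (?U - {i} - {p i})" by simp
      also have "\<dots> \<le> ?c ^ CARD('n)" using K by (intro power_increasing card_mono) auto
      finally show "(\<Prod>i\<in>?U - {i} - {p i}. \<bar>?E $ i $ p i\<bar>) \<le> ?c ^ CARD('n)" .
    qed (use h K in \<open>auto intro!: prod_nonneg mult_nonneg_nonneg\<close>)
    also have "\<dots> = h\<^sup>2 * (K\<^sup>2 * ?c ^ CARD('n))" by (simp add: power2_eq_square)
    finally show ?thesis .
  qed
  let ?P = "{p. p permutes ?U}"
  let ?f = "\<lambda>p. of_int (sign p) * (\<Prod>i\<in>?U. ?E $ i $ p i)"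
  have fin: "finite ?P" by (simp add: finite_permutations)
  have "det ?E = ?f id + sum ?f (?P - {id})"
    unfolding det_def using fin by (subst sum.remove[of _ id]) (auto simp: permutes_id)
  moreover have "?f id = (\<Prod>i\<in>?U. 1 + h * A $ i $ i)" by (simp add: sign_id mat_def)
  moreover have "\<bar>sum ?f (?P - {id})\<bar> \<le> fact CARD('n) * (h\<^sup>2 * (K\<^sup>2 * ?c ^ CARD('n)))"
  proof -
    have "norm (sum ?f (?P - {id})) \<le> real (card (?P - {id})) * (h\<^sup>2 * (K\<^sup>2 * ?c ^ CARD('n)))"
      by (rule sum_norm_bound) (use small in auto)
    also have "\<dots> \<le> fact CARD('n) * (h\<^sup>2 * (K\<^sup>2 * ?c ^ CARD('n)))"
    proof (intro mult_right_mono)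
      have "card (?P - {id}) \<le> card ?P" using fin by (intro card_mono) auto
      also have "\<dots> = fact CARD('n)" by (rule card_permutations) auto
      finally show "real (card (?P - {id})) \<le> fact CARD('n)"
        by (metis of_nat_fact of_nat_le_iff)
    qed (use K in auto)
    finally show ?thesis by simp
  qed
  moreover have "\<bar>(\<Prod>i\<in>?U. 1 + h * A $ i $ i) - 1 - (\<Sum>i\<in>?U. h * A $ i $ i)\<bar>
      \<le> h\<^sup>2 * K\<^sup>2 * (CARD('n))\<^sup>2 * ?c ^ CARD('n)"
    by (rule prod_one_plus_bound) (use hA h K in auto)
  ultimately show ?thesis
    by (simp add: algebra_simps sum_distrib_left)
qed

text \<open>Injectivity holds because \<open>h w\<close> has Lipschitz constant at most \<open>1/2\<close>. For surjectivity, the equation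
\<open>z + h w z = y\<close> is the fixed point equation of the contraction \<open>z \<mapsto> y - h w z\<close>.\<close>

lemma near_identity_bij:
  fixes w :: "'a::euclidean_space \<Rightarrow> 'a"
  assumes lip: "\<And>x y. norm (w x - w y) \<le> K * norm (x - y)" and h: "0 \<le> h" "h * K \<le> 1/2"
  shows "bij (\<lambda>z. z + h *\<^sub>R w z)"
proof (rule bijI)
  have small: "norm (h *\<^sub>R w x - h *\<^sub>R w y) \<le> 1/2 * norm (x - y)" for x y
  proof -
    have "norm (h *\<^sub>R w x - h *\<^sub>R w y) = h * norm (w x - w y)"
      using h by (simp flip: scaleR_diff_right)
    also have "\<dots> \<le> h * (K * norm (x - y))" using h lip by (intro mult_left_mono) auto
    also have "\<dots> = (h * K) * norm (x - y)" by simp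
    also have "\<dots> \<le> 1/2 * norm (x - y)" using h by (intro mult_right_mono) auto
    finally show ?thesis .
  qed
  show "inj (\<lambda>z. z + h *\<^sub>R w z)"
  proof (rule injI)
    fix x y assume "x + h *\<^sub>R w x = y + h *\<^sub>R w y"
    then have "x - y = h *\<^sub>R w y - h *\<^sub>R w x" by (simp add: algebra_simps)
    then have "norm (x - y) \<le> 1/2 * norm (y - x)" using small[of y x] by simp
    then show "x = y" by (simp add: norm_minus_commute)
  qed
  show "surj (\<lambda>z. z + h *\<^sub>R w z)"
  proof (unfold surj_def, rule allI)
    fix y
    have "\<exists>!x. y - h *\<^sub>R w x = x"
    proof (rule banach_fix_type[where c="1/2"])
      show "\<forall>a b. dist (y - h *\<^sub>R w a) (y - h *\<^sub>R w b) \<le> 1/2 * dist a b"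
      proof (intro allI)
        fix a b
        have "norm (y - h *\<^sub>R w a - (y - h *\<^sub>R w b)) = norm (h *\<^sub>R w b - h *\<^sub>R w a)"
          by (simp add: algebra_simps)
        then show "dist (y - h *\<^sub>R w a) (y - h *\<^sub>R w b) \<le> 1/2 * dist a b"
          using small[of b a] by (simp add: dist_norm norm_minus_commute)
      qed
    qed auto
    then obtain x where "y - h *\<^sub>R w x = x" by auto
    then show "\<exists>x. y = x + h *\<^sub>R w x" by (metis diff_add_cancel)
  qed
qed

lemma derivative_bound_Lipschitz:
  fixes w :: "'a::euclidean_space \<Rightarrow> 'b::euclidean_space"
  assumes "\<And>z. (w has_derivative Dw z) (at z)" "\<And>z y. norm (Dw z y) \<le> K * norm y"
  shows "norm (w x - w y) \<le> K * norm (x - y)"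
proof (rule differentiable_bound[where S=UNIV and f'=Dw])
  show "onorm (Dw z) \<le> K" for z
    by (rule onorm_le) (use assms in auto)
qed (use assms in auto)

text \<open>The formula for vector-valued integrands, applied to \<open>F\<close> times a unit vector of \<open>real^1\<close>.\<close>

lemma change_of_variables_vec:
  fixes g :: "real^'n::{finite,wellorder} \<Rightarrow> real^'n::_" and F :: "real^'n::_ \<Rightarrow> real"
  assumes g: "\<And>z. (g has_derivative g' z) (at z)" and "bij g"
    and F: "integrable lebesgue F"
  shows "integrable lebesgue (\<lambda>z. \<bar>det (matrix (g' z))\<bar> * F (g z)) \<and>
    (LINT z|lebesgue. \<bar>det (matrix (g' z))\<bar> * F (g z)) = integral\<^sup>L lebesgue F"
proof -
  let ?J = "\<lambda>z. \<bar>det (matrix (g' z))\<bar>"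
  let ?c = "axis 1 1 :: real^1"
  have cc: "(r *\<^sub>R ?c) \<bullet> ?c = r" for r by (simp add: inner_axis)
  have ai: "G absolutely_integrable_on UNIV \<longleftrightarrow> integrable lebesgue G" for G :: "real^'n::_ \<Rightarrow> real"
    by (simp add: set_integrable_def)
  have ai1: "(\<lambda>z. G z *\<^sub>R ?c) absolutely_integrable_on UNIV \<longleftrightarrow> G absolutely_integrable_on UNIV"
    for G :: "real^'n::_ \<Rightarrow> real"
  proof
    assume "(\<lambda>z. G z *\<^sub>R ?c) absolutely_integrable_on UNIV"
    from absolutely_integrable_linear[OF this bounded_linear_inner_left[of ?c]]
    show "G absolutely_integrable_on UNIV" by (simp add: o_def cc)
  next
    assume "G absolutely_integrable_on UNIV"
    from absolutely_integrable_linear[OF this bounded_linear_scaleR_left[of ?c]]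
    show "(\<lambda>z. G z *\<^sub>R ?c) absolutely_integrable_on UNIV" by (simp add: o_def)
  qed
  have int1: "integral UNIV (\<lambda>z. G z *\<^sub>R ?c) = integral UNIV G *\<^sub>R ?c"
    if "G absolutely_integrable_on UNIV" for G :: "real^'n::_ \<Rightarrow> real"
    using integral_linear[OF set_lebesgue_integral_eq_integral(1)[OF that] bounded_linear_scaleR_left[of ?c]]
    by (simp add: o_def)
  have FF: "(\<lambda>z. F z *\<^sub>R ?c) absolutely_integrable_on range g"
    using F \<open>bij g\<close> by (simp add: ai1 ai bij_is_surj)
  have *: "(\<lambda>z. ?J z *\<^sub>R (F (g z) *\<^sub>R ?c)) absolutely_integrable_on UNIV \<and>
      integral UNIV (\<lambda>z. ?J z *\<^sub>R (F (g z) *\<^sub>R ?c)) = integral (range g) (\<lambda>z. F z *\<^sub>R ?c)"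
    by (subst has_absolute_integral_change_of_variables[of UNIV g g' "\<lambda>z. F z *\<^sub>R ?c"])
      (use g \<open>bij g\<close> FF in \<open>auto simp: bij_is_inj\<close>)
  then have J: "(\<lambda>z. ?J z * F (g z)) absolutely_integrable_on UNIV"
    using ai1[of "\<lambda>z. ?J z * F (g z)"] by simp
  have "integral UNIV (\<lambda>z. ?J z * F (g z)) *\<^sub>R ?c = integral UNIV F *\<^sub>R ?c"
    using * int1[OF J] int1[of F] F ai[of F] \<open>bij g\<close> by (simp add: bij_is_surj)
  then have "integral UNIV (\<lambda>z. ?J z * F (g z)) = integral UNIV F"
    by (metis cc)
  then show ?thesis using J F ai
    by (simp add: integral_lebesgue)
qed

text \<open>The change of variables formula concerns vectors with a well-ordered index type. This type, a copy of
the numbers below \<open>DIM('a)\<close>, indexes the coordinates of an arbitrary Euclidean space \<open>'a\<close>.\<close>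

typedef (overloaded) ('a::euclidean_space) coord = "{..<DIM('a)}"
  by (intro exI[of _ 0]) simp

setup_lifting type_definition_coord

instantiation coord :: (euclidean_space) wellorder
begin
lift_definition less_eq_coord :: "'a coord \<Rightarrow> 'a coord \<Rightarrow> bool" is "(\<le>)" .
lift_definition less_coord :: "'a coord \<Rightarrow> 'a coord \<Rightarrow> bool" is "(<)" .
instance
proof
  fix P :: "'a coord \<Rightarrow> bool" and a
  assume *: "\<And>x. (\<And>y. y < x \<Longrightarrow> P y) \<Longrightarrow> P x"
  show "P a"
    by (induction a rule: measure_induct_rule[of Rep_coord]) (use * in \<open>auto simp: less_coord.rep_eq\<close>)
qed (transfer; force)+
end

lemma bij_betw_Rep_coord: "bij_betw Rep_coord (UNIV :: 'a::euclidean_space coord set) {..<DIM('a)}"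
  by (simp add: bij_betw_def inj_on_def Rep_coord_inject type_definition.Rep_range[OF type_definition_coord])

instance coord :: (euclidean_space) finite
  by standard (metis bij_betw_Rep_coord bij_betw_finite finite_lessThan)

text \<open>The first summand bounds the quadratic part of the product of the diagonal entries \<open>1 + h a\<close> of an
\<open>n \<times> n\<close> matrix, the second one the contribution of the other permutations to the determinant.\<close>

definition near_identity_constant :: "real \<Rightarrow> nat \<Rightarrow> real" where
  "near_identity_constant K n = K\<^sup>2 * n\<^sup>2 * (1 + K) ^ n + fact n * (K\<^sup>2 * (1 + K) ^ n)"

lemma near_identity_change_of_variables_vec:
  fixes w :: "real^'n::{finite,wellorder} \<Rightarrow> real^'n::_" and Dw :: "real^'n::_ \<Rightarrow> real^'n::_ \<Rightarrow> real^'n::_"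
    and K h :: real
  assumes K: "0 \<le> K"
    and w: "\<And>z. (w has_derivative Dw z) (at z)" "\<And>z y. norm (Dw z y) \<le> K * norm y"
      "\<And>y. continuous_on UNIV (\<lambda>z. Dw z y)"
    and h: "0 \<le> h" "h \<le> 1" "h * ((CARD('n) + 1) * K) \<le> 1/2"
  shows "\<exists>J\<in>borel_measurable borel.
    (\<forall>z. \<bar>J z - 1 - h * (\<Sum>j\<in>UNIV. Dw z (axis j 1) $ j)\<bar> \<le> near_identity_constant K CARD('n) * h\<^sup>2) \<and>
    (\<forall>F. integrable lborel F \<longrightarrow> integrable lborel (\<lambda>z. J z * F (z + h *\<^sub>R w z)) \<and>
      (LINT z|lborel. J z * F (z + h *\<^sub>R w z)) = integral\<^sup>L lborel F)"
proof -
  let ?g = "\<lambda>z. z + h *\<^sub>R w z"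
  let ?g' = "\<lambda>z y. y + h *\<^sub>R Dw z y"
  let ?J = "\<lambda>z. \<bar>det (matrix (?g' z))\<bar>"
  have hn: "0 \<le> h * (CARD('n) * K)" and hK: "0 \<le> h * K" using h K by auto
  have sp: "h * (CARD('n) * K) + h * K \<le> 1/2" using h(3) by (simp add: algebra_simps)
  have entry: "\<bar>Dw z (axis j 1) $ i\<bar> \<le> K" for z i j
    using component_le_norm_cart[of "Dw z (axis j 1)" i] w(2)[of z "axis j 1"] by (simp add: norm_axis_1)
  have mat: "matrix (?g' z) = mat 1 + h *\<^sub>R matrix (Dw z)" for z
    by (simp add: matrix_def vec_eq_iff mat_def axis_def)
  have J: "\<bar>?J z - 1 - h * (\<Sum>j\<in>UNIV. Dw z (axis j 1) $ j)\<bar> \<le> near_identity_constant K CARD('n) * h\<^sup>2" for z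
  proof -
    let ?s = "\<Sum>j\<in>UNIV. Dw z (axis j 1) $ j"
    have "\<bar>det (mat 1 + h *\<^sub>R matrix (Dw z)) - 1 - h * ?s\<bar> \<le> near_identity_constant K CARD('n) * h\<^sup>2"
      unfolding near_identity_constant_def
      using det_near_identity[of "matrix (Dw z)" K h] entry h by (simp add: matrix_def)
    moreover have "\<bar>?s\<bar> \<le> CARD('n) * K"
      using sum_norm_bound[of UNIV "\<lambda>j. Dw z (axis j 1) $ j" K] entry by simp
    then have "\<bar>h * ?s\<bar> \<le> h * (CARD('n) * K)" using h by (simp add: abs_mult mult_left_mono)
    then have "0 \<le> 1 + h * ?s" using sp hK by linarith
    ultimately show ?thesis unfolding mat by linarith
  qed
  have contJ: "continuous_on UNIV ?J"
    unfolding det_def mat by (simp add: matrix_def) (intro continuous_intros w(3))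
  have g: "(?g has_derivative ?g' z) (at z)" for z
    by (auto intro!: derivative_eq_intros w(1))
  have bij: "bij ?g"
    by (rule near_identity_bij[where K=K])
      (use derivative_bound_Lipschitz[OF w(1,2)] h sp hn in auto)
  have contg: "continuous_on UNIV ?g"
    by (rule differentiable_imp_continuous_on)
      (use g in \<open>auto simp: differentiable_on_def differentiable_def intro: has_derivative_at_withinI\<close>)
  have int: "integrable lborel (\<lambda>z. ?J z * F (?g z)) \<and> (LINT z|lborel. ?J z * F (?g z)) = integral\<^sup>L lborel F"
    if F: "integrable lborel F" for F :: "real^'n::_ \<Rightarrow> real"
  proof -
    have FL: "integrable lebesgue F" using F by (simp add: integrable_completion)
    have Fm: "F \<in> borel_measurable borel" using F by auto
    have JF: "(\<lambda>z. ?J z * F (?g z)) \<in> borel_measurable borel"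
      by (intro borel_measurable_times borel_measurable_continuous_onI contJ
          measurable_compose[OF _ Fm] contg)
    show ?thesis
      using change_of_variables_vec[OF g bij FL] JF F by (simp add: integrable_completion integral_completion)
  qed
  show ?thesis
    using J int borel_measurable_continuous_onI[OF contJ] by (intro bexI[of _ ?J]) auto
qed

text \<open>\<open>T\<close> lists the coordinates of a point with respect to \<open>Basis\<close>. It maps boxes to boxes with the same side
lengths, hence preserves Lebesgue measure, and conjugation with it does not change the trace.\<close>

lemma exists_coordinate_isometry:
  obtains T :: "'a::euclidean_space \<Rightarrow> real^'a coord" and S where "linear T" "linear S"
    "\<And>x. S (T x) = x" "\<And>v. T (S v) = v" "\<And>x. norm (T x) = norm x"
    "distr lborel borel T = lborel"
    "\<And>A. linear A \<Longrightarrow> (\<Sum>j\<in>UNIV. T (A (S (axis j 1))) $ j) = (\<Sum>b\<in>Basis. A b \<bullet> b)"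
proof -
  have "card (UNIV :: 'a coord set) = card (Basis :: 'a set)"
    using bij_betw_same_card[OF bij_betw_Rep_coord] by auto
  then obtain e where e: "bij_betw e (UNIV :: 'a coord set) (Basis :: 'a set)"
    using finite_same_card_bij[of "UNIV :: 'a coord set" "Basis :: 'a set"] by auto
  have Be: "Basis = range e" using e by (simp add: bij_betw_def)
  have eB: "e j \<in> Basis" for j using e by (auto simp: bij_betw_def)
  have ee: "e i \<bullet> e j = (if i = j then 1 else 0)" for i j
    using eB e by (auto simp: inner_Basis bij_betw_def inj_on_def)
  define T :: "'a \<Rightarrow> real^'a coord" where "T x = (\<chi> j. x \<bullet> e j)" for x
  define S :: "real^'a coord \<Rightarrow> 'a" where "S v = (\<Sum>j\<in>UNIV. v $ j *\<^sub>R e j)" for v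
  have lT: "linear T" by (auto intro!: linearI simp: T_def vec_eq_iff inner_add_left)
  have lS: "linear S"
    by (auto intro!: linearI simp: S_def scaleR_left_distrib sum.distrib scaleR_sum_right)
  have ST: "S (T x) = x" for x
    unfolding S_def T_def
    by (simp add: sum.reindex_bij_betw[OF e, of "\<lambda>b. (x \<bullet> b) *\<^sub>R b"] euclidean_representation)
  have TS: "T (S v) = v" for v
    by (simp add: T_def S_def vec_eq_iff inner_sum_left ee if_distrib[of "\<lambda>x. _ * x"] cong: if_cong)
  have nT: "norm (T x) = norm x" for x
  proof -
    have "(norm (T x))\<^sup>2 = (\<Sum>j\<in>UNIV. (x \<bullet> e j)\<^sup>2)"
      by (simp add: power2_norm_eq_inner inner_vec_def T_def) (simp add: power2_eq_square)
    also have "\<dots> = (\<Sum>b\<in>Basis. (x \<bullet> b)\<^sup>2)" by (rule sum.reindex_bij_betw[OF e])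
    also have "\<dots> = (norm x)\<^sup>2"
      by (simp add: power2_norm_eq_inner euclidean_inner[of x x]) (simp add: power2_eq_square)
    finally show ?thesis by (simp add: power2_eq_iff_nonneg)
  qed
  have Tm: "T \<in> borel_measurable borel"
    using lT by (intro borel_measurable_continuous_onI linear_continuous_on) (simp add: linear_conv_bounded_linear)
  have dT: "lborel = distr lborel borel T"
  proof (rule lborel_eqI)
    fix l u :: "real^'a coord"
    assume lu: "\<And>b. b \<in> Basis \<Longrightarrow> l \<bullet> b \<le> u \<bullet> b"
    have Sb: "S v \<bullet> e j = v $ j" for v j using TS[of v] by (simp add: T_def vec_eq_iff)
    have le: "l $ j \<le> u $ j" for j using lu[of "axis j 1"] by (simp add: cart_eq_inner_axis[symmetric] inner_commute axis_in_Basis_iff inner_axis)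
    have Sle: "S l \<bullet> b \<le> S u \<bullet> b" if "b \<in> Basis" for b
      using that le Sb by (auto simp: Be)
    have vim: "T -` box l u = box (S l) (S u)"
    proof -
      have "x \<in> box (S l) (S u) \<longleftrightarrow> (\<forall>j. S l \<bullet> e j < x \<bullet> e j \<and> x \<bullet> e j < S u \<bullet> e j)" for x
        by (simp add: mem_box Be)
      then show ?thesis by (auto simp: mem_box_cart Sb T_def)
    qed
    have "emeasure (distr lborel borel T) (box l u) = emeasure lborel (box (S l) (S u))"
      using Tm by (subst emeasure_distr) (auto simp: vim)
    also have "\<dots> = (\<Prod>b\<in>Basis. (S u - S l) \<bullet> b)" using Sle by (rule emeasure_lborel_box)
    also have "(\<Prod>b\<in>Basis. (S u - S l) \<bullet> b) = (\<Prod>j\<in>UNIV. (S u - S l) \<bullet> e j)"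
      by (rule prod.reindex_bij_betw[OF e, symmetric])
    also have "\<dots> = (\<Prod>j\<in>UNIV. (u - l) $ j)" by (simp add: inner_diff_left Sb)
    also have "\<dots> = (\<Prod>b\<in>Basis. (u - l) \<bullet> b)"
      unfolding Basis_vec_def
      by (subst prod.UNION_disjoint) (auto simp: axis_eq_axis inner_axis)
    finally show "emeasure (distr lborel borel T) (box l u) = (\<Prod>b\<in>Basis. (u - l) \<bullet> b)" .
  qed simp
  have tr: "(\<Sum>j\<in>UNIV. T (A (S (axis j 1))) $ j) = (\<Sum>b\<in>Basis. A b \<bullet> b)" if "linear A" for A
  proof -
    have "S (axis j 1) = e j" for j
      by (simp add: S_def axis_def if_distrib[of "\<lambda>x. x *\<^sub>R _"] cong: if_cong)
    then show ?thesis by (simp add: T_def sum.reindex_bij_betw[OF e, of "\<lambda>b. A b \<bullet> b"])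
  qed
  show thesis by (rule that[OF lT lS ST TS nT dT[symmetric] tr])
qed

text \<open>The Jacobian \<open>J\<close> of \<open>z \<mapsto> z + h w z\<close> is hidden behind its first-order expansion: the flow estimates
below use nothing else about it. The condition on \<open>h\<close> makes the map bijective and its Jacobian determinant
comparable with \<open>1 + h trace (Dw z) \<ge> 0\<close>.\<close>

lemma near_identity_change_of_variables:
  fixes w :: "'a::euclidean_space \<Rightarrow> 'a" and Dw :: "'a \<Rightarrow> 'a \<Rightarrow> 'a" and K h :: real
  assumes K: "0 \<le> K"
    and w: "\<And>z. (w has_derivative Dw z) (at z)" "\<And>z y. norm (Dw z y) \<le> K * norm y"
      "\<And>y. continuous_on UNIV (\<lambda>z. Dw z y)"
    and h: "0 \<le> h" "h \<le> 1" "h * ((DIM('a) + 1) * K) \<le> 1/2"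
  shows "\<exists>J\<in>borel_measurable borel.
    (\<forall>z. \<bar>J z - 1 - h * (\<Sum>b\<in>Basis. Dw z b \<bullet> b)\<bar> \<le> near_identity_constant K DIM('a) * h\<^sup>2) \<and>
    (\<forall>F. integrable lborel F \<longrightarrow> integrable lborel (\<lambda>z. J z * F (z + h *\<^sub>R w z)) \<and>
      (LINT z|lborel. J z * F (z + h *\<^sub>R w z)) = integral\<^sup>L lborel F)"
proof -
  have card: "CARD('a coord) = DIM('a)"
    using bij_betw_same_card[OF bij_betw_Rep_coord[where 'a='a]] by simp
  obtain T :: "'a \<Rightarrow> real^'a coord" and S where TS: "linear T" "linear S"
    "\<And>x. S (T x) = x" "\<And>v. T (S v) = v" "\<And>x. norm (T x) = norm x"
    "distr lborel borel T = lborel"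
    "\<And>A. linear A \<Longrightarrow> (\<Sum>j\<in>UNIV. T (A (S (axis j 1))) $ j) = (\<Sum>b\<in>Basis. A b \<bullet> b)"
    using exists_coordinate_isometry by blast
  have nS: "norm (S v) = norm v" for v by (metis TS(4,5))
  have blT: "bounded_linear T" and blS: "bounded_linear S"
    using TS by (auto simp: linear_conv_bounded_linear)
  have Tm: "T \<in> borel_measurable borel" and Sm: "S \<in> borel_measurable borel"
    using blT blS by (auto intro!: borel_measurable_continuous_onI linear_continuous_on)
  let ?w = "\<lambda>v. T (w (S v))" and ?Dw = "\<lambda>v y. T (Dw (S v) (S y))"
  have w1: "(?w has_derivative ?Dw v) (at v)" for v
  proof -
    have "(w \<circ> S has_derivative Dw (S v) \<circ> S) (at v)"
      by (rule diff_chain_at[OF bounded_linear.has_derivative[OF blS has_derivative_ident] w(1)])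
    from bounded_linear.has_derivative[OF blT this] show ?thesis by (simp add: o_def)
  qed
  have w2: "norm (?Dw v y) \<le> K * norm y" for v y
    using w(2)[of "S v" "S y"] by (simp add: TS nS)
  have w3: "continuous_on UNIV (\<lambda>v. ?Dw v y)" for y
    by (intro continuous_on_compose2[OF linear_continuous_on[OF blT]]
        continuous_on_compose2[OF w(3) linear_continuous_on[OF blS]]) auto
  note vec = near_identity_change_of_variables_vec[where w="?w" and Dw="?Dw" and K=K and h=h, unfolded card,
      OF K w1 w2 w3 h]
  from vec show ?thesis
  proof (rule bexE)
    fix J :: "real^'a coord \<Rightarrow> real"
    assume J: "J \<in> borel_measurable borel"
    assume JJ: "(\<forall>v. \<bar>J v - 1 - h * (\<Sum>j\<in>UNIV. ?Dw v (axis j 1) $ j)\<bar> \<le> near_identity_constant K DIM('a) * h\<^sup>2) \<and>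
      (\<forall>F. integrable lborel F \<longrightarrow> integrable lborel (\<lambda>v. J v * F (v + h *\<^sub>R ?w v)) \<and>
        (LINT v|lborel. J v * F (v + h *\<^sub>R ?w v)) = integral\<^sup>L lborel F)"
    note J1 = conjunct1[OF JJ, rule_format] and J2 = conjunct2[OF JJ, rule_format]
    show ?thesis
  proof (intro bexI[of _ "J \<circ> T"] conjI allI impI)
    show "J \<circ> T \<in> borel_measurable borel" using measurable_compose[OF Tm J] by (simp add: o_def)
    fix z
    have "linear (Dw z)" using w(1) has_derivative_linear by blast
    then show "\<bar>(J \<circ> T) z - 1 - h * (\<Sum>b\<in>Basis. Dw z b \<bullet> b)\<bar> \<le> near_identity_constant K DIM('a) * h\<^sup>2"
      using J1[of "T z"] TS(7)[of "Dw z"] by (simp add: TS(3))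
  next
    fix F :: "'a \<Rightarrow> real" assume F: "integrable lborel F"
    then have Fm: "F \<in> borel_measurable borel" by auto
    have w_m: "w \<in> borel_measurable borel"
      by (intro borel_measurable_continuous_onI differentiable_imp_continuous_on)
        (use w(1) in \<open>auto simp: differentiable_on_def differentiable_def intro: has_derivative_at_withinI\<close>)
    have FS: "integrable (distr lborel borel T) (F \<circ> S)"
      using F measurable_compose[OF Sm Fm] Tm by (subst integrable_distr_eq) (auto simp: TS o_def)
    have FSi: "integral\<^sup>L (distr lborel borel T) (F \<circ> S) = integral\<^sup>L lborel F"
      using measurable_compose[OF Sm Fm] Tm by (subst integral_distr) (auto simp: TS o_def)
    let ?G = "\<lambda>v. J v * (F \<circ> S) (v + h *\<^sub>R ?w v)"
    have SG: "(F \<circ> S) (T z + h *\<^sub>R ?w (T z)) = F (z + h *\<^sub>R w z)" for z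
      using TS by (simp add: linear_add linear_scale)
    have Gm: "?G \<in> borel_measurable borel"
      unfolding o_def
      by (intro borel_measurable_times J measurable_compose[OF _ Fm] measurable_compose[OF _ Sm]
          borel_measurable_add borel_measurable_scaleR borel_measurable_const measurable_compose[OF _ Tm]
          measurable_compose[OF _ w_m]) auto
    have "integrable lborel ?G" "integral\<^sup>L lborel ?G = integral\<^sup>L lborel F"
      using J2[of "F \<circ> S"] FS FSi by (auto simp: TS(6))
    moreover have Tl: "T \<in> measurable lborel borel" using Tm by simp
    ultimately have "integrable (distr lborel borel T) ?G" "integral\<^sup>L (distr lborel borel T) ?G = integral\<^sup>L lborel F"
      by (simp_all add: TS(6))
    then show "integrable lborel (\<lambda>z. (J \<circ> T) z * F (z + h *\<^sub>R w z))"
      "(LINT z|lborel. (J \<circ> T) z * F (z + h *\<^sub>R w z)) = integral\<^sup>L lborel F"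
      using integrable_distr_eq[OF Tl Gm] integral_distr[OF Tl Gm]
      by (simp_all only: SG o_apply[of J T] simp_thms)
  qed
  qed
qed

section \<open>Flows of Lipschitz vector fields\<close>

text \<open>Stated for \<open>a\<close> and \<open>b\<close> in either order, since characteristics are followed forwards and backwards in
time.\<close>

lemma near_constant_derivative_bound:
  fixes f :: "real \<Rightarrow> 'a::real_normed_vector"
  assumes f: "\<And>r. r \<in> S \<Longrightarrow> (f has_vector_derivative f' r) (at r within S)"
    and S: "{min a b..max a b} \<subseteq> S" and B: "\<And>r. r \<in> {min a b..max a b} \<Longrightarrow> norm (f' r - c) \<le> B"
  shows "norm (f b - f a - (b - a) *\<^sub>R c) \<le> \<bar>b - a\<bar> * B"
proof -
  let ?I = "{min a b..max a b}"
  let ?g = "\<lambda>r. f r - r *\<^sub>R c"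
  have "norm (?g b - ?g a) \<le> B * norm (b - a)"
  proof (rule differentiable_bound[where S="?I" and f'="\<lambda>r h. h *\<^sub>R (f' r - c)"])
    show "(?g has_derivative (\<lambda>h. h *\<^sub>R (f' r - c))) (at r within ?I)" if "r \<in> ?I" for r
    proof -
      have "(f has_vector_derivative f' r) (at r within ?I)"
        using f[of r] that S has_vector_derivative_within_subset by blast
      then have "(?g has_vector_derivative f' r - c) (at r within ?I)"
        by (auto intro!: derivative_eq_intros)
      then show ?thesis by (simp add: has_vector_derivative_def)
    qed
    show "onorm (\<lambda>h. h *\<^sub>R (f' r - c)) \<le> B" if "r \<in> ?I" for r
      by (rule onorm_le) (use B[OF that] in \<open>auto simp: mult.commute[of B] intro: mult_left_mono\<close>)
  qed auto
  then show ?thesis by (simp add: algebra_simps)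
qed

lemma derivative_nonpos_imp_decreasing:
  fixes f :: "real \<Rightarrow> real"
  assumes "a \<le> b" "{a..b} \<subseteq> S"
    and f: "\<And>r. r \<in> {a..b} \<Longrightarrow> (f has_vector_derivative f' r) (at r within S)"
    and "\<And>r. r \<in> {a..b} \<Longrightarrow> f' r \<le> 0"
  shows "f b \<le> f a"
proof (rule DERIV_nonpos_imp_decreasing_open[OF \<open>a \<le> b\<close>])
  have f2: "(f has_vector_derivative f' r) (at r within {a..b})" if "r \<in> {a..b}" for r
    using f[OF that] assms(2) has_vector_derivative_within_subset by blast
  show "continuous_on {a..b} f"
    by (rule continuous_on_vector_derivative) (use f2 in auto)
  fix r assume r: "a < r" "r < b"
  then have "(f has_vector_derivative f' r) (at r)"
    using f2[of r] at_within_Icc_at[OF r] by simp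
  then show "\<exists>y. (f has_real_derivative y) (at r) \<and> y \<le> 0"
    using assms(4)[of r] r by (auto simp: has_real_derivative_iff_has_vector_derivative)
qed

lemma exp_quadratic_remainder:
  fixes x :: real
  assumes "\<bar>x\<bar> \<le> 1"
  shows "\<bar>exp x - 1 - x\<bar> \<le> x\<^sup>2"
proof -
  have "exp x \<le> 1 + x + x\<^sup>2"
  proof (cases "0 \<le> x")
    case True
    then show ?thesis using exp_bound[of x] assms by simp
  next
    case False
    define y where "y = - x"
    have y: "0 < y" "y \<le> 1" using False assms by (auto simp: y_def)
    have "1 \<le> (1 + y) * (1 - y + y\<^sup>2)"
      using y by (simp add: algebra_simps power2_eq_square)
    also have "\<dots> \<le> exp y * (1 - y + y\<^sup>2)"
    proof (intro mult_right_mono exp_ge_add_one_self)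
      show "0 \<le> 1 - y + y\<^sup>2" using y zero_le_power2[of y] by linarith
    qed
    finally have "exp (- y) * 1 \<le> exp (- y) * (exp y * (1 - y + y\<^sup>2))" by (intro mult_left_mono) auto
    then show ?thesis by (simp add: y_def mult.assoc[symmetric] flip: exp_add)
  qed
  then show ?thesis using exp_ge_add_one_self[of x] by linarith
qed

lemma exp_Lipschitz_below:
  fixes a b c :: real
  assumes "a \<le> c" "b \<le> c"
  shows "\<bar>exp a - exp b\<bar> \<le> exp c * \<bar>a - b\<bar>"
proof -
  have *: "exp a - exp b \<le> exp c * (a - b)" if "b \<le> a" "a \<le> c" for a b :: real
  proof -
    have "exp a * (1 + (b - a)) \<le> exp a * exp (b - a)" by (intro mult_left_mono exp_ge_add_one_self) auto
    then have "exp a - exp b \<le> exp a * (a - b)" by (simp add: algebra_simps flip: exp_add)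
    also have "\<dots> \<le> exp c * (a - b)" using that by (intro mult_right_mono) auto
    finally show ?thesis .
  qed
  show ?thesis
    using *[of b a] *[of a b] assms by (cases "b \<le> a") auto
qed

text \<open>The number \<open>d s t\<close> measures how far apart the fields at times \<open>s\<close> and \<open>t\<close> are, uniformly in space; for
the velocity it will be the \<open>L\<^sup>1\<close> distance of the densities. One constant \<open>K\<close> serves as sup bound and as
Lipschitz constant of both the field and its derivative, which keeps the composition with another
function in the same form.\<close>

locale regular_field =
  fixes u :: "real \<Rightarrow> 'a::euclidean_space \<Rightarrow> 'b::euclidean_space" and Du :: "real \<Rightarrow> 'a \<Rightarrow> 'a \<Rightarrow> 'b"
    and d :: "real \<Rightarrow> real \<Rightarrow> real" and T K :: real
  assumes T: "0 \<le> T" and K: "0 \<le> K"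
    and der: "\<And>t x. t \<in> {0..T} \<Longrightarrow> (u t has_derivative Du t x) (at x)"
    and u_bound: "\<And>t x. t \<in> {0..T} \<Longrightarrow> norm (u t x) \<le> K"
    and Du_bound: "\<And>t x z. t \<in> {0..T} \<Longrightarrow> norm (Du t x z) \<le> K * norm z"
    and u_close: "\<And>s t x. s \<in> {0..T} \<Longrightarrow> t \<in> {0..T} \<Longrightarrow> norm (u s x - u t x) \<le> K * d s t"
    and Du_close: "\<And>s t x y z. s \<in> {0..T} \<Longrightarrow> t \<in> {0..T} \<Longrightarrow>
      norm (Du s x z - Du t y z) \<le> K * (d s t + norm (x - y)) * norm z"
    and d_nonneg: "\<And>s t. 0 \<le> d s t"
    and d_small: "\<And>\<epsilon>. 0 < \<epsilon> \<Longrightarrow> \<exists>\<delta>>0. \<forall>s\<in>{0..T}. \<forall>t\<in>{0..T}. \<bar>s - t\<bar> < \<delta> \<longrightarrow> d s t \<le> \<epsilon>"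
begin

lemma d_self: "d s s \<le> 0" if "s \<in> {0..T}"
proof (rule field_le_epsilon)
  fix e :: real assume "0 < e"
  then show "d s s \<le> 0 + e" using d_small[of e] that by force
qed

lemma u_Lipschitz: "norm (u t x - u t y) \<le> K * norm (x - y)" if "t \<in> {0..T}"
  using derivative_bound_Lipschitz[OF der Du_bound] that by blast

end

text \<open>\<open>X t s x\<close> is the position at time \<open>t\<close> of the characteristic through \<open>x\<close> at time \<open>s\<close>.\<close>

locale regular_flow = regular_field u Du d T K
  for u :: "real \<Rightarrow> 'a::euclidean_space \<Rightarrow> 'a" and Du d T K +
  fixes X :: "real \<Rightarrow> real \<Rightarrow> 'a \<Rightarrow> 'a"
  assumes X_init: "\<And>t x. t \<in> {0..T} \<Longrightarrow> X t t x = x"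
    and X_deriv: "\<And>s t x. s \<in> {0..T} \<Longrightarrow> t \<in> {0..T} \<Longrightarrow>
      ((\<lambda>t. X t s x) has_vector_derivative u t (X t s x)) (at t within {0..T})"
begin

text \<open>Gronwall's inequality in both time directions: the squared distance \<open>D\<close> satisfies \<open>\<bar>D'\<bar> \<le> 2 K D\<close>.\<close>

lemma solutions_close:
  assumes p: "\<And>t. t \<in> {0..T} \<Longrightarrow> (p has_vector_derivative u t (p t)) (at t within {0..T})"
    and q: "\<And>t. t \<in> {0..T} \<Longrightarrow> (q has_vector_derivative u t (q t)) (at t within {0..T})"
    and st: "s \<in> {0..T}" "t \<in> {0..T}"
  shows "norm (p t - q t) \<le> exp (K * \<bar>t - s\<bar>) * norm (p s - q s)"
proof -
  define D where "D r = (p r - q r) \<bullet> (p r - q r)" for r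
  define D' where "D' r = 2 * ((u r (p r) - u r (q r)) \<bullet> (p r - q r))" for r
  have dD: "(D has_vector_derivative D' r) (at r within {0..T})" if "r \<in> {0..T}" for r
    unfolding D_def [abs_def] D'_def
    using bounded_bilinear.has_vector_derivative[OF bounded_bilinear_inner
        has_vector_derivative_diff[OF p[OF that] q[OF that]] has_vector_derivative_diff[OF p[OF that] q[OF that]]]
    by (simp add: inner_commute)
  have D'_bound: "\<bar>D' r\<bar> \<le> 2 * K * D r" if "r \<in> {0..T}" for r
  proof -
    have "\<bar>D' r\<bar> \<le> 2 * (norm (u r (p r) - u r (q r)) * norm (p r - q r))"
      unfolding D'_def using Cauchy_Schwarz_ineq2 by (simp add: abs_mult)
    also have "\<dots> \<le> 2 * ((K * norm (p r - q r)) * norm (p r - q r))"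
      using u_Lipschitz[OF that] by (intro mult_left_mono mult_right_mono) auto
    also have "\<dots> = 2 * K * D r" by (simp add: D_def dot_square_norm power2_eq_square)
    finally show ?thesis .
  qed
  have "D t \<le> exp (2 * K * \<bar>t - s\<bar>) * D s"
  proof (cases "s \<le> t")
    case True
    have "exp (- (2 * K) * t) * D t \<le> exp (- (2 * K) * s) * D s"
    proof (rule derivative_nonpos_imp_decreasing[OF True, where S="{0..T}" and
          f'="\<lambda>r. exp (- (2 * K) * r) * (D' r - 2 * K * D r)"])
      fix r assume "r \<in> {s..t}"
      then have r: "r \<in> {0..T}" using st by auto
      show "((\<lambda>r. exp (- (2 * K) * r) * D r) has_vector_derivative exp (- (2 * K) * r) * (D' r - 2 * K * D r))
          (at r within {0..T})"
        using dD[OF r] unfolding has_real_derivative_iff_has_vector_derivative[symmetric]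
        by (auto intro!: derivative_eq_intros simp: algebra_simps)
      show "exp (- (2 * K) * r) * (D' r - 2 * K * D r) \<le> 0"
        using D'_bound[OF r] by (auto intro!: mult_nonneg_nonpos)
    qed (use st in auto)
    then have "exp (2 * K * t) * (exp (- (2 * K) * t) * D t) \<le> exp (2 * K * t) * (exp (- (2 * K) * s) * D s)"
      by (intro mult_left_mono) auto
    moreover have "exp (2 * K * t) * exp (- (2 * K) * t) = 1" by (simp flip: exp_add)
    moreover have "exp (2 * K * t) * exp (- (2 * K) * s) = exp (2 * K * \<bar>t - s\<bar>)"
      using True by (simp add: right_diff_distrib flip: exp_add)
    ultimately show ?thesis by (simp only: mult.assoc[symmetric] mult_1_left)
  next
    case False
    then have ts: "t \<le> s" by simp
    have "- (exp (2 * K * s) * D s) \<le> - (exp (2 * K * t) * D t)"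
    proof (rule derivative_nonpos_imp_decreasing[OF ts, where S="{0..T}" and
          f'="\<lambda>r. - (exp (2 * K * r) * (D' r + 2 * K * D r))"])
      fix r assume "r \<in> {t..s}"
      then have r: "r \<in> {0..T}" using st by auto
      show "((\<lambda>r. - (exp (2 * K * r) * D r)) has_vector_derivative - (exp (2 * K * r) * (D' r + 2 * K * D r)))
          (at r within {0..T})"
        using dD[OF r] unfolding has_real_derivative_iff_has_vector_derivative[symmetric]
        by (auto intro!: derivative_eq_intros simp: algebra_simps)
      show "- (exp (2 * K * r) * (D' r + 2 * K * D r)) \<le> 0"
        using D'_bound[OF r] by simp
    qed (use st in auto)
    then have "exp (- (2 * K) * t) * (exp (2 * K * t) * D t) \<le> exp (- (2 * K) * t) * (exp (2 * K * s) * D s)"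
      by (intro mult_left_mono) auto
    moreover have "exp (- (2 * K) * t) * exp (2 * K * t) = 1" by (simp flip: exp_add)
    moreover have "exp (- (2 * K) * t) * exp (2 * K * s) = exp (2 * K * \<bar>t - s\<bar>)"
      using False by (simp add: right_diff_distrib flip: exp_add)
    ultimately show ?thesis by (simp only: mult.assoc[symmetric] mult_1_left)
  qed
  also have "exp (2 * K * \<bar>t - s\<bar>) = (exp (K * \<bar>t - s\<bar>))\<^sup>2" by (simp add: power2_eq_square flip: exp_add)
  finally have "(norm (p t - q t))\<^sup>2 \<le> (exp (K * \<bar>t - s\<bar>) * norm (p s - q s))\<^sup>2"
    by (simp add: D_def dot_square_norm power_mult_distrib)
  then show ?thesis by (rule power2_le_imp_le) auto
qed

text \<open>Uniqueness of characteristics: both sides solve the equation and agree at time \<open>t\<close>.\<close>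

lemma X_cocycle: "X r t (X t s x) = X r s x" if "r \<in> {0..T}" "s \<in> {0..T}" "t \<in> {0..T}"
proof -
  have "norm (X r t (X t s x) - X r s x) \<le> exp (K * \<bar>r - t\<bar>) * norm (X t t (X t s x) - X t s x)"
    by (rule solutions_close[OF X_deriv X_deriv]) (use that in auto)
  then show ?thesis using that by (simp add: X_init)
qed

lemma X_Lipschitz: "norm (X t s x - X t s y) \<le> exp (K * T) * norm (x - y)" if "s \<in> {0..T}" "t \<in> {0..T}"
proof -
  have "norm (X t s x - X t s y) \<le> exp (K * \<bar>t - s\<bar>) * norm (X s s x - X s s y)"
    by (rule solutions_close[OF X_deriv X_deriv]) (use that in auto)
  also have "\<dots> \<le> exp (K * T) * norm (x - y)"
    using that K by (intro mult_mono) (auto simp: X_init intro!: mult_left_mono)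
  finally show ?thesis .
qed

lemma X_displacement: "norm (X t s x - X r s x) \<le> K * \<bar>t - r\<bar>"
  if "s \<in> {0..T}" "t \<in> {0..T}" "r \<in> {0..T}"
proof -
  have "norm (X t s x - X r s x - (t - r) *\<^sub>R 0) \<le> \<bar>t - r\<bar> * K"
  proof (rule near_constant_derivative_bound[where S="{0..T}"])
    show "((\<lambda>t. X t s x) has_vector_derivative u t (X t s x)) (at t within {0..T})" if "t \<in> {0..T}" for t
      using X_deriv \<open>s \<in> {0..T}\<close> that by blast
    show "norm (u t' (X t' s x) - 0) \<le> K" if "t' \<in> {min r t..max r t}" for t'
      using u_bound[of t' "X t' s x"] that \<open>r \<in> _\<close> \<open>t \<in> _\<close> by (auto simp: min_def max_def split: if_splits)
  qed (use that in auto)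
  then show ?thesis by (simp add: mult.commute)
qed

definition dvg :: "real \<Rightarrow> 'a \<Rightarrow> real" where "dvg t x = (\<Sum>b\<in>Basis. Du t x b \<bullet> b)"

lemma dvg_bound: "\<bar>dvg t x\<bar> \<le> DIM('a) * K" if "t \<in> {0..T}"
proof -
  have "norm (\<Sum>b\<in>Basis. Du t x b \<bullet> b) \<le> DIM('a) * K"
  proof (rule sum_norm_bound)
    show "norm (Du t x b \<bullet> b) \<le> K" if "b \<in> Basis" for b
      using Cauchy_Schwarz_ineq2[of "Du t x b" b] Du_bound[OF \<open>t \<in> _\<close>, of x b] that by simp
  qed
  then show ?thesis by (simp add: dvg_def)
qed

lemma dvg_close: "\<bar>dvg s x - dvg t y\<bar> \<le> DIM('a) * (K * (d s t + norm (x - y)))" if "s \<in> {0..T}" "t \<in> {0..T}"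
proof -
  have "norm (\<Sum>b\<in>Basis. (Du s x b - Du t y b) \<bullet> b) \<le> DIM('a) * (K * (d s t + norm (x - y)))"
  proof (rule sum_norm_bound)
    show "norm ((Du s x b - Du t y b) \<bullet> b) \<le> K * (d s t + norm (x - y))" if "b \<in> Basis" for b
      using Cauchy_Schwarz_ineq2[of "Du s x b - Du t y b" b] Du_close[of s t x b y] \<open>s \<in> _\<close> \<open>t \<in> _\<close> that by simp
  qed
  then show ?thesis by (simp add: dvg_def inner_diff_left sum_subtractf)
qed

lemma continuous_dvg: "continuous_on {0..T} (\<lambda>r. dvg r (X r s x))" if s: "s \<in> {0..T}"
  unfolding continuous_on_iff
proof (intro ballI allI impI)
  fix t e :: real assume t: "t \<in> {0..T}" and e: "0 < e"
  define \<eta> where "\<eta> = e / (2 * (DIM('a) * K + 1))"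
  have \<eta>: "0 < \<eta>" using e K by (auto simp: \<eta>_def intro!: divide_pos_pos mult_pos_pos add_nonneg_pos)
  have \<eta>2: "2 * \<eta> = e / (DIM('a) * K + 1)" unfolding \<eta>_def by (simp only: times_divide_eq_right mult_divide_mult_cancel_left_if) simp
  obtain \<delta> where \<delta>: "0 < \<delta>" "\<And>r t. r \<in> {0..T} \<Longrightarrow> t \<in> {0..T} \<Longrightarrow> \<bar>r - t\<bar> < \<delta> \<Longrightarrow> d r t \<le> \<eta>"
    using d_small[OF \<eta>] by blast
  show "\<exists>\<delta>>0. \<forall>r\<in>{0..T}. dist r t < \<delta> \<longrightarrow> dist (dvg r (X r s x)) (dvg t (X t s x)) < e"
  proof (intro exI[of _ "min \<delta> (\<eta> / (K + 1))"] conjI ballI impI)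
    show "0 < min \<delta> (\<eta> / (K + 1))" using \<delta> \<eta> K by auto
    fix r assume r: "r \<in> {0..T}" and "dist r t < min \<delta> (\<eta> / (K + 1))"
    then have rt: "\<bar>r - t\<bar> < \<delta>" "\<bar>r - t\<bar> < \<eta> / (K + 1)" by (auto simp: dist_real_def)
    have "norm (X r s x - X t s x) \<le> K * \<bar>r - t\<bar>" by (rule X_displacement) (use s r t in auto)
    also have "\<dots> \<le> (K + 1) * (\<eta> / (K + 1))" using rt K by (intro mult_mono) auto
    also have "\<dots> = \<eta>" using K by auto
    finally have "d r t + norm (X r s x - X t s x) \<le> 2 * \<eta>" using \<delta>(2)[OF r t rt(1)] by simp
    then have "DIM('a) * (K * (d r t + norm (X r s x - X t s x))) \<le> DIM('a) * (K * (2 * \<eta>))"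
      using K by (intro mult_left_mono) auto
    also have "\<dots> = (DIM('a) * K) * (e / (DIM('a) * K + 1))" by (simp add: \<eta>2)
    also have "\<dots> < (DIM('a) * K + 1) * (e / (DIM('a) * K + 1))"
      using e K by (intro mult_strict_right_mono divide_pos_pos add_nonneg_pos) auto
    also have "\<dots> = e" using K by (simp add: add_nonneg_eq_0_iff)
    finally show "dist (dvg r (X r s x)) (dvg t (X t s x)) < e"
      using dvg_close[OF r t, of "X r s x" "X t s x"] by (simp add: dist_real_def)
  qed
qed

lemma dvg_integrable: "(\<lambda>r. dvg r (X r s x)) integrable_on {a..b}" if "s \<in> {0..T}" "{a..b} \<subseteq> {0..T}"
  by (intro integrable_continuous_interval continuous_on_subset[OF continuous_dvg]) (use that in auto)

text \<open>The factor by which the density changes along the characteristic that is at \<open>x\<close> at time \<open>t\<close>.\<close>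

definition weight :: "real \<Rightarrow> 'a \<Rightarrow> real" where
  "weight t x = exp (- integral {0..t} (\<lambda>r. dvg r (X r t x)))"

lemma weight_cocycle: "weight t x = weight s (X s t x) * exp (- integral {s..t} (\<lambda>r. dvg r (X r t x)))"
  if "0 \<le> s" "s \<le> t" "t \<le> T"
proof -
  have "integral {0..s} (\<lambda>r. dvg r (X r s (X s t x))) = integral {0..s} (\<lambda>r. dvg r (X r t x))"
    by (intro integral_cong) (use that in \<open>auto simp: X_cocycle\<close>)
  moreover have "integral {0..t} (\<lambda>r. dvg r (X r t x)) =
      integral {0..s} (\<lambda>r. dvg r (X r t x)) + integral {s..t} (\<lambda>r. dvg r (X r t x))"
    by (rule Henstock_Kurzweil_Integration.integral_combine[symmetric]) (use that in \<open>auto intro!: dvg_integrable\<close>)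
  ultimately show ?thesis by (simp add: weight_def flip: exp_add)
qed

lemma integral_dvg_bound: "\<bar>integral {0..t} (\<lambda>r. dvg r (X r t x))\<bar> \<le> DIM('a) * K * T" if "t \<in> {0..T}"
proof -
  have "norm (integral {0..t} (\<lambda>r. dvg r (X r t x))) \<le> DIM('a) * K * (t - 0)"
    by (rule integral_bound) (use that dvg_bound in \<open>auto intro!: continuous_on_subset[OF continuous_dvg]\<close>)
  also have "\<dots> \<le> DIM('a) * K * T" using that K by (intro mult_left_mono) auto
  finally show ?thesis by simp
qed

lemma weight_bound: "weight t x \<le> exp (DIM('a) * K * T)" if "t \<in> {0..T}"
  using integral_dvg_bound[OF that, of x] by (simp add: weight_def)

lemma weight_pos: "0 < weight t x" by (simp add: weight_def)

lemma weight_Lipschitz: "\<bar>weight t x - weight t y\<bar> \<le> exp (DIM('a) * K * T) * (DIM('a) * (K * exp (K * T)) * T) * norm (x - y)"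
  if t: "t \<in> {0..T}"
proof -
  let ?I = "\<lambda>x. integral {0..t} (\<lambda>r. dvg r (X r t x))"
  have "?I x - ?I y = integral {0..t} (\<lambda>r. dvg r (X r t x) - dvg r (X r t y))"
    by (rule integral_diff[symmetric]; rule dvg_integrable) (use t in auto)
  also have "norm \<dots> \<le> (DIM('a) * (K * (exp (K * T) * norm (x - y)))) * (t - 0)"
  proof (rule integral_bound)
    fix r assume r: "r \<in> {0..t}"
    then have rT: "r \<in> {0..T}" using t by auto
    have "\<bar>dvg r (X r t x) - dvg r (X r t y)\<bar> \<le> DIM('a) * (K * (d r r + norm (X r t x - X r t y)))"
      by (rule dvg_close[OF rT rT])
    also have "\<dots> \<le> DIM('a) * (K * (exp (K * T) * norm (x - y)))"
      using K d_self[OF rT] X_Lipschitz[OF t rT, of x y] by (intro mult_left_mono) auto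
    finally show "norm (dvg r (X r t x) - dvg r (X r t y)) \<le> DIM('a) * (K * (exp (K * T) * norm (x - y)))" by simp
  qed (use t in \<open>auto intro!: continuous_intros continuous_on_subset[OF continuous_dvg]\<close>)
  also have "\<dots> \<le> (DIM('a) * (K * (exp (K * T) * norm (x - y)))) * T"
    using t K by (intro mult_left_mono) auto
  finally have "\<bar>?I x - ?I y\<bar> \<le> (DIM('a) * (K * (exp (K * T) * norm (x - y)))) * T" by simp
  moreover have "\<bar>weight t x - weight t y\<bar> \<le> exp (DIM('a) * K * T) * \<bar>- ?I x - (- ?I y)\<bar>"
    unfolding weight_def by (rule exp_Lipschitz_below) (use integral_dvg_bound[OF t] in \<open>auto simp: abs_le_iff\<close>)
  ultimately have "\<bar>weight t x - weight t y\<bar> \<le> exp (DIM('a) * K * T) * ((DIM('a) * (K * (exp (K * T) * norm (x - y)))) * T)"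
    by (smt (verit) exp_gt_zero mult_left_mono)
  then show ?thesis by (simp add: mult_ac)
qed

end

section \<open>Integrals along a flow\<close>

context regular_flow begin

text \<open>The solution at time \<open>t\<close> of the continuity equation with initial datum \<open>f\<close>.\<close>

definition transport :: "('a \<Rightarrow> real) \<Rightarrow> real \<Rightarrow> 'a \<Rightarrow> real" where
  "transport f t x = f (X 0 t x) * weight t x"

lemma zero_in: "0 \<in> {0..T}" using T by simp

text \<open>Restarting at time \<open>s\<close>: this reduces the comparison of two times \<open>s < t\<close> to the flow on \<open>{s..t}\<close>.\<close>

lemma transport_cocycle: "transport f t x = transport f s (X s t x) * exp (- integral {s..t} (\<lambda>r. dvg r (X r t x)))"
  if "0 \<le> s" "s \<le> t" "t \<le> T"
  using weight_cocycle[OF that, of x] X_cocycle[of 0 t s x] that T by (simp add: transport_def)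

lemma transport_bound: "\<bar>transport f t x\<bar> \<le> B * exp (DIM('a) * K * T)"
  if "t \<in> {0..T}" "\<And>x. \<bar>f x\<bar> \<le> B"
proof -
  have "0 \<le> B" using that(2)[of 0] by linarith
  then show ?thesis
    using that(2)[of "X 0 t x"] weight_bound[OF that(1), of x] weight_pos[of t x]
    by (auto simp: transport_def abs_mult intro!: mult_mono)
qed

lemma transport_Lipschitz: "\<exists>C\<ge>0. \<forall>t\<in>{0..T}. \<forall>x y. \<bar>transport f t x - transport f t y\<bar> \<le> C * norm (x - y)"
  if f: "\<And>x y. \<bar>f x - f y\<bar> \<le> L * norm (x - y)" and L: "0 \<le> L" and B: "\<And>x. \<bar>f x\<bar> \<le> B"
proof -
  let ?A = "L * exp (K * T)" and ?e = "exp (DIM('a) * K * T)"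
    and ?B = "exp (DIM('a) * K * T) * (DIM('a) * (K * exp (K * T)) * T)"
  have B0: "0 \<le> B" using B[of 0] by linarith
  show ?thesis
  proof (intro exI[of _ "?A * ?e + B * ?B"] conjI ballI allI)
    show "0 \<le> ?A * ?e + B * ?B" using L K T B0 by auto
    fix t x y assume t: "t \<in> {0..T}"
    have "\<bar>f (X 0 t x) - f (X 0 t y)\<bar> \<le> L * norm (X 0 t x - X 0 t y)" by (rule f)
    also have "\<dots> \<le> L * (exp (K * T) * norm (x - y))"
      using L X_Lipschitz[OF t zero_in] by (intro mult_left_mono)
    finally have 1: "\<bar>f (X 0 t x) - f (X 0 t y)\<bar> \<le> ?A * norm (x - y)" by (simp add: mult.assoc)
    have "\<bar>transport f t x - transport f t y\<bar> = \<bar>(f (X 0 t x) - f (X 0 t y)) * weight t x + f (X 0 t y) * (weight t x - weight t y)\<bar>"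
      by (simp add: transport_def algebra_simps)
    also have "\<dots> \<le> \<bar>f (X 0 t x) - f (X 0 t y)\<bar> * weight t x + \<bar>f (X 0 t y)\<bar> * \<bar>weight t x - weight t y\<bar>"
      using abs_triangle_ineq[of "(f (X 0 t x) - f (X 0 t y)) * weight t x" "f (X 0 t y) * (weight t x - weight t y)"]
      using weight_pos[of t x] by (simp add: abs_mult)
    also have "\<dots> \<le> (?A * norm (x - y)) * ?e + B * (?B * norm (x - y))"
      using 1 weight_bound[OF t, of x] weight_pos[of t x] B weight_Lipschitz[OF t, of x y] L B0
      by (intro add_mono mult_mono) auto
    finally show "\<bar>transport f t x - transport f t y\<bar> \<le> (?A * ?e + B * ?B) * norm (x - y)" by (simp add: algebra_simps)
  qed
qed

text \<open>Finite speed of propagation.\<close>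

lemma transport_eq_0: "transport f t x = 0" if "t \<in> {0..T}" "\<And>x. R < norm x \<Longrightarrow> f x = 0" "R + K * T < norm x"
proof -
  have "norm (X 0 t x - X t t x) \<le> K * \<bar>0 - t\<bar>" by (rule X_displacement) (use that(1) T in auto)
  also have "\<dots> \<le> K * T" using that(1) K by (intro mult_left_mono) auto
  finally have "norm (X 0 t x - x) \<le> K * T" using that(1) by (simp add: X_init)
  then have "R < norm (X 0 t x)"
    using that(3) norm_triangle_ineq2[of x "X 0 t x"] by (simp add: norm_minus_commute)
  then show ?thesis using that(2)[of "X 0 t x"] by (simp add: transport_def)
qed

lemma transport_continuous: "continuous_on UNIV (transport f t)"
  if t: "t \<in> {0..T}"
    and f: "\<And>x y. \<bar>f x - f y\<bar> \<le> L * norm (x - y)" "0 \<le> L" "\<And>x. \<bar>f x\<bar> \<le> B"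
proof -
  obtain C where C: "0 \<le> C" "\<And>x y. \<bar>transport f t x - transport f t y\<bar> \<le> C * norm (x - y)"
    using transport_Lipschitz[OF f] t by blast
  then have "C-lipschitz_on UNIV (transport f t)" by (intro lipschitz_onI) (auto simp: dist_norm)
  then show ?thesis by (rule lipschitz_on_continuous_on)
qed

lemma transport_integrable: "integrable lborel (transport f t)"
  if t: "t \<in> {0..T}" and f: "\<And>x y. \<bar>f x - f y\<bar> \<le> L * norm (x - y)" "0 \<le> L" "\<And>x. \<bar>f x\<bar> \<le> B"
    "\<And>x. R < norm x \<Longrightarrow> f x = 0"
proof (rule integrableI_bounded_set[where A="cball 0 (R + K * T)" and B="B * exp (DIM('a) * K * T)"])
  show "transport f t \<in> borel_measurable lborel"
    using transport_continuous[OF t f(1-3)] by (simp add: borel_measurable_continuous_onI)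
  show "emeasure lborel (cball (0::'a) (R + K * T)) < \<infinity>"
    by (rule emeasure_bounded_finite) simp
  show "AE x in lborel. x \<in> cball 0 (R + K * T) \<longrightarrow> norm (transport f t x) \<le> B * exp (DIM('a) * K * T)"
    using transport_bound[OF t f(3)] by simp
  show "AE x in lborel. x \<notin> cball 0 (R + K * T) \<longrightarrow> transport f t x = 0"
    using transport_eq_0[OF t f(4)] by (simp add: not_le)
qed simp

text \<open>Going forward with the Euler scheme and backward with the flow returns to the starting point up to
\<open>o(t - s)\<close>. Here \<open>\<omega>\<close> bounds the variation of the field in time.\<close>

lemma Euler_step: "norm (X s t (z + (t - s) *\<^sub>R u s z) - z) \<le> (t - s) * (exp (K * T) * (K * \<omega> + K * (K * (t - s))))"
  if st: "0 \<le> s" "s \<le> t" "t \<le> T" and \<omega>: "\<And>r. r \<in> {s..t} \<Longrightarrow> d r s \<le> \<omega>"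
proof -
  let ?B = "K * \<omega> + K * (K * (t - s))"
  have s: "s \<in> {0..T}" and t: "t \<in> {0..T}" using st by auto
  have "norm (X t s z - X s s z - (t - s) *\<^sub>R u s z) \<le> \<bar>t - s\<bar> * ?B"
  proof (rule near_constant_derivative_bound[where S="{0..T}"])
    show "((\<lambda>t. X t s z) has_vector_derivative u t (X t s z)) (at t within {0..T})" if "t \<in> {0..T}" for t
      using X_deriv s that by blast
    fix r assume "r \<in> {min s t..max s t}"
    then have r: "r \<in> {s..t}" "r \<in> {0..T}" using st by auto
    have "norm (u r (X r s z) - u s z) \<le> norm (u r (X r s z) - u s (X r s z)) + norm (u s (X r s z) - u s z)"
      using norm_triangle_ineq[of "u r (X r s z) - u s (X r s z)" "u s (X r s z) - u s z"] by simp
    also have "\<dots> \<le> K * d r s + K * norm (X r s z - z)"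
      using u_close[OF r(2) s] u_Lipschitz[OF s] by (intro add_mono)
    also have "\<dots> \<le> ?B"
    proof (intro add_mono mult_left_mono)
      have "norm (X r s z - X s s z) \<le> K * \<bar>r - s\<bar>" by (rule X_displacement[OF s r(2) s])
      also have "\<dots> \<le> K * (t - s)" using r K by (intro mult_left_mono) auto
      finally show "norm (X r s z - z) \<le> K * (t - s)" using s by (simp add: X_init)
    qed (use \<omega> r K in auto)
    finally show "norm (u r (X r s z) - u s z) \<le> ?B" .
  qed (use st in auto)
  then have 1: "norm (X t s z - (z + (t - s) *\<^sub>R u s z)) \<le> (t - s) * ?B"
    using st s by (simp add: X_init algebra_simps)
  have "norm (X s t (z + (t - s) *\<^sub>R u s z) - X s t (X t s z)) \<le> exp (K * T) * norm (z + (t - s) *\<^sub>R u s z - X t s z)"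
    by (rule X_Lipschitz[OF t s])
  also have "\<dots> \<le> exp (K * T) * ((t - s) * ?B)"
    using 1 by (intro mult_left_mono) (auto simp: norm_minus_commute)
  finally show ?thesis using X_cocycle[OF s s t, of z] s by (simp add: X_init mult_ac)
qed

text \<open>The heart of Liouville's formula. Writing \<open>h = t - s\<close>, the substitution \<open>x = z + h u s z\<close> turns the integral
at time \<open>t\<close> into that of \<open>J z * transport f s p * exp (- I)\<close>, where \<open>p\<close> is close to \<open>z\<close> by \<open>Euler_step\<close>
and where both \<open>J z\<close> and \<open>exp I\<close> are \<open>1 + h dvg s z\<close> up to \<open>o(h)\<close>. The integrand thus differs from
\<open>transport f s z\<close> by \<open>o(h)\<close>, uniformly on a bounded set outside of which both vanish.\<close>

lemma one_step:
  assumes f: "\<And>x y. \<bar>f x - f y\<bar> \<le> L * norm (x - y)" "0 \<le> L" "\<And>x. \<bar>f x\<bar> \<le> B"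
    "\<And>x. R < norm x \<Longrightarrow> f x = 0"
  shows "\<exists>C\<ge>0. \<forall>s t \<omega>. 0 \<le> s \<and> s \<le> t \<and> t \<le> T \<and> t - s \<le> 1 \<and> (t - s) * ((DIM('a) + 1) * K) \<le> 1/2 \<and>
    0 \<le> \<omega> \<and> (\<forall>r\<in>{s..t}. d r s \<le> \<omega>) \<longrightarrow>
    \<bar>integral\<^sup>L lborel (transport f t) - integral\<^sup>L lborel (transport f s)\<bar> \<le> C * ((t - s) * (\<omega> + (t - s)))"
proof -
  let ?N = "real DIM('a)"
  obtain LG where LG: "0 \<le> LG" "\<And>t x y. t \<in> {0..T} \<Longrightarrow> \<bar>transport f t x - transport f t y\<bar> \<le> LG * norm (x - y)"
    using transport_Lipschitz[OF f(1-3)] by blast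
  define BG where "BG = B * exp (?N * K * T)"
  have "0 \<le> B" using f(3)[of 0] by linarith
  then have BG0: "0 \<le> BG" by (simp add: BG_def)
  have BG: "\<bar>transport f t x\<bar> \<le> BG" if "t \<in> {0..T}" for t x
    using transport_bound[OF that f(3)] by (simp add: BG_def)
  define Nc where "Nc = near_identity_constant K DIM('a)"
  have Nc0: "0 \<le> Nc" using K by (simp add: Nc_def near_identity_constant_def)
  define \<gamma> where "\<gamma> = 2 * (Nc + ?N * K + 2 * ?N * K\<^sup>2 + (?N * K)\<^sup>2)"
  define \<alpha> where "\<alpha> = exp (K * T) * (K + K\<^sup>2)"
  have \<gamma>0: "0 \<le> \<gamma>" and \<alpha>0: "0 \<le> \<alpha>" using K Nc0 by (auto simp: \<gamma>_def \<alpha>_def)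
  define A where "A = cball (0::'a) (R + K * T + 2 * K)"
  define C0 where "C0 = BG * \<gamma> + LG * \<alpha>"
  have C00: "0 \<le> C0" using BG0 \<gamma>0 LG \<alpha>0 by (simp add: C0_def)
  define C where "C = C0 * measure lborel A"
  have Afin: "emeasure lborel A < \<infinity>" unfolding A_def by (rule emeasure_bounded_finite) simp
  have "\<bar>integral\<^sup>L lborel (transport f t) - integral\<^sup>L lborel (transport f s)\<bar> \<le> C * ((t - s) * (\<omega> + (t - s)))"
    if st: "0 \<le> s" "s \<le> t" "t \<le> T" "t - s \<le> 1" "(t - s) * ((DIM('a) + 1) * K) \<le> 1/2"
      and \<omega>: "0 \<le> \<omega>" "\<And>r. r \<in> {s..t} \<Longrightarrow> d r s \<le> \<omega>" for s t \<omega>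
  proof -
    define h where "h = t - s"
    have h: "0 \<le> h" "h \<le> 1" "h * ((DIM('a) + 1) * K) \<le> 1/2" using st by (auto simp: h_def)
    have s: "s \<in> {0..T}" and t: "t \<in> {0..T}" using st by auto
    let ?\<Phi> = "\<lambda>z. z + h *\<^sub>R u s z"
    have cont: "continuous_on UNIV (\<lambda>z. Du s z y)" for y
    proof (rule lipschitz_on_continuous_on[where L="K * norm y"], rule lipschitz_onI)
      fix a b
      have "norm (Du s a y - Du s b y) \<le> K * (d s s + norm (a - b)) * norm y" by (rule Du_close[OF s s])
      also have "\<dots> \<le> K * norm (a - b) * norm y"
        using d_self[OF s] K by (intro mult_right_mono mult_left_mono) auto
      finally show "dist (Du s a y) (Du s b y) \<le> K * norm y * dist a b" by (simp add: dist_norm mult_ac)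
    qed (use K in auto)
    obtain J where J: "\<And>z. \<bar>J z - 1 - h * dvg s z\<bar> \<le> Nc * h\<^sup>2"
      and J_int: "\<And>F. integrable lborel F \<Longrightarrow> integrable lborel (\<lambda>z. J z * F (?\<Phi> z))"
      and J_eq: "\<And>F. integrable lborel F \<Longrightarrow> (LINT z|lborel. J z * F (?\<Phi> z)) = integral\<^sup>L lborel F"
      using near_identity_change_of_variables[of K "u s" "Du s" h] K der[OF s] Du_bound[OF s] cont h
      unfolding dvg_def Nc_def by blast
    define D where "D z = J z * transport f t (?\<Phi> z) - transport f s z" for z
    have Gt: "integrable lborel (transport f t)" and Gs: "integrable lborel (transport f s)"
      using transport_integrable[OF t f] transport_integrable[OF s f] by auto
    have D_int: "integrable lborel D" unfolding D_def by (intro Bochner_Integration.integrable_diff J_int Gt Gs)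
    have "integral\<^sup>L lborel (transport f t) - integral\<^sup>L lborel (transport f s) = integral\<^sup>L lborel D"
      unfolding D_def J_eq[OF Gt, symmetric] by (intro Bochner_Integration.integral_diff[symmetric] J_int Gt Gs)
    also have "\<bar>\<dots>\<bar> \<le> (LINT z|lborel. C0 * (h * (\<omega> + h)) * indicator A z)"
    proof -
      have "\<bar>integral\<^sup>L lborel D\<bar> \<le> (LINT z|lborel. \<bar>D z\<bar>)" using integral_norm_bound[of lborel D] by simp
      also have "\<dots> \<le> (LINT z|lborel. C0 * (h * (\<omega> + h)) * indicator A z)"
      proof (rule integral_mono)
        show "integrable lborel (\<lambda>z. \<bar>D z\<bar>)" using D_int by simp
        show "integrable lborel (\<lambda>z. C0 * (h * (\<omega> + h)) * indicator A z)"
          using Afin by (intro integrable_mult_right integrable_real_indicator) (auto simp: A_def)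
        fix z
        define p where "p = X s t (?\<Phi> z)"
        define I where "I = integral {s..t} (\<lambda>r. dvg r (X r t (?\<Phi> z)))"
        have Gp: "transport f t (?\<Phi> z) = transport f s p * exp (- I)"
          unfolding p_def I_def by (rule transport_cocycle) (use st in auto)
        have \<Phi>z: "norm (?\<Phi> z - z) \<le> h * K"
          using u_bound[OF s, of z] h by (simp add: mult_left_mono)
        have near: "norm (X r t (?\<Phi> z) - z) \<le> 2 * K * h" if r: "r \<in> {s..t}" for r
        proof -
          have "norm (X r t (?\<Phi> z) - X t t (?\<Phi> z)) \<le> K * \<bar>r - t\<bar>"
            by (rule X_displacement) (use st r in auto)
          also have "\<dots> \<le> K * h" using r K by (intro mult_left_mono) (auto simp: h_def)
          finally have "norm (X r t (?\<Phi> z) - ?\<Phi> z) \<le> K * h" using t by (simp add: X_init)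
          then show ?thesis
            using \<Phi>z norm_triangle_ineq[of "X r t (?\<Phi> z) - ?\<Phi> z" "?\<Phi> z - z"] by (simp add: algebra_simps)
        qed
        show "\<bar>D z\<bar> \<le> C0 * (h * (\<omega> + h)) * indicator A z"
        proof (cases "z \<in> A")
          case False
          then have z: "R + K * T + 2 * K < norm z" by (simp add: A_def)
          have "norm (p - z) \<le> 2 * K * h" unfolding p_def by (rule near) (use st in auto)
          also have "\<dots> \<le> 2 * K" using h K by (simp add: mult_left_le)
          finally have "R + K * T < norm p"
            using z norm_triangle_ineq2[of z p] by (simp add: norm_minus_commute)
          then have "transport f s p = 0" by (intro transport_eq_0[where R=R] s f(4))
          moreover have "transport f s z = 0" by (rule transport_eq_0[where R=R]) (use s f(4) z K in auto)
          ultimately show ?thesis using False by (simp add: D_def Gp)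
        next
          case True
          have pz: "norm (p - z) \<le> h * (\<alpha> * (\<omega> + h))"
          proof -
            have "norm (p - z) \<le> h * (exp (K * T) * (K * \<omega> + K * (K * h)))"
              using Euler_step[OF st(1-3) \<omega>(2), of z] by (simp add: p_def h_def)
            also have "\<dots> \<le> h * (exp (K * T) * ((K + K\<^sup>2) * (\<omega> + h)))"
              using h K \<omega>(1) by (intro mult_left_mono) (auto simp: algebra_simps power2_eq_square)
            finally show ?thesis by (simp add: \<alpha>_def mult.assoc)
          qed
          have I1: "\<bar>I - h * dvg s z\<bar> \<le> ?N * (K * (\<omega> + 2 * K * h)) * h"
          proof -
            have "I - h * dvg s z = integral {s..t} (\<lambda>r. dvg r (X r t (?\<Phi> z)) - dvg s z)"
              unfolding I_def
              by (subst Henstock_Kurzweil_Integration.integral_diff) (use st in \<open>auto intro!: dvg_integrable simp: h_def\<close>)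
            also have "norm \<dots> \<le> ?N * (K * (\<omega> + 2 * K * h)) * (t - s)"
            proof (rule integral_bound)
              fix r assume r: "r \<in> {s..t}"
              have "\<bar>dvg r (X r t (?\<Phi> z)) - dvg s z\<bar> \<le> ?N * (K * (d r s + norm (X r t (?\<Phi> z) - z)))"
                by (rule dvg_close) (use r st in auto)
              also have "\<dots> \<le> ?N * (K * (\<omega> + 2 * K * h))"
                using near[OF r] \<omega>(2)[OF r] K by (intro mult_left_mono add_mono) auto
              finally show "norm (dvg r (X r t (?\<Phi> z)) - dvg s z) \<le> ?N * (K * (\<omega> + 2 * K * h))" by simp
            qed (use st in \<open>auto intro!: continuous_intros continuous_on_subset[OF continuous_dvg]\<close>)
            finally show ?thesis by (simp add: h_def)
          qed
          have I2: "\<bar>I\<bar> \<le> ?N * K * h"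
          proof -
            have "norm I \<le> ?N * K * (t - s)" unfolding I_def
              by (rule integral_bound) (use st dvg_bound in \<open>auto intro!: continuous_on_subset[OF continuous_dvg]\<close>)
            then show ?thesis by (simp add: h_def)
          qed
          have I3: "\<bar>I\<bar> \<le> 1/2"
          proof -
            have "?N * K * h + K * h \<le> 1/2" using h(3) by (simp add: algebra_simps)
            moreover have "0 \<le> K * h" using h K by simp
            ultimately show ?thesis using I2 by linarith
          qed
          have eI: "exp (- I) \<le> 2" using exp_bound_half[of "- I"] I3 by simp
          have "\<bar>J z - exp I\<bar> \<le> \<bar>J z - 1 - h * dvg s z\<bar> + \<bar>I - h * dvg s z\<bar> + \<bar>exp I - 1 - I\<bar>"
            by linarith
          also have "\<dots> \<le> Nc * h\<^sup>2 + ?N * (K * (\<omega> + 2 * K * h)) * h + (?N * K * h)\<^sup>2"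
          proof (intro add_mono J I1)
            have "\<bar>exp I - 1 - I\<bar> \<le> I\<^sup>2" by (rule exp_quadratic_remainder) (use I3 in auto)
            also have "\<dots> \<le> (?N * K * h)\<^sup>2" using power_mono[OF I2, of 2] by simp
            finally show "\<bar>exp I - 1 - I\<bar> \<le> (?N * K * h)\<^sup>2" .
          qed
          \<comment> \<open>All three errors are of the form \<open>h * O(\<omega> + h)\<close>.\<close>
          also have "\<dots> = h * (Nc * h + ?N * K * \<omega> + 2 * ?N * K\<^sup>2 * h + (?N * K)\<^sup>2 * h)"
            by (simp add: algebra_simps power2_eq_square)
          also have "\<dots> \<le> h * (Nc * (\<omega> + h) + ?N * K * (\<omega> + h) + 2 * ?N * K\<^sup>2 * (\<omega> + h) + (?N * K)\<^sup>2 * (\<omega> + h))"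
            using h(1) \<omega>(1) K Nc0 by (intro mult_left_mono add_mono) auto
          finally have J2: "\<bar>J z - exp I\<bar> \<le> h * (\<gamma> / 2 * (\<omega> + h))" by (simp add: \<gamma>_def algebra_simps)
          have "exp (- I) * J z - 1 = exp (- I) * (J z - exp I)" by (simp add: algebra_simps flip: exp_add)
          then have "\<bar>exp (- I) * J z - 1\<bar> = exp (- I) * \<bar>J z - exp I\<bar>" by (simp add: abs_mult)
          also have "\<dots> \<le> 2 * (h * (\<gamma> / 2 * (\<omega> + h)))" using eI J2 by (intro mult_mono) auto
          finally have J3: "\<bar>exp (- I) * J z - 1\<bar> \<le> h * (\<gamma> * (\<omega> + h))" by simp
          have "D z = transport f s p * (exp (- I) * J z - 1) + (transport f s p - transport f s z)"
            by (simp add: D_def Gp algebra_simps)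
          then have "\<bar>D z\<bar> \<le> \<bar>transport f s p\<bar> * \<bar>exp (- I) * J z - 1\<bar> + \<bar>transport f s p - transport f s z\<bar>"
            using abs_triangle_ineq[of "transport f s p * (exp (- I) * J z - 1)" "transport f s p - transport f s z"] by (simp add: abs_mult)
          also have "\<dots> \<le> BG * (h * (\<gamma> * (\<omega> + h))) + LG * (h * (\<alpha> * (\<omega> + h)))"
          proof (intro add_mono mult_mono BG[OF s] J3)
            show "\<bar>transport f s p - transport f s z\<bar> \<le> LG * (h * (\<alpha> * (\<omega> + h)))"
              using LG(2)[OF s, of p z] mult_left_mono[OF pz LG(1)] by linarith
          qed (use BG0 in auto)
          also have "\<dots> = C0 * (h * (\<omega> + h))" by (simp add: C0_def algebra_simps)
          finally show ?thesis using True by simp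
        qed
      qed
      finally show ?thesis .
    qed
    also have "\<dots> = C * ((t - s) * (\<omega> + (t - s)))"
      using Afin by (simp add: C_def h_def A_def)
    finally show ?thesis .
  qed
  moreover have "0 \<le> C" using C00 by (simp add: C_def)
  ultimately show ?thesis by (intro exI[of _ C]) blast
qed

text \<open>Conservation of mass for Lipschitz data with bounded support: by \<open>one_step\<close> the time derivative of the
integral is zero.\<close>

lemma transport_integral_constant:
  assumes f: "\<And>x y. \<bar>f x - f y\<bar> \<le> L * norm (x - y)" "0 \<le> L" "\<And>x. \<bar>f x\<bar> \<le> B"
    "\<And>x. R < norm x \<Longrightarrow> f x = 0" and t: "t \<in> {0..T}"
  shows "integral\<^sup>L lborel (transport f t) = integral\<^sup>L lborel f"
proof -
  define F where "F t = integral\<^sup>L lborel (transport f t)" for t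
  obtain C where C: "0 \<le> C" and step: "\<And>s t \<omega>. 0 \<le> s \<Longrightarrow> s \<le> t \<Longrightarrow> t \<le> T \<Longrightarrow> t - s \<le> 1 \<Longrightarrow>
    (t - s) * ((DIM('a) + 1) * K) \<le> 1/2 \<Longrightarrow> 0 \<le> \<omega> \<Longrightarrow> (\<And>r. r \<in> {s..t} \<Longrightarrow> d r s \<le> \<omega>) \<Longrightarrow>
    \<bar>F t - F s\<bar> \<le> C * ((t - s) * (\<omega> + (t - s)))"
    using one_step[OF f] unfolding F_def by metis
  have "(F has_real_derivative 0) (at s within {0..T})" if s: "s \<in> {0..T}" for s
    unfolding has_field_derivative_iff tendsto_iff eventually_at
  proof (intro allI impI)
    fix e :: real assume e: "0 < e"
    define \<omega> where "\<omega> = e / (4 * (C + 1))"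
    have \<omega>: "0 < \<omega>" using e C by (simp add: \<omega>_def)
    obtain \<delta> where \<delta>: "0 < \<delta>" "\<And>r s. r \<in> {0..T} \<Longrightarrow> s \<in> {0..T} \<Longrightarrow> \<bar>r - s\<bar> < \<delta> \<Longrightarrow> d r s \<le> \<omega>"
      using d_small[OF \<omega>] by blast
    define m where "m = (DIM('a) + 1) * K + 1"
    have m: "1 \<le> m" using K by (simp add: m_def)
    let ?\<delta> = "min (min \<delta> \<omega>) (1 / (2 * m))"
    \<comment> \<open>\<open>one_step\<close> starts from the smaller of the two times, so it serves for both one-sided derivatives.\<close>
    have small: "\<bar>F b - F a\<bar> \<le> C * ((b - a) * (2 * \<omega>))" if ab: "0 \<le> a" "a \<le> b" "b \<le> T" "b - a < ?\<delta>" for a b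
    proof -
      have "\<bar>F b - F a\<bar> \<le> C * ((b - a) * (\<omega> + (b - a)))"
      proof (rule step)
        have "1 / (2 * m) \<le> 1" using m by simp
        then show "b - a \<le> 1" using ab by linarith
        have "(b - a) * ((DIM('a) + 1) * K) \<le> (b - a) * m" using ab K by (intro mult_left_mono) (auto simp: m_def)
        also have "\<dots> \<le> 1 / (2 * m) * m" using ab m by (intro mult_right_mono) auto
        finally show "(b - a) * ((DIM('a) + 1) * K) \<le> 1/2" using m by simp
        show "d r a \<le> \<omega>" if "r \<in> {a..b}" for r by (rule \<delta>(2)) (use that ab in auto)
      qed (use ab \<omega> in auto)
      also have "\<dots> \<le> C * ((b - a) * (2 * \<omega>))" using ab C by (intro mult_left_mono) auto
      finally show ?thesis .
    qed
    show "\<exists>\<delta>>0. \<forall>y\<in>{0..T}. y \<noteq> s \<and> dist y s < \<delta> \<longrightarrow> dist ((F y - F s) / (y - s)) 0 < e"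
    proof (intro exI[of _ ?\<delta>] conjI ballI impI)
      show "0 < ?\<delta>" using \<delta> \<omega> m by auto
      fix y assume y: "y \<in> {0..T}" "y \<noteq> s \<and> dist y s < ?\<delta>"
      have "\<bar>F y - F s\<bar> \<le> C * (\<bar>y - s\<bar> * (2 * \<omega>))"
      proof (cases "s \<le> y")
        case True
        then show ?thesis using small[of s y] s y by (simp add: dist_real_def)
      next
        case False
        then show ?thesis using small[of y s] s y by (simp add: dist_real_def abs_minus_commute)
      qed
      then have "\<bar>F y - F s\<bar> / \<bar>y - s\<bar> \<le> C * (2 * \<omega>)" using y by (simp add: field_simps)
      also have "\<dots> \<le> (C + 1) * (2 * \<omega>)" using \<omega> by (intro mult_right_mono) auto
      also have "\<dots> = e / 2" using C by (simp add: \<omega>_def field_simps)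
      also have "\<dots> < e" using e by simp
      finally show "dist ((F y - F s) / (y - s)) 0 < e" by simp
    qed
  qed
  then obtain c where "\<And>s. s \<in> {0..T} \<Longrightarrow> F s = c"
    using has_field_derivative_zero_constant[of "{0..T}" F] by auto
  then have "F t = F 0" using t zero_in by simp
  moreover have "transport f 0 = f" using zero_in by (simp add: transport_def [abs_def] weight_def X_init)
  ultimately show ?thesis by (simp add: F_def)
qed

end

text \<open>Lipschitz approximations of the indicator of a box from below: the class of functions whose integrals can
be differentiated along the flow is rich enough to determine a measure.\<close>

lemma box_indicator_limit:
  fixes l u :: "'a::euclidean_space"
  shows "(\<lambda>n. min 1 (real n * infdist y (- box l u))) \<longlonglongrightarrow> indicator (box l u) y"
proof (cases "y \<in> box l u")
  case False
  then show ?thesis by (simp add: infdist_zero)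
next
  case True
  have ne: "- box l u \<noteq> {}"
    using not_bounded_UNIV[where 'a='a] bounded_box[of l u] by (metis Compl_empty_eq double_complement)
  have "closed (- box l u)" by (simp add: closed_Compl open_box)
  then have pos: "0 < infdist y (- box l u)"
    using True ne infdist_pos_not_in_closed[of "- box l u" y] by simp
  obtain n0 where n0: "1 < real n0 * infdist y (- box l u)" using reals_Archimedean3[OF pos] by blast
  have "eventually (\<lambda>n. min 1 (real n * infdist y (- box l u)) = 1) sequentially"
    unfolding eventually_sequentially
  proof (intro exI[of _ n0] allI impI)
    fix n assume "n0 \<le> n"
    then have "real n0 * infdist y (- box l u) \<le> real n * infdist y (- box l u)"
      using pos by (intro mult_right_mono) auto
    then show "min 1 (real n * infdist y (- box l u)) = 1" using n0 by simp
  qed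
  then show ?thesis using True by (simp add: tendsto_eventually)
qed

context regular_flow begin

lemma weight_continuous: "continuous_on UNIV (weight t)" if "t \<in> {0..T}"
  by (rule lipschitz_on_continuous_on[where L="exp (DIM('a) * K * T) * (DIM('a) * (K * exp (K * T)) * T)"],
      rule lipschitz_onI) (use weight_Lipschitz[OF that] K T in \<open>auto simp: dist_norm\<close>)

lemma X_continuous: "continuous_on UNIV (X s t)" if "s \<in> {0..T}" "t \<in> {0..T}"
  by (rule lipschitz_on_continuous_on[where L="exp (K * T)"], rule lipschitz_onI)
    (use X_Lipschitz[OF that(2,1)] in \<open>auto simp: dist_norm\<close>)

lemma weight_measurable: "t \<in> {0..T} \<Longrightarrow> weight t \<in> borel_measurable borel"
  by (intro borel_measurable_continuous_onI weight_continuous)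

lemma X_measurable: "s \<in> {0..T} \<Longrightarrow> t \<in> {0..T} \<Longrightarrow> X s t \<in> borel_measurable borel"
  by (intro borel_measurable_continuous_onI X_continuous)

text \<open>Liouville's formula. The integrals of the approximations of \<open>box_indicator_limit\<close> with respect to the two
measures agree by \<open>transport_integral_constant\<close>, so both measures coincide on boxes.\<close>

theorem flow_pushforward: "distr (density lborel (\<lambda>x. ennreal (weight t x))) borel (X 0 t) = lborel"
  if t: "t \<in> {0..T}"
proof (rule lborel_eqI[symmetric])
  note [measurable] = weight_measurable[OF t] X_measurable[OF zero_in t]
  let ?\<mu> = "distr (density lborel (\<lambda>x. ennreal (weight t x))) borel (X 0 t)"
  fix l u :: 'a assume lu: "\<And>b. b \<in> Basis \<Longrightarrow> l \<bullet> b \<le> u \<bullet> b"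
  define f where "f n y = min 1 (real n * infdist y (- box l u))" for n y
  have f_Lip: "\<bar>f n x - f n y\<bar> \<le> real n * norm (x - y)" for n x y
  proof -
    have "\<bar>f n x - f n y\<bar> \<le> \<bar>real n * infdist x (- box l u) - real n * infdist y (- box l u)\<bar>"
      unfolding f_def by (simp add: min_def)
    also have "\<dots> = real n * \<bar>infdist x (- box l u) - infdist y (- box l u)\<bar>"
      by (simp add: abs_mult flip: right_diff_distrib)
    also have "\<dots> \<le> real n * norm (x - y)"
      using infdist_triangle_abs[of x _ y] by (intro mult_left_mono) (auto simp: dist_norm)
    finally show ?thesis .
  qed
  have f0: "0 \<le> f n y" and f1: "\<bar>f n y\<bar> \<le> 1" for n y
    by (auto simp: f_def infdist_nonneg)
  obtain R where R: "\<And>y. y \<in> box l u \<Longrightarrow> norm y \<le> R"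
    using bounded_box[of l u] by (auto simp: bounded_iff)
  have f_supp: "f n y = 0" if "R < norm y" for n y
  proof -
    have "y \<notin> box l u" using R[of y] that by linarith
    then show ?thesis by (simp add: f_def infdist_zero)
  qed
  have [measurable]: "f n \<in> borel_measurable borel" for n
    unfolding f_def [abs_def] by (intro borel_measurable_continuous_onI continuous_intros)
  have transport_f: "integrable lborel (transport (f n) s)" if "s \<in> {0..T}" for n s
    by (rule transport_integrable[where L="real n" and B=1 and R=R]) (fact that f_Lip f1 | simp | erule f_supp)+
  have transport_f_const: "integral\<^sup>L lborel (transport (f n) t) = integral\<^sup>L lborel (f n)" for n
    by (rule transport_integral_constant[where L="real n" and B=1 and R=R]) (fact t f_Lip f1 | simp | erule f_supp)+
  have "transport (f n) 0 = f n" for n using zero_in by (simp add: transport_def [abs_def] weight_def X_init)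
  then have f_int: "integrable lborel (f n)" for n using transport_f[OF zero_in, of n] by simp
  have eq: "(\<integral>\<^sup>+y. ennreal (f n y) \<partial>?\<mu>) = (\<integral>\<^sup>+y. ennreal (f n y) \<partial>lborel)" for n
  proof -
    have "(\<integral>\<^sup>+y. ennreal (f n y) \<partial>?\<mu>) = (\<integral>\<^sup>+x. ennreal (weight t x) * ennreal (f n (X 0 t x)) \<partial>lborel)"
      by (simp add: nn_integral_distr nn_integral_density)
    also have "\<dots> = (\<integral>\<^sup>+x. ennreal (transport (f n) t x) \<partial>lborel)"
      using f0 less_imp_le[OF weight_pos] by (intro nn_integral_cong) (simp add: transport_def ennreal_mult[symmetric] mult.commute)
    also have "\<dots> = ennreal (integral\<^sup>L lborel (transport (f n) t))"
      by (intro nn_integral_eq_integral transport_f t) (simp add: transport_def f0 less_imp_le[OF weight_pos])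
    also have "\<dots> = (\<integral>\<^sup>+y. ennreal (f n y) \<partial>lborel)"
      unfolding transport_f_const by (intro nn_integral_eq_integral[symmetric] f_int) (simp add: f0)
    finally show ?thesis .
  qed
  have lim: "(\<lambda>n. \<integral>\<^sup>+y. ennreal (f n y) \<partial>M) \<longlonglongrightarrow> emeasure M (box l u)"
    if "sets M = sets borel" for M :: "'a measure"
  proof -
    have "(\<lambda>n. \<integral>\<^sup>+y. ennreal (f n y) \<partial>M) \<longlonglongrightarrow> (\<integral>\<^sup>+y. ennreal (indicator (box l u) y) \<partial>M)"
    proof (rule nn_integral_LIMSEQ)
      show "incseq (\<lambda>n y. ennreal (f n y))"
        by (auto simp: incseq_def le_fun_def f_def intro!: ennreal_leI min.mono mult_right_mono infdist_nonneg)
      show "(\<lambda>y. ennreal (f n y)) \<in> borel_measurable M" for n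
        unfolding measurable_cong_sets[OF that refl] by measurable
      show "(\<lambda>n. ennreal (f n y)) \<longlonglongrightarrow> ennreal (indicator (box l u) y)" for y
        unfolding f_def by (intro tendsto_ennrealI box_indicator_limit)
    qed
    then show ?thesis using that by (simp add: ennreal_indicator)
  qed
  have "emeasure ?\<mu> (box l u) = emeasure lborel (box l u)"
    using LIMSEQ_unique[OF lim[of ?\<mu>, unfolded eq] lim[of lborel]] by simp
  then show "emeasure ?\<mu> (box l u) = (\<Prod>b\<in>Basis. (u - l) \<bullet> b)"
    using emeasure_lborel_box[OF lu] by simp
qed simp

text \<open>The flow pulls null sets back to null sets because the density \<open>weight t\<close> is positive everywhere.\<close>

lemma flow_AE: "AE x in lebesgue. P (X 0 t x)" if t: "t \<in> {0..T}" and "AE y in lebesgue. P y"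
proof -
  note [measurable] = weight_measurable[OF t] X_measurable[OF zero_in t]
  have "AE y in distr (density lborel (\<lambda>x. ennreal (weight t x))) borel (X 0 t). P y"
    using that(2) by (simp only: flow_pushforward[OF t] AE_completion_iff)
  then have "AE x in density lborel (\<lambda>x. ennreal (weight t x)). P (X 0 t x)"
    by (rule AE_distrD[rotated]) simp
  then show ?thesis by (simp add: AE_density weight_pos AE_completion_iff)
qed

text \<open>For Lebesgue measurable \<open>g\<close>, pass to a Borel representative; by \<open>flow_AE\<close> this is harmless along the
flow as well.\<close>

theorem flow_integral: "(LINT x|lebesgue. g (X 0 t x) * weight t x) = integral\<^sup>L lebesgue g"
  if t: "t \<in> {0..T}" and g: "integrable lebesgue g"
proof -
  note [measurable] = weight_measurable[OF t] X_measurable[OF zero_in t]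
  obtain g' where g'm [measurable]: "g' \<in> borel_measurable lborel" and "AE y in lborel. g y = g' y"
    using completion_ex_borel_measurable_real[of g lborel] g by auto
  then have ae: "AE y in lebesgue. g y = g' y" by (simp add: AE_completion_iff)
  have g'm2 [measurable]: "g' \<in> borel_measurable borel" using g'm by simp
  have meas: "(\<lambda>x. g' (X 0 t x) * weight t x) \<in> borel_measurable lebesgue"
    by (intro measurable_completion) measurable
  have ae2: "AE x in lebesgue. g' (X 0 t x) * weight t x = g (X 0 t x) * weight t x"
    using flow_AE[OF t ae] by eventually_elim simp
  have "(LINT x|lebesgue. g (X 0 t x) * weight t x) = (LINT x|lebesgue. g' (X 0 t x) * weight t x)"
    by (rule integral_cong_AE[OF borel_measurable_AE[OF meas ae2] meas]) (use ae2 in \<open>auto elim: eventually_mono\<close>)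
  also have "\<dots> = (LINT x|lborel. g' (X 0 t x) * weight t x)"
    by (subst integral_completion) measurable
  also have "\<dots> = integral\<^sup>L (distr (density lborel (\<lambda>x. ennreal (weight t x))) borel (X 0 t)) g'"
    by (subst integral_distr; (subst integral_density)?) (auto simp: less_imp_le[OF weight_pos] mult.commute)
  also have "\<dots> = integral\<^sup>L lebesgue g'" by (simp add: flow_pushforward[OF t] integral_completion)
  also have "\<dots> = integral\<^sup>L lebesgue g"
    by (rule integral_cong_AE) (use g ae in \<open>auto intro: measurable_completion elim: eventually_mono\<close>)
  finally show ?thesis .
qed

end

section \<open>Convolution with a smooth compactly supported kernel\<close>

lemma has_derivative_partials:
  fixes f :: "'a::euclidean_space \<Rightarrow> 'b::real_normed_vector"
  assumes "f differentiable (at x)"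
  shows "(f has_derivative (\<lambda>y. \<Sum>b\<in>Basis. (y \<bullet> b) *\<^sub>R partial b f x)) (at x)"
proof -
  have D: "(f has_derivative frechet_derivative f (at x)) (at x)"
    using assms frechet_derivative_works by blast
  then have lin: "linear (frechet_derivative f (at x))" by (rule has_derivative_linear)
  have "frechet_derivative f (at x) y = (\<Sum>b\<in>Basis. (y \<bullet> b) *\<^sub>R partial b f x)" for y
  proof -
    have "frechet_derivative f (at x) y = frechet_derivative f (at x) (\<Sum>b\<in>Basis. (y \<bullet> b) *\<^sub>R b)"
      by (simp add: euclidean_representation)
    also have "\<dots> = (\<Sum>b\<in>Basis. (y \<bullet> b) *\<^sub>R partial b f x)"
      by (simp add: linear_sum[OF lin] linear_cmul[OF lin] partial_def)
    finally show ?thesis .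
  qed
  with D show ?thesis by (metis (no_types, lifting) ext)
qed

lemma partial_eq: "(f has_derivative f') (at x) \<Longrightarrow> partial b f x = f' b"
  unfolding partial_def using frechet_derivative_at by metis

lemma C_k_continuous: "C_k k f \<Longrightarrow> continuous_on UNIV f"
  by (cases k) (auto simp: continuous_on_eq_continuous_at differentiable_imp_continuous_within)

lemma sum_inner_scaleR_bound:
  fixes D :: "'a::euclidean_space \<Rightarrow> 'b::real_normed_vector" and C :: real
  assumes "\<And>b. b \<in> Basis \<Longrightarrow> norm (D b) \<le> C"
  shows "norm (\<Sum>b\<in>Basis. (y \<bullet> b) *\<^sub>R D b) \<le> DIM('a) * C * norm y"
proof -
  have "norm ((y \<bullet> b) *\<^sub>R D b) \<le> C * norm y" if "b \<in> Basis" for b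
    using assms[OF that] Basis_le_norm[OF that, of y] by (auto simp: mult.commute[of C] intro!: mult_mono')
  then have "norm (\<Sum>b\<in>Basis. (y \<bullet> b) *\<^sub>R D b) \<le> DIM('a) * (C * norm y)"
    by (intro sum_norm_bound) auto
  then show ?thesis by simp
qed

lemma continuous_bounded_finite_family:
  fixes f :: "'i \<Rightarrow> 'a::topological_space \<Rightarrow> 'b::real_normed_vector"
  assumes "finite I" "compact S" "\<And>i. i \<in> I \<Longrightarrow> continuous_on S (f i)"
  shows "\<exists>C\<ge>0. \<forall>i\<in>I. \<forall>x\<in>S. norm (f i x) \<le> C"
proof -
  have "bounded (\<Union>i\<in>I. f i ` S)"
    using assms by (auto intro!: bounded_UN compact_imp_bounded compact_continuous_image)
  then obtain C where "\<And>x i. i \<in> I \<Longrightarrow> x \<in> S \<Longrightarrow> norm (f i x) \<le> C"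
    unfolding bounded_iff by blast
  then show ?thesis by (intro exI[of _ "max C 0"]) (auto simp: le_max_iff_disj)
qed

text \<open>The mean value inequality on a convex compact set, where the continuous partial derivatives are bounded.\<close>

lemma C1_Lipschitz_on_ball:
  fixes f :: "'a::euclidean_space \<Rightarrow> 'b::real_normed_vector"
  assumes f: "\<And>x. f differentiable (at x)" "\<And>b. b \<in> Basis \<Longrightarrow> continuous_on UNIV (partial b f)"
  shows "\<exists>C\<ge>0. \<forall>x\<in>cball 0 R. \<forall>y\<in>cball 0 R. norm (f x - f y) \<le> C * norm (x - y)"
proof -
  obtain C where C: "0 \<le> C" "\<And>b x. b \<in> Basis \<Longrightarrow> x \<in> cball 0 R \<Longrightarrow> norm (partial b f x) \<le> C"
    using continuous_bounded_finite_family[of Basis "cball 0 R" "\<lambda>b. partial b f"] f(2)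
    by (meson compact_cball continuous_on_subset finite_Basis subset_UNIV)
  have "norm (f x - f y) \<le> (DIM('a) * C) * norm (x - y)" if "x \<in> cball 0 R" "y \<in> cball 0 R" for x y
  proof (rule differentiable_bound[where S="cball 0 R"])
    fix z :: 'a assume z: "z \<in> cball 0 R"
    show "(f has_derivative (\<lambda>y. \<Sum>b\<in>Basis. (y \<bullet> b) *\<^sub>R partial b f z)) (at z within cball 0 R)"
      using has_derivative_partials[OF f(1)] has_derivative_at_withinI by blast
    show "onorm (\<lambda>y. \<Sum>b\<in>Basis. (y \<bullet> b) *\<^sub>R partial b f z) \<le> DIM('a) * C"
      by (intro onorm_le sum_inner_scaleR_bound C(2) z)
  qed (use that in auto)
  then show ?thesis using C(1) by (intro exI[of _ "DIM('a) * C"]) auto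
qed

text \<open>The function vanishes on an open neighbourhood of \<open>x\<close>.\<close>

lemma partial_outside_support:
  fixes f :: "'a::euclidean_space \<Rightarrow> 'b::real_normed_vector"
  assumes "\<And>x. R < norm x \<Longrightarrow> f x = 0" "R < norm x"
  shows "partial b f x = 0"
proof -
  have op: "open {x::'a. R < norm x}" by (intro open_Collect_less continuous_intros)
  have "((\<lambda>_. 0) has_derivative (\<lambda>_. 0)) (at x)" by simp
  then have "(f has_derivative (\<lambda>_. 0)) (at x)"
    by (rule has_derivative_transform_within_open[OF _ op]) (use assms(2) in simp, simp add: assms(1))
  then show ?thesis by (rule partial_eq)
qed

lemma continuous_compact_support_bounded:
  fixes f :: "'a::euclidean_space \<Rightarrow> 'b::real_normed_vector"
  assumes "continuous_on UNIV f" "\<And>x. R < norm x \<Longrightarrow> f x = 0"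
  shows "\<exists>C\<ge>0. \<forall>x. norm (f x) \<le> C"
proof -
  obtain C where C: "0 \<le> C" "\<And>x. x \<in> cball 0 R \<Longrightarrow> norm (f x) \<le> C"
    using continuous_bounded_finite_family[of "{()}" "cball 0 R" "\<lambda>_. f"] assms(1)
    by (metis compact_cball continuous_on_subset finite.intros insertI1 subset_UNIV)
  have "norm (f x) \<le> C" for x
    using C assms(2)[of x] by (cases "norm x \<le> R") auto
  then show ?thesis using C by blast
qed

lemma C1_compact_support_Lipschitz:
  fixes f :: "'a::euclidean_space \<Rightarrow> real"
  assumes f: "C_k (Suc k) f" "\<And>x. R < norm x \<Longrightarrow> f x = 0"
  shows "\<exists>C\<ge>0. (\<forall>x. \<bar>f x\<bar> \<le> C) \<and> (\<forall>x y. \<bar>f x - f y\<bar> \<le> C * norm (x - y))"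
proof -
  have "\<exists>C\<ge>0. \<forall>x. norm (partial b f x) \<le> C" if "b \<in> Basis" for b
    by (rule continuous_compact_support_bounded[where R=R])
      (use f that in \<open>auto intro: C_k_continuous partial_outside_support\<close>)
  then obtain C where C: "\<And>b x. b \<in> Basis \<Longrightarrow> 0 \<le> C b \<and> norm (partial b f x) \<le> C b" by metis
  define B where "B = DIM('a) * sum C Basis"
  have CB: "C b \<le> sum C Basis" if "b \<in> Basis" for b
    using that C by (intro member_le_sum) auto
  have lip: "norm (f x - f y) \<le> B * norm (x - y)" for x y
  proof (rule derivative_bound_Lipschitz)
    show "(f has_derivative (\<lambda>y. \<Sum>b\<in>Basis. (y \<bullet> b) *\<^sub>R partial b f z)) (at z)" for z
      by (rule has_derivative_partials) (use f in auto)
    show "norm (\<Sum>b\<in>Basis. (y \<bullet> b) *\<^sub>R partial b f z) \<le> B * norm y" for z y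
      unfolding B_def by (rule sum_inner_scaleR_bound) (use C CB order_trans in blast)
  qed
  obtain A where A: "0 \<le> A" "\<And>x. norm (f x) \<le> A"
    using continuous_compact_support_bounded[OF C_k_continuous[OF f(1)] f(2)] by blast
  have "0 \<le> sum C Basis" by (rule sum_nonneg) (use C in auto)
  then have "0 \<le> B" by (simp add: B_def)
  then show ?thesis using A lip
    by (intro exI[of _ "A + B"]) (auto simp: distrib_right intro: order_trans[OF A(2)[simplified]] order_trans[OF lip[simplified]])
qed

text \<open>A quadratic remainder bound passes through integrals and through the components of a matrix, so it is
used below as the criterion for differentiability.\<close>

lemma has_derivative_quadratic_remainder:
  fixes f :: "'a::real_normed_vector \<Rightarrow> 'b::real_normed_vector" and C :: real
  assumes f': "bounded_linear f'" and f: "\<And>y. norm (f y - f x - f' (y - x)) \<le> C * (norm (y - x))\<^sup>2" and C: "0 \<le> C"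
  shows "(f has_derivative f') (at x)"
  unfolding has_derivative_at_alt
proof (intro conjI allI impI f')
  fix e :: real assume e: "0 < e"
  show "\<exists>d>0. \<forall>y. norm (y - x) < d \<longrightarrow> norm (f y - f x - f' (y - x)) \<le> e * norm (y - x)"
  proof (intro exI[of _ "e / (C + 1)"] conjI allI impI)
    show "0 < e / (C + 1)" using e C by simp
    fix y assume y: "norm (y - x) < e / (C + 1)"
    have "C * norm (y - x) \<le> (C + 1) * (e / (C + 1))" using y C by (intro mult_mono) auto
    also have "\<dots> = e" using C by simp
    finally have "C * norm (y - x) * norm (y - x) \<le> e * norm (y - x)" by (intro mult_right_mono) auto
    then show "norm (f y - f x - f' (y - x)) \<le> e * norm (y - x)"
      using f[of y] by (simp add: power2_eq_square mult.assoc)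
  qed
qed

lemma convolution_integrable:
  fixes \<rho> g :: "real^'n \<Rightarrow> real" and C :: real
  assumes \<rho>: "integrable lebesgue \<rho>" and g: "continuous_on UNIV g" "\<And>x. \<bar>g x\<bar> \<le> C"
  shows "integrable lebesgue (\<lambda>\<xi>. \<rho> \<xi> * g (x - \<xi>))"
proof (rule Bochner_Integration.integrable_bound[of _ "\<lambda>\<xi>. C * \<rho> \<xi>"])
  have "(\<lambda>\<xi>. g (x - \<xi>)) \<in> borel_measurable lebesgue"
    using continuous_imp_measurable_on_sets_lebesgue[of UNIV "\<lambda>\<xi>. g (x - \<xi>)"]
      continuous_on_compose2[OF g(1), of UNIV "\<lambda>\<xi>. x - \<xi>"]
    by (simp add: lebesgue_on_UNIV_eq continuous_on_diff)
  then show "(\<lambda>\<xi>. \<rho> \<xi> * g (x - \<xi>)) \<in> borel_measurable lebesgue" using \<rho> by (intro borel_measurable_times) auto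
  show "AE \<xi> in lebesgue. norm (\<rho> \<xi> * g (x - \<xi>)) \<le> norm (C * \<rho> \<xi>)"
  proof (rule AE_I2)
    fix \<xi>
    have "\<bar>\<rho> \<xi>\<bar> * \<bar>g (x - \<xi>)\<bar> \<le> \<bar>\<rho> \<xi>\<bar> * \<bar>C\<bar>" using g(2)[of "x - \<xi>"] by (intro mult_left_mono) auto
    then show "norm (\<rho> \<xi> * g (x - \<xi>)) \<le> norm (C * \<rho> \<xi>)" by (simp add: abs_mult mult.commute)
  qed
qed (use \<rho> in auto)

lemma integral_mult_bound:
  fixes \<rho> k :: "'a \<Rightarrow> real" and C :: real
  assumes \<rho>: "integrable M \<rho>" and k: "integrable M (\<lambda>\<xi>. \<rho> \<xi> * k \<xi>)" "\<And>\<xi>. \<bar>k \<xi>\<bar> \<le> C"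
  shows "\<bar>LINT \<xi>|M. \<rho> \<xi> * k \<xi>\<bar> \<le> C * (LINT \<xi>|M. \<bar>\<rho> \<xi>\<bar>)"
proof -
  have "\<bar>LINT \<xi>|M. \<rho> \<xi> * k \<xi>\<bar> \<le> (LINT \<xi>|M. \<bar>\<rho> \<xi> * k \<xi>\<bar>)"
    using integral_norm_bound[of M "\<lambda>\<xi>. \<rho> \<xi> * k \<xi>"] by simp
  also have "\<dots> \<le> (LINT \<xi>|M. C * \<bar>\<rho> \<xi>\<bar>)"
  proof (rule integral_mono)
    fix \<xi> show "\<bar>\<rho> \<xi> * k \<xi>\<bar> \<le> C * \<bar>\<rho> \<xi>\<bar>"
      using mult_left_mono[OF k(2)[of \<xi>], of "\<bar>\<rho> \<xi>\<bar>"] by (simp add: abs_mult mult.commute)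
  qed (use \<rho> k in auto)
  finally show ?thesis by simp
qed

lemma convolution_bound:
  fixes \<rho> g :: "real^'n \<Rightarrow> real" and C :: real
  assumes \<rho>: "integrable lebesgue \<rho>" and g: "continuous_on UNIV g" "\<And>x. \<bar>g x\<bar> \<le> C"
  shows "\<bar>convolution \<rho> g x\<bar> \<le> C * (LINT \<xi>|lebesgue. \<bar>\<rho> \<xi>\<bar>)"
  unfolding convolution_def
  by (rule integral_mult_bound[OF \<rho> convolution_integrable[OF \<rho> g]]) (use g in auto)

lemma convolution_diff_density:
  fixes \<rho> \<sigma> g :: "real^'n \<Rightarrow> real" and C :: real
  assumes "integrable lebesgue \<rho>" "integrable lebesgue \<sigma>" and g: "continuous_on UNIV g" "\<And>x. \<bar>g x\<bar> \<le> C"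
  shows "convolution \<rho> g x - convolution \<sigma> g x = convolution (\<lambda>\<xi>. \<rho> \<xi> - \<sigma> \<xi>) g x"
  unfolding convolution_def
  by (subst Bochner_Integration.integral_diff[symmetric])
    (auto intro!: convolution_integrable assms simp: left_diff_distrib)

lemma convolution_Lipschitz:
  fixes \<rho> g :: "real^'n \<Rightarrow> real" and C :: real
  assumes \<rho>: "integrable lebesgue \<rho>" and g: "continuous_on UNIV g" "\<And>x. \<bar>g x\<bar> \<le> C"
    "\<And>x y. \<bar>g x - g y\<bar> \<le> C * norm (x - y)"
  shows "\<bar>convolution \<rho> g x - convolution \<rho> g y\<bar> \<le> C * norm (x - y) * (LINT \<xi>|lebesgue. \<bar>\<rho> \<xi>\<bar>)"
proof -
  have "convolution \<rho> g x - convolution \<rho> g y = (LINT \<xi>|lebesgue. \<rho> \<xi> * (g (x - \<xi>) - g (y - \<xi>)))"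
    unfolding convolution_def right_diff_distrib
    by (intro Bochner_Integration.integral_diff[symmetric] convolution_integrable[OF \<rho> g(1,2)])
  also have "\<bar>\<dots>\<bar> \<le> C * norm (x - y) * (LINT \<xi>|lebesgue. \<bar>\<rho> \<xi>\<bar>)"
  proof (rule integral_mult_bound[OF \<rho>])
    show "integrable lebesgue (\<lambda>\<xi>. \<rho> \<xi> * (g (x - \<xi>) - g (y - \<xi>)))"
      unfolding right_diff_distrib
      by (intro Bochner_Integration.integrable_diff convolution_integrable[OF \<rho> g(1,2)])
    show "\<bar>g (x - \<xi>) - g (y - \<xi>)\<bar> \<le> C * norm (x - y)" for \<xi> using g(3)[of "x - \<xi>" "y - \<xi>"] by simp
  qed
  finally show ?thesis .
qed

lemma Taylor_remainder:
  fixes g :: "'a::euclidean_space \<Rightarrow> 'b::real_normed_vector" and C :: real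
  assumes g: "\<And>x. g differentiable (at x)"
    and lip: "\<And>b x y. b \<in> Basis \<Longrightarrow> norm (partial b g x - partial b g y) \<le> C * norm (x - y)" and C: "0 \<le> C"
  shows "norm (g y - g x - (\<Sum>b\<in>Basis. ((y - x) \<bullet> b) *\<^sub>R partial b g x)) \<le> DIM('a) * C * (norm (y - x))\<^sup>2"
proof -
  let ?g' = "\<lambda>z h. \<Sum>b\<in>Basis. (h \<bullet> b) *\<^sub>R partial b g z"
  have "norm (g y - g x - ?g' x (y - x)) \<le> norm (y - x) * (DIM('a) * (C * norm (y - x)))"
  proof (rule differentiable_bound_linearization[where S="cball x (norm (y - x))" and f'="?g'"])
    show "x + t *\<^sub>R (y - x) \<in> cball x (norm (y - x))" if "t \<in> {0..1}" for t
      using that by (simp add: dist_norm mult_left_le_one_le)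
    show "(g has_derivative ?g' z) (at z within cball x (norm (y - x)))" for z
      by (rule has_derivative_at_withinI[OF has_derivative_partials[OF g]])
    fix z assume z: "z \<in> cball x (norm (y - x))"
    show "onorm (?g' z - ?g' x) \<le> DIM('a) * (C * norm (y - x))"
    proof (rule onorm_le)
      fix h
      have "(?g' z - ?g' x) h = (\<Sum>b\<in>Basis. (h \<bullet> b) *\<^sub>R (partial b g z - partial b g x))"
        by (simp add: scaleR_diff_right sum_subtractf)
      also have "norm \<dots> \<le> DIM('a) * (C * norm (y - x)) * norm h"
      proof (rule sum_inner_scaleR_bound)
        fix b :: 'a assume b: "b \<in> Basis"
        have "norm (partial b g z - partial b g x) \<le> C * norm (z - x)" by (rule lip[OF b])
        also have "\<dots> \<le> C * norm (y - x)"
          using z C by (intro mult_left_mono) (auto simp: dist_norm norm_minus_commute)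
        finally show "norm (partial b g z - partial b g x) \<le> C * norm (y - x)" .
      qed
      finally show "norm ((?g' z - ?g' x) h) \<le> DIM('a) * (C * norm (y - x)) * norm h" .
    qed
  qed auto
  then show ?thesis by (simp add: power2_eq_square mult_ac)
qed

text \<open>Differentiation under the integral sign with an explicit remainder: integrate the Taylor remainder of
the kernel against \<open>\<rho>\<close>.\<close>

lemma convolution_remainder:
  fixes \<rho> g :: "real^'n \<Rightarrow> real" and C :: real
  assumes \<rho>: "integrable lebesgue \<rho>" and g: "\<And>x. g differentiable (at x)" "\<And>x. \<bar>g x\<bar> \<le> C"
    and pg: "\<And>b x. b \<in> Basis \<Longrightarrow> \<bar>partial b g x\<bar> \<le> C"
      "\<And>b x y. b \<in> Basis \<Longrightarrow> \<bar>partial b g x - partial b g y\<bar> \<le> C * norm (x - y)"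
  shows "\<bar>convolution \<rho> g y - convolution \<rho> g x - (\<Sum>b\<in>Basis. ((y - x) \<bullet> b) * convolution \<rho> (partial b g) x)\<bar>
    \<le> CARD('n) * C * (norm (y - x))\<^sup>2 * (LINT \<xi>|lebesgue. \<bar>\<rho> \<xi>\<bar>)"
proof -
  have C0: "0 \<le> C" using g(2)[of 0] by linarith
  have cont: "continuous_on UNIV g"
    using g(1) by (auto simp: continuous_on_eq_continuous_at differentiable_imp_continuous_within)
  have contp: "continuous_on UNIV (partial b g)" if "b \<in> Basis" for b
    by (rule lipschitz_on_continuous_on[where L=C], rule lipschitz_onI) (use pg that C0 in \<open>auto simp: dist_norm dist_real_def\<close>)
  let ?R = "\<lambda>\<xi>. g (y - \<xi>) - g (x - \<xi>) - (\<Sum>b\<in>Basis. ((y - x) \<bullet> b) * partial b g (x - \<xi>))"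
  have i1: "integrable lebesgue (\<lambda>\<xi>. \<rho> \<xi> * g (z - \<xi>))" for z by (rule convolution_integrable[OF \<rho> cont g(2)])
  have i2: "integrable lebesgue (\<lambda>\<xi>. \<rho> \<xi> * partial b g (z - \<xi>))" if "b \<in> Basis" for b z
    by (rule convolution_integrable[OF \<rho> contp pg(1)]) (use that in auto)
  have R: "\<rho> \<xi> * ?R \<xi> = \<rho> \<xi> * g (y - \<xi>) - \<rho> \<xi> * g (x - \<xi>) -
      (\<Sum>b\<in>Basis. ((y - x) \<bullet> b) * (\<rho> \<xi> * partial b g (x - \<xi>)))" for \<xi>
    by (simp add: right_diff_distrib sum_distrib_left mult.left_commute)
  have iR: "integrable lebesgue (\<lambda>\<xi>. \<rho> \<xi> * ?R \<xi>)"
    unfolding R by (intro Bochner_Integration.integrable_diff i1 Bochner_Integration.integrable_sum integrable_mult_right i2)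
  have "convolution \<rho> g y - convolution \<rho> g x - (\<Sum>b\<in>Basis. ((y - x) \<bullet> b) * convolution \<rho> (partial b g) x)
      = (LINT \<xi>|lebesgue. \<rho> \<xi> * ?R \<xi>)"
    unfolding R convolution_def
    by (subst Bochner_Integration.integral_diff Bochner_Integration.integral_sum,
        auto intro!: Bochner_Integration.integrable_diff i1 Bochner_Integration.integrable_sum integrable_mult_right i2)+
  also have "\<bar>\<dots>\<bar> \<le> CARD('n) * C * (norm (y - x))\<^sup>2 * (LINT \<xi>|lebesgue. \<bar>\<rho> \<xi>\<bar>)"
  proof (rule integral_mult_bound[OF \<rho> iR])
    fix \<xi>
    show "\<bar>?R \<xi>\<bar> \<le> CARD('n) * C * (norm (y - x))\<^sup>2"
      using Taylor_remainder[of g C "y - \<xi>" "x - \<xi>"] g(1) pg(2) C0 by simp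
  qed
  finally show ?thesis .
qed

definition bounded_Lipschitz :: "real \<Rightarrow> ('a::real_normed_vector \<Rightarrow> real) \<Rightarrow> bool" where
  "bounded_Lipschitz C f \<longleftrightarrow> (\<forall>x. \<bar>f x\<bar> \<le> C) \<and> (\<forall>x y. \<bar>f x - f y\<bar> \<le> C * norm (x - y))"

lemma bounded_Lipschitz_mono: "bounded_Lipschitz C f \<Longrightarrow> C \<le> C' \<Longrightarrow> bounded_Lipschitz C' f"
  unfolding bounded_Lipschitz_def by (meson mult_right_mono norm_ge_zero order_trans)

lemma bounded_Lipschitz_continuous:
  fixes f :: "'a::real_normed_vector \<Rightarrow> real"
  assumes "bounded_Lipschitz C f" shows "continuous_on UNIV f"
proof -
  have "0 \<le> C" using assms abs_ge_zero order_trans unfolding bounded_Lipschitz_def by blast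
  then show ?thesis
    using assms by (intro lipschitz_on_continuous_on[where L=C] lipschitz_onI)
      (auto simp: bounded_Lipschitz_def dist_norm dist_real_def)
qed

lemma bounded_Lipschitz_common_constant:
  assumes "finite I" "\<And>i. i \<in> I \<Longrightarrow> \<exists>C\<ge>0. bounded_Lipschitz C (f i)"
  shows "\<exists>C\<ge>0. \<forall>i\<in>I. bounded_Lipschitz C (f i)"
proof -
  obtain c where c: "\<And>i. i \<in> I \<Longrightarrow> 0 \<le> c i \<and> bounded_Lipschitz (c i) (f i)" using assms(2) by metis
  have "c i \<le> sum c I" if "i \<in> I" for i using assms(1) c that by (intro member_le_sum) auto
  then show ?thesis
    using c by (intro exI[of _ "sum c I"] conjI sum_nonneg ballI) (auto intro: bounded_Lipschitz_mono)
qed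

text \<open>One constant for the kernel and its first and second partial derivatives; the third derivatives enter
through the Lipschitz bounds of the second ones.\<close>

lemma kernel_constant:
  fixes \<eta> :: "'a::euclidean_space \<Rightarrow> real"
  assumes "C_k 3 \<eta>" "\<And>x. R < norm x \<Longrightarrow> \<eta> x = 0"
  shows "\<exists>C\<ge>0. bounded_Lipschitz C \<eta> \<and> (\<forall>b\<in>Basis. bounded_Lipschitz C (partial b \<eta>)) \<and>
    (\<forall>b\<in>Basis. \<forall>c\<in>Basis. bounded_Lipschitz C (partial c (partial b \<eta>)))"
proof -
  have C3: "C_k (Suc 2) \<eta>" using assms(1) by (simp add: numeral_3_eq_3 numeral_2_eq_2)
  then have C2: "C_k (Suc 1) (partial b \<eta>)" if "b \<in> Basis" for b using that by (simp add: numeral_2_eq_2)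
  then have C1: "C_k (Suc 0) (partial c (partial b \<eta>))" if "b \<in> Basis" "c \<in> Basis" for b c using that by simp
  have s1: "partial b \<eta> x = 0" if "R < norm x" for b x by (rule partial_outside_support[OF assms(2) that])
  have s2: "partial c (partial b \<eta>) x = 0" if "R < norm x" for b c x
    by (rule partial_outside_support[OF s1 that])
  obtain A where A: "0 \<le> A" "bounded_Lipschitz A \<eta>"
    using C1_compact_support_Lipschitz[OF C3 assms(2)] unfolding bounded_Lipschitz_def by blast
  have "\<exists>C\<ge>0. bounded_Lipschitz C (partial b \<eta>)" if "b \<in> Basis" for b
    using C1_compact_support_Lipschitz[OF C2[OF that] s1] unfolding bounded_Lipschitz_def by blast
  then obtain B where B: "0 \<le> B" "\<And>b. b \<in> Basis \<Longrightarrow> bounded_Lipschitz B (partial b \<eta>)"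
    using bounded_Lipschitz_common_constant[of "Basis :: 'a set" "\<lambda>b. partial b \<eta>"] by auto
  have "\<exists>C\<ge>0. bounded_Lipschitz C (partial c (partial b \<eta>))" if "b \<in> Basis" "c \<in> Basis" for b c
    using C1_compact_support_Lipschitz[OF C1[OF that] s2] unfolding bounded_Lipschitz_def by blast
  then have "\<exists>C\<ge>0. \<forall>p\<in>Basis \<times> Basis. bounded_Lipschitz C (partial (snd p) (partial (fst p) \<eta>))"
    by (intro bounded_Lipschitz_common_constant) auto
  then obtain D where D: "0 \<le> D" "\<And>b c. b \<in> Basis \<Longrightarrow> c \<in> Basis \<Longrightarrow> bounded_Lipschitz D (partial c (partial b \<eta>))"
    by force
  have le: "A \<le> A + B + D" "B \<le> A + B + D" "D \<le> A + B + D" using A B D by auto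
  show ?thesis
    using bounded_Lipschitz_mono[OF A(2) le(1)] bounded_Lipschitz_mono[OF B(2) le(2)]
      bounded_Lipschitz_mono[OF D(2) le(3)] A(1) B(1) D(1)
    by (intro exI[of _ "A + B + D"]) auto
qed

lemma norm_matrix_le:
  fixes A :: "real^'m^'n" and c :: real
  assumes "\<And>j i. \<bar>A $ j $ i\<bar> \<le> c"
  shows "norm A \<le> CARD('n) * (CARD('m) * c)"
proof -
  have "norm (A $ j) \<le> CARD('m) * c" for j
    using norm_le_l1_cart[of "A $ j"] sum_bounded_above[of UNIV "\<lambda>i. \<bar>A $ j $ i\<bar>" c] assms by auto
  then have "(\<Sum>j\<in>UNIV. norm (A $ j)) \<le> CARD('n) * (CARD('m) * c)"
    using sum_bounded_above[of UNIV "\<lambda>j. norm (A $ j)"] by auto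
  moreover have "norm A \<le> (\<Sum>j\<in>UNIV. norm (A $ j))" unfolding norm_vec_def[of A] by (rule L2_set_le_sum) simp
  ultimately show ?thesis by linarith
qed

definition L1_dist :: "(real \<Rightarrow> real^'n \<Rightarrow> real^'m) \<Rightarrow> real \<Rightarrow> real \<Rightarrow> real" where
  "L1_dist \<rho> s t = (LINT x|lebesgue. norm (\<rho> s x - \<rho> t x))"

context
  fixes \<rho> :: "real \<Rightarrow> real^'n \<Rightarrow> real^'m"
  assumes \<rho>: "continuous_into_L_one UNIV \<rho>"
begin

lemma rho_integrable: "integrable lebesgue (\<rho> t)"
  using \<rho> by (auto simp: continuous_into_L_one_def L_one_def)

lemma rho_component_integrable: "integrable lebesgue (\<lambda>x. \<rho> t x $ i)"
  using integrable_bounded_linear[OF bounded_linear_vec_nth rho_integrable] .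

lemma L1_dist_triangle: "L1_dist \<rho> s t \<le> L1_dist \<rho> s r + L1_dist \<rho> r t"
proof -
  have "L1_dist \<rho> s t \<le> (LINT x|lebesgue. norm (\<rho> s x - \<rho> r x) + norm (\<rho> r x - \<rho> t x))"
    unfolding L1_dist_def
  proof (rule integral_mono)
    show "norm (\<rho> s x - \<rho> t x) \<le> norm (\<rho> s x - \<rho> r x) + norm (\<rho> r x - \<rho> t x)" for x
      using norm_triangle_ineq[of "\<rho> s x - \<rho> r x" "\<rho> r x - \<rho> t x"] by simp
  qed (intro Bochner_Integration.integrable_add integrable_norm Bochner_Integration.integrable_diff rho_integrable)+
  then show ?thesis unfolding L1_dist_def
    by (subst (asm) Bochner_Integration.integral_add) (auto intro!: rho_integrable)
qed

lemma L1_dist_commute: "L1_dist \<rho> s t = L1_dist \<rho> t s"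
  by (simp add: L1_dist_def norm_minus_commute)

text \<open>Continuity in time at each point becomes uniform by a Lebesgue number of the cover of \<open>{0..T}\<close> by the
intervals of continuity.\<close>

lemma L1_dist_uniformly_small:
  assumes "0 < \<epsilon>"
  shows "\<exists>\<delta>>0. \<forall>s\<in>{0..T}. \<forall>t\<in>{0..T}. \<bar>s - t\<bar> < \<delta> \<longrightarrow> L1_dist \<rho> s t \<le> \<epsilon>"
proof -
  have "\<exists>\<delta>>0. \<forall>t. \<bar>t - s\<bar> < \<delta> \<longrightarrow> L1_dist \<rho> t s \<le> \<epsilon> / 2" for s
  proof -
    have "((\<lambda>t. L1_dist \<rho> t s) \<longlongrightarrow> 0) (at s)"
      using \<rho> by (simp add: continuous_into_L_one_def L1_dist_def)
    then have "eventually (\<lambda>t. dist (L1_dist \<rho> t s) 0 < \<epsilon> / 2) (at s)"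
      using assms by (intro tendstoD) auto
    then obtain \<delta> where "0 < \<delta>" "\<And>t. t \<noteq> s \<Longrightarrow> dist t s < \<delta> \<Longrightarrow> L1_dist \<rho> t s < \<epsilon> / 2"
      unfolding eventually_at by force
    moreover have "L1_dist \<rho> s s = 0" by (simp add: L1_dist_def)
    ultimately have "\<forall>t. \<bar>t - s\<bar> < \<delta> \<longrightarrow> L1_dist \<rho> t s \<le> \<epsilon> / 2"
      using assms by (metis dist_real_def less_eq_real_def half_gt_zero)
    with \<open>0 < \<delta>\<close> show ?thesis by blast
  qed
  then obtain \<delta> where \<delta>: "\<And>s. 0 < \<delta> s" "\<And>s t. \<bar>t - s\<bar> < \<delta> s \<Longrightarrow> L1_dist \<rho> t s \<le> \<epsilon> / 2" by metis
  obtain e where e: "0 < e" "\<And>x. x \<in> {0..T} \<Longrightarrow> \<exists>G\<in>(\<lambda>s. ball s (\<delta> s)) ` {0..T}. ball x e \<subseteq> G"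
    by (rule Heine_Borel_lemma[of "{0..T}" "(\<lambda>s. ball s (\<delta> s)) ` {0..T}"]) (use \<delta>(1) in auto)
  show ?thesis
  proof (intro exI[of _ e] conjI ballI impI e(1))
    fix s t assume st: "s \<in> {0..T}" "\<bar>s - t\<bar> < e"
    obtain r where r: "ball s e \<subseteq> ball r (\<delta> r)" using e(2)[OF st(1)] by auto
    have "s \<in> ball s e" "t \<in> ball s e" using st e(1) by (auto simp: dist_real_def)
    then have "s \<in> ball r (\<delta> r)" "t \<in> ball r (\<delta> r)" using r by blast+
    then have "\<bar>s - r\<bar> < \<delta> r" "\<bar>t - r\<bar> < \<delta> r" by (auto simp: dist_real_def)
    then have "L1_dist \<rho> s r \<le> \<epsilon> / 2" "L1_dist \<rho> t r \<le> \<epsilon> / 2" using \<delta>(2) by auto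
    then show "L1_dist \<rho> s t \<le> \<epsilon>" using L1_dist_triangle[of s t r] L1_dist_commute[of r t] by simp
  qed
qed

lemma component_L1_dist:
  "(LINT x|lebesgue. \<bar>\<rho> s x $ i - \<rho> t x $ i\<bar>) \<le> L1_dist \<rho> s t"
  unfolding L1_dist_def
proof (rule integral_mono)
  show "\<bar>\<rho> s x $ i - \<rho> t x $ i\<bar> \<le> norm (\<rho> s x - \<rho> t x)" for x
    using component_le_norm_cart[of "\<rho> s x - \<rho> t x" i] by simp
qed (auto intro!: rho_integrable rho_component_integrable)

lemma component_L1_bounded: "\<exists>M\<ge>0. \<forall>t\<in>{0..T}. \<forall>i. (LINT x|lebesgue. \<bar>\<rho> t x $ i\<bar>) \<le> M"
proof -
  let ?n = "\<lambda>t. LINT x|lebesgue. norm (\<rho> t x)"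
  have diff: "?n s - ?n t \<le> L1_dist \<rho> s t" for s t
  proof -
    have "?n s - ?n t = (LINT x|lebesgue. norm (\<rho> s x) - norm (\<rho> t x))"
      by (intro Bochner_Integration.integral_diff[symmetric]) (auto intro!: rho_integrable)
    also have "\<dots> \<le> L1_dist \<rho> s t" unfolding L1_dist_def
      by (intro integral_mono) (auto intro!: rho_integrable norm_triangle_ineq2)
    finally show ?thesis .
  qed
  have "continuous_on {0..T} ?n"
    unfolding continuous_on_iff
  proof (intro ballI allI impI)
    fix t e :: real assume t: "t \<in> {0..T}" and e: "0 < e"
    obtain \<delta> where \<delta>: "0 < \<delta>" "\<And>s t. s \<in> {0..T} \<Longrightarrow> t \<in> {0..T} \<Longrightarrow> \<bar>s - t\<bar> < \<delta> \<Longrightarrow> L1_dist \<rho> s t \<le> e / 2"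
      using L1_dist_uniformly_small[of "e / 2" T] e by force
    show "\<exists>\<delta>>0. \<forall>s\<in>{0..T}. dist s t < \<delta> \<longrightarrow> dist (?n s) (?n t) < e"
    proof (intro exI[of _ \<delta>] conjI ballI impI \<delta>(1))
      fix s assume s: "s \<in> {0..T}" "dist s t < \<delta>"
      then have "L1_dist \<rho> s t \<le> e / 2" using \<delta>(2)[OF s(1) t] by (simp add: dist_real_def)
      then show "dist (?n s) (?n t) < e"
        using diff[of s t] diff[of t s] L1_dist_commute[of t s] e by (simp add: dist_real_def)
    qed
  qed
  then have "bounded (?n ` {0..T})" by (intro compact_imp_bounded compact_continuous_image) auto
  then obtain M where M: "\<And>t. t \<in> {0..T} \<Longrightarrow> norm (?n t) \<le> M" unfolding bounded_iff by blast
  have "(LINT x|lebesgue. \<bar>\<rho> t x $ i\<bar>) \<le> max M 0" if "t \<in> {0..T}" for t i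
  proof -
    have "(LINT x|lebesgue. \<bar>\<rho> t x $ i\<bar>) \<le> ?n t"
      by (intro integral_mono) (auto intro!: rho_integrable rho_component_integrable component_le_norm_cart)
    then show ?thesis using M[OF that] by (simp add: le_max_iff_disj)
  qed
  then show ?thesis by (intro exI[of _ "max M 0"]) auto
qed

end

lemma convolution_has_derivative:
  fixes \<rho> g :: "real^'n \<Rightarrow> real"
  assumes \<rho>: "integrable lebesgue \<rho>" and g: "\<And>x. g differentiable (at x)" "bounded_Lipschitz C g"
    and pg: "\<And>b. b \<in> Basis \<Longrightarrow> bounded_Lipschitz C (partial b g)"
  shows "(convolution \<rho> g has_derivative (\<lambda>y. \<Sum>b\<in>Basis. (y \<bullet> b) * convolution \<rho> (partial b g) x)) (at x)"
proof (rule has_derivative_quadratic_remainder)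
  show "bounded_linear (\<lambda>y. \<Sum>b\<in>Basis. (y \<bullet> b) * convolution \<rho> (partial b g) x)"
    by (intro bounded_linear_sum bounded_linear_mult_const bounded_linear_inner_left)
  have C: "0 \<le> C" using g(2) abs_ge_zero order_trans unfolding bounded_Lipschitz_def by blast
  show "0 \<le> CARD('n) * C * (LINT \<xi>|lebesgue. \<bar>\<rho> \<xi>\<bar>)" using C by simp
  show "norm (convolution \<rho> g y - convolution \<rho> g x - (\<Sum>b\<in>Basis. ((y - x) \<bullet> b) * convolution \<rho> (partial b g) x))
      \<le> CARD('n) * C * (LINT \<xi>|lebesgue. \<bar>\<rho> \<xi>\<bar>) * (norm (y - x))\<^sup>2" for y
    using convolution_remainder[OF \<rho> g(1), of C y x] g(2) pg unfolding bounded_Lipschitz_def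
    by (simp add: mult_ac)
qed

lemma grad_convolution_entry:
  fixes \<eta> :: "real^'n \<Rightarrow> real" and u :: "real^'n \<Rightarrow> real^'m"
  assumes "integrable lebesgue (\<lambda>\<xi>. u \<xi> $ i)" "\<And>x. \<eta> differentiable (at x)" "bounded_Lipschitz C \<eta>"
    and "\<And>b. b \<in> Basis \<Longrightarrow> bounded_Lipschitz C (partial b \<eta>)"
  shows "grad_convolution u \<eta> x $ j $ i = convolution (\<lambda>\<xi>. u \<xi> $ i) (partial (axis j 1) \<eta>) x"
proof -
  have "partial (axis j 1) (convolution (\<lambda>\<xi>. u \<xi> $ i) \<eta>) x =
      (\<Sum>b\<in>Basis. (axis j 1 \<bullet> b) * convolution (\<lambda>\<xi>. u \<xi> $ i) (partial b \<eta>) x)"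
    by (rule partial_eq[OF convolution_has_derivative[OF assms]])
  also have "\<dots> = convolution (\<lambda>\<xi>. u \<xi> $ i) (partial (axis j 1) \<eta>) x"
    by (subst sum.remove[of _ "axis j 1"]) (auto simp: axis_in_Basis_iff inner_Basis intro!: sum.neutral split: if_splits)
  finally show ?thesis by (simp add: grad_convolution_def)
qed

section \<open>Regularity of the nonlocal velocity\<close>

text \<open>All entries of \<open>\<nabla>\<rho> * \<eta>\<close> and of its derivative are convolutions of a component of \<open>\<rho>\<close> with a partial
derivative of \<open>\<eta>\<close>. Such a convolution is bounded and Lipschitz in space by the corresponding property of
the kernel times the \<open>L\<^sup>1\<close> norm of \<open>\<rho>\<close>, and Lipschitz in \<open>\<rho>\<close> for the \<open>L\<^sup>1\<close> distance.\<close>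

theorem grad_convolution_regular:
  fixes \<rho> :: "real \<Rightarrow> real^'n \<Rightarrow> real^'m" and \<eta> :: "real^'n \<Rightarrow> real"
  assumes \<rho>: "continuous_into_L_one UNIV \<rho>" and T: "0 \<le> T"
    and \<eta>: "C_k 3 \<eta>" "\<And>x. R < norm x \<Longrightarrow> \<eta> x = 0"
  shows "\<exists>K Dw. regular_field (\<lambda>t. grad_convolution (\<rho> t) \<eta>) Dw (L1_dist \<rho>) T K"
proof -
  have "\<exists>C\<ge>0. bounded_Lipschitz C \<eta> \<and> (\<forall>b\<in>Basis. bounded_Lipschitz C (partial b \<eta>)) \<and>
    (\<forall>b\<in>Basis. \<forall>c\<in>Basis. bounded_Lipschitz C (partial c (partial b \<eta>)))"
    by (rule kernel_constant[where R=R]) (fact \<eta>)+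
  then obtain C where C': "0 \<le> C" "bounded_Lipschitz C \<eta>" "\<forall>b\<in>Basis. bounded_Lipschitz C (partial b \<eta>)"
    "\<forall>b\<in>Basis. \<forall>c\<in>Basis. bounded_Lipschitz C (partial c (partial b \<eta>))"
    by (elim exE conjE)
  note C = C'(1,2) C'(3)[rule_format] C'(4)[rule_format]
  obtain M where M': "0 \<le> M" "\<forall>t\<in>{0..T}. \<forall>i. (LINT x|lebesgue. \<bar>\<rho> t x $ i\<bar>) \<le> M"
    using component_L1_bounded[OF \<rho>, of T] by (elim exE conjE)
  note M = M'(1) M'(2)[rule_format]
  note int = rho_component_integrable[OF \<rho>]
  have d1: "\<eta> differentiable (at x)" for x using \<eta>(1) by (simp add: numeral_3_eq_3)
  have d2: "partial b \<eta> differentiable (at x)" if "b \<in> Basis" for b x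
    using \<eta>(1) that by (simp add: numeral_3_eq_3)
  define e where "e j = (axis j 1 :: real^'n)" for j
  have e: "e j \<in> Basis" for j by (simp add: e_def axis_in_Basis_iff)
  define \<kappa> where "\<kappa> t i g x = convolution (\<lambda>\<xi>. \<rho> t \<xi> $ i) g x" for t i and g :: "real^'n \<Rightarrow> real" and x
  let ?w = "\<lambda>t. grad_convolution (\<rho> t) \<eta>"
  define Dw where "Dw t x y = (\<chi> j i. \<Sum>b\<in>Basis. (y \<bullet> b) * \<kappa> t i (partial b (partial (e j) \<eta>)) x)" for t x y
  have w: "?w t x $ j $ i = \<kappa> t i (partial (e j) \<eta>) x" for t x j i
    unfolding \<kappa>_def e_def by (rule grad_convolution_entry[OF int d1 C(2,3)])
  have \<kappa>_bound: "\<bar>\<kappa> t i g x\<bar> \<le> C * M" if "t \<in> {0..T}" "bounded_Lipschitz C g" for t i g x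
  proof -
    have "\<bar>\<kappa> t i g x\<bar> \<le> C * (LINT \<xi>|lebesgue. \<bar>\<rho> t \<xi> $ i\<bar>)" unfolding \<kappa>_def
      by (rule convolution_bound[OF int bounded_Lipschitz_continuous[OF that(2)]])
        (use that(2) in \<open>simp add: bounded_Lipschitz_def\<close>)
    also have "\<dots> \<le> C * M" using M(2)[OF that(1)] C(1) by (intro mult_left_mono)
    finally show ?thesis .
  qed
  have \<kappa>_close: "\<bar>\<kappa> s i g x - \<kappa> t i g x\<bar> \<le> C * L1_dist \<rho> s t" if "bounded_Lipschitz C g" for s t i g x
  proof -
    have gb: "\<bar>g x\<bar> \<le> C" for x using that by (simp add: bounded_Lipschitz_def)
    note gc = bounded_Lipschitz_continuous[OF that]
    have "\<kappa> s i g x - \<kappa> t i g x = convolution (\<lambda>\<xi>. \<rho> s \<xi> $ i - \<rho> t \<xi> $ i) g x"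
      unfolding \<kappa>_def by (rule convolution_diff_density[OF int int gc gb])
    also have "\<bar>\<dots>\<bar> \<le> C * (LINT \<xi>|lebesgue. \<bar>\<rho> s \<xi> $ i - \<rho> t \<xi> $ i\<bar>)"
      by (rule convolution_bound[OF _ gc gb]) (intro Bochner_Integration.integrable_diff int)
    also have "\<dots> \<le> C * L1_dist \<rho> s t"
      using C(1) component_L1_dist[OF \<rho>] by (intro mult_left_mono)
    finally show ?thesis .
  qed
  have \<kappa>_Lip: "\<bar>\<kappa> t i g x - \<kappa> t i g y\<bar> \<le> C * M * norm (x - y)" if "t \<in> {0..T}" "bounded_Lipschitz C g" for t i g x y
  proof -
    have "\<bar>\<kappa> t i g x - \<kappa> t i g y\<bar> \<le> C * norm (x - y) * (LINT \<xi>|lebesgue. \<bar>\<rho> t \<xi> $ i\<bar>)" unfolding \<kappa>_def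
      by (rule convolution_Lipschitz[OF int bounded_Lipschitz_continuous[OF that(2)]])
        (use that(2) in \<open>auto simp: bounded_Lipschitz_def\<close>)
    also have "\<dots> \<le> C * norm (x - y) * M" using M(2)[OF that(1)] C(1) by (intro mult_left_mono) auto
    finally show ?thesis by (simp add: mult_ac)
  qed
  have L0: "0 \<le> L1_dist \<rho> s t" for s t by (simp add: L1_dist_def)
  define m where "m = real CARD('n) * real CARD('m)"
  define n where "n = real CARD('n)"
  have m0: "0 \<le> m" and n1: "1 \<le> n" by (auto simp: m_def n_def)
  have mat: "norm A \<le> m * c" if "\<And>j i. \<bar>A $ j $ i\<bar> \<le> c" for A :: "real^'m^'n" and c
    using norm_matrix_le[of A c] that by (simp add: m_def mult.assoc)
  have sumb: "\<bar>\<Sum>b\<in>Basis. ((y::real^'n) \<bullet> b) * D b\<bar> \<le> n * c * norm y" if "\<And>b. b \<in> Basis \<Longrightarrow> \<bar>D b\<bar> \<le> c" for y D c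
    using sum_inner_scaleR_bound[of D c y] that by (simp add: n_def)
  have der: "(?w t has_derivative Dw t x) (at x)" if t: "t \<in> {0..T}" for t x
  proof (rule has_derivative_quadratic_remainder)
    have "linear (Dw t x)"
      by (rule linearI) (simp_all add: Dw_def vec_eq_iff inner_add_left distrib_right sum.distrib sum_distrib_left mult.assoc)
    then show "bounded_linear (Dw t x)" by (simp add: linear_conv_bounded_linear)
    show "0 \<le> m * (n * C * M)" using m0 n1 C M by simp
    fix y
    have "norm (?w t y - ?w t x - Dw t x (y - x)) \<le> m * (n * C * (norm (y - x))\<^sup>2 * M)"
    proof (rule mat)
      fix j i
      have "\<bar>\<kappa> t i (partial (e j) \<eta>) y - \<kappa> t i (partial (e j) \<eta>) x
          - (\<Sum>b\<in>Basis. ((y - x) \<bullet> b) * \<kappa> t i (partial b (partial (e j) \<eta>)) x)\<bar>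
        \<le> n * C * (norm (y - x))\<^sup>2 * (LINT \<xi>|lebesgue. \<bar>\<rho> t \<xi> $ i\<bar>)"
        unfolding \<kappa>_def n_def
        by (rule convolution_remainder[OF int d2[OF e]])
          (use C(3)[OF e] C(4)[OF e] in \<open>auto simp: bounded_Lipschitz_def\<close>)
      also have "\<dots> \<le> n * C * (norm (y - x))\<^sup>2 * M"
        using M(2)[OF t] C(1) n1 by (intro mult_left_mono) auto
      finally show "\<bar>(?w t y - ?w t x - Dw t x (y - x)) $ j $ i\<bar> \<le> n * C * (norm (y - x))\<^sup>2 * M"
        by (simp add: w Dw_def)
    qed
    then show "norm (?w t y - ?w t x - Dw t x (y - x)) \<le> m * (n * C * M) * (norm (y - x))\<^sup>2"
      by (simp add: mult_ac)
  qed
  define K where "K = m * (n * (C * (M + 1)))"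
  have K0: "0 \<le> K" using m0 n1 C(1) M(1) by (simp add: K_def)
  have "C * M \<le> C * (M + 1)" "C * 1 \<le> C * (M + 1)"
    using C(1) M(1) by (intro mult_left_mono; simp)+
  moreover have "1 * (C * (M + 1)) \<le> n * (C * (M + 1))" using n1 C(1) M(1) by (intro mult_right_mono) auto
  ultimately have CM: "C * M \<le> n * (C * (M + 1))" "C \<le> n * (C * (M + 1))" by linarith+
  have "regular_field ?w Dw (L1_dist \<rho>) T K"
  proof
    show "0 \<le> T" "0 \<le> K" by fact+
    show "0 \<le> L1_dist \<rho> s t" for s t by (rule L0)
    show "\<exists>\<delta>>0. \<forall>s\<in>{0..T}. \<forall>t\<in>{0..T}. \<bar>s - t\<bar> < \<delta> \<longrightarrow> L1_dist \<rho> s t \<le> \<epsilon>" if "0 < \<epsilon>" for \<epsilon>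
      by (rule L1_dist_uniformly_small[OF \<rho> that])
    show "(?w t has_derivative Dw t x) (at x)" if "t \<in> {0..T}" for t x by (rule der[OF that])
    show "norm (?w t x) \<le> K" if t: "t \<in> {0..T}" for t x
      unfolding K_def
    proof (rule mat)
      fix j i
      show "\<bar>?w t x $ j $ i\<bar> \<le> n * (C * (M + 1))"
        using \<kappa>_bound[OF t C(3)[OF e], where i=i] CM(1) unfolding w by (rule order_trans)
    qed
    show "norm (Dw t x z) \<le> K * norm z" if t: "t \<in> {0..T}" for t x z
      unfolding K_def mult.assoc
    proof (rule mat)
      fix j i
      have "\<bar>Dw t x z $ j $ i\<bar> \<le> n * (C * M) * norm z"
        using sumb[of "\<lambda>b. \<kappa> t i (partial b (partial (e j) \<eta>)) x" "C * M" z] \<kappa>_bound[OF t C(4)[OF e]]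
        by (simp add: Dw_def)
      also have "\<dots> \<le> n * (C * (M + 1)) * norm z"
        using n1 C(1) by (intro mult_right_mono mult_left_mono) auto
      finally show "\<bar>Dw t x z $ j $ i\<bar> \<le> n * (C * ((M + 1) * norm z))" by (simp add: mult.assoc)
    qed
    show "norm (?w s x - ?w t x) \<le> K * L1_dist \<rho> s t" for s t x
      unfolding K_def mult.assoc
    proof (rule mat)
      fix j i
      have "\<bar>(?w s x - ?w t x) $ j $ i\<bar> \<le> C * L1_dist \<rho> s t"
        using \<kappa>_close[OF C(3)[OF e]] by (simp add: w)
      also have "\<dots> \<le> n * (C * (M + 1)) * L1_dist \<rho> s t" using CM(2) L0 by (intro mult_right_mono)
      finally show "\<bar>(?w s x - ?w t x) $ j $ i\<bar> \<le> n * (C * ((M + 1) * L1_dist \<rho> s t))" by (simp add: mult.assoc)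
    qed
    show "norm (Dw s x z - Dw t y z) \<le> K * (L1_dist \<rho> s t + norm (x - y)) * norm z"
      if t: "s \<in> {0..T}" "t \<in> {0..T}" for s t x y z
      unfolding K_def mult.assoc
    proof (rule mat)
      fix j i
      let ?k = "\<lambda>t b x. \<kappa> t i (partial b (partial (e j) \<eta>)) x"
      have "\<bar>\<Sum>b\<in>Basis. (z \<bullet> b) * (?k s b x - ?k t b y)\<bar> \<le> n * (C * (M + 1) * (L1_dist \<rho> s t + norm (x - y))) * norm z"
      proof (rule sumb)
        fix b :: "real^'n" assume b: "b \<in> Basis"
        have "\<bar>?k s b x - ?k t b y\<bar> \<le> \<bar>?k s b x - ?k t b x\<bar> + \<bar>?k t b x - ?k t b y\<bar>" by linarith
        also have "\<dots> \<le> C * L1_dist \<rho> s t + C * M * norm (x - y)"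
          by (intro add_mono \<kappa>_close \<kappa>_Lip t C(4) e b)
        also have "\<dots> \<le> C * (M + 1) * L1_dist \<rho> s t + C * (M + 1) * norm (x - y)"
          using C(1) M(1) L0[of s t] by (intro add_mono mult_right_mono) (auto simp: algebra_simps)
        finally show "\<bar>?k s b x - ?k t b y\<bar> \<le> C * (M + 1) * (L1_dist \<rho> s t + norm (x - y))"
          by (simp add: algebra_simps)
      qed
      then show "\<bar>(Dw s x z - Dw t y z) $ j $ i\<bar> \<le> n * (C * ((M + 1) * ((L1_dist \<rho> s t + norm (x - y)) * norm z)))"
        by (simp add: Dw_def right_diff_distrib sum_subtractf mult.assoc)
    qed
  qed
  then show ?thesis by blast
qed

lemma regular_field_linear:
  assumes "regular_field u Du d T K" and P: "bounded_linear P" "\<And>z. norm (P z) \<le> norm z"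
  shows "regular_field (\<lambda>t x. P (u t x)) (\<lambda>t x z. P (Du t x z)) d T K"
proof -
  interpret regular_field u Du d T K by fact
  have diff: "P a - P b = P (a - b)" for a b using linear_diff[OF bounded_linear.linear[OF P(1)]] by simp
  show ?thesis
    by (unfold_locales, unfold diff)
      (assumption | rule T K d_nonneg d_small bounded_linear.has_derivative[OF P(1)] der order_trans[OF P(2)]
        u_bound Du_bound u_close Du_close)+
qed

text \<open>The field takes its values in the closed ball of radius \<open>K\<close>. On this ball \<open>V\<close> and its first partial
derivatives are bounded and Lipschitz, which is all that the chain rule requires.\<close>

lemma regular_field_compose:
  fixes V :: "'b::euclidean_space \<Rightarrow> 'c::euclidean_space"
  assumes "regular_field w Dw d T K" and V: "C_k 2 V"
  shows "\<exists>K' Du. regular_field (\<lambda>t x. V (w t x)) Du d T K'"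
proof -
  interpret regular_field w Dw d T K by fact
  let ?N = "real DIM('b)"
  have dV: "V differentiable (at x)" and d2V: "b \<in> Basis \<Longrightarrow> C_k 1 (partial b V)" for x b
    using V by (auto simp: numeral_2_eq_2)
  have cV: "continuous_on UNIV (partial b V)" if "b \<in> Basis" for b using C_k_continuous[OF d2V[OF that]] .
  obtain B1 where B1: "0 \<le> B1" "\<And>z. z \<in> cball 0 K \<Longrightarrow> norm (V z) \<le> B1"
    using continuous_bounded_finite_family[of "{()}" "cball 0 K" "\<lambda>_. V"] C_k_continuous[OF V]
    by (metis compact_cball continuous_on_subset finite.intros insertI1 subset_UNIV)
  obtain B2 where B2: "0 \<le> B2" "\<And>b z. b \<in> Basis \<Longrightarrow> z \<in> cball 0 K \<Longrightarrow> norm (partial b V z) \<le> B2"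
    using continuous_bounded_finite_family[of Basis "cball 0 K" "\<lambda>b. partial b V"] cV
    by (meson compact_cball continuous_on_subset finite_Basis subset_UNIV)
  obtain B3 where B3: "0 \<le> B3" "\<And>y z. y \<in> cball 0 K \<Longrightarrow> z \<in> cball 0 K \<Longrightarrow> norm (V y - V z) \<le> B3 * norm (y - z)"
    using C1_Lipschitz_on_ball[OF dV cV] by blast
  have "\<exists>C\<ge>0. \<forall>y\<in>cball 0 K. \<forall>z\<in>cball 0 K. norm (partial b V y - partial b V z) \<le> C * norm (y - z)"
    if "b \<in> Basis" for b
    by (rule C1_Lipschitz_on_ball) (use d2V[OF that] in auto)
  then obtain c where c: "\<And>b. b \<in> Basis \<Longrightarrow> 0 \<le> c b"
    "\<And>b y z. b \<in> Basis \<Longrightarrow> y \<in> cball 0 K \<Longrightarrow> z \<in> cball 0 K \<Longrightarrow> norm (partial b V y - partial b V z) \<le> c b * norm (y - z)"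
    by metis
  define B4 where "B4 = sum c Basis"
  have B40: "0 \<le> B4" unfolding B4_def by (rule sum_nonneg) (use c in auto)
  have B4: "norm (partial b V y - partial b V z) \<le> B4 * norm (y - z)"
    if "b \<in> Basis" "y \<in> cball 0 K" "z \<in> cball 0 K" for b y z
  proof -
    have "c b \<le> B4" unfolding B4_def using that c by (intro member_le_sum) auto
    then show ?thesis using c(2)[OF that] mult_right_mono[of "c b" B4 "norm (y - z)"] by force
  qed
  have wK: "w t x \<in> cball 0 K" if "t \<in> {0..T}" for t x using u_bound[OF that] by simp
  define Du where "Du t x z = (\<Sum>b\<in>Basis. (Dw t x z \<bullet> b) *\<^sub>R partial b V (w t x))" for t x z
  define K' where "K' = B1 + ?N * B2 * K + B3 * K + ?N * (B4 * K) * K"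
  have K'0: "0 \<le> K'" "B1 \<le> K'" "?N * B2 * K \<le> K'" "B3 * K \<le> K'" "?N * B2 * K + ?N * (B4 * K) * K \<le> K'"
    using B1(1) B2(1) B3(1) B40 K by (auto simp: K'_def)
  have "regular_field (\<lambda>t x. V (w t x)) Du d T K'"
  proof
    show "0 \<le> T" "0 \<le> K'" "0 \<le> d s t" for s t using T K'0 d_nonneg by auto
    show "\<exists>\<delta>>0. \<forall>s\<in>{0..T}. \<forall>t\<in>{0..T}. \<bar>s - t\<bar> < \<delta> \<longrightarrow> d s t \<le> \<epsilon>" if "0 < \<epsilon>" for \<epsilon>
      by (rule d_small[OF that])
    fix t x assume t: "t \<in> {0..T}"
    show "((\<lambda>x. V (w t x)) has_derivative Du t x) (at x)"
      using diff_chain_at[OF der[OF t] has_derivative_partials[OF dV]] by (simp add: o_def Du_def [abs_def])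
    show "norm (V (w t x)) \<le> K'" using B1(2)[OF wK[OF t]] K'0 by (meson order_trans)
    fix z
    have "norm (Du t x z) \<le> ?N * B2 * norm (Dw t x z)"
      unfolding Du_def by (rule sum_inner_scaleR_bound) (use B2(2) wK[OF t] in auto)
    also have "\<dots> \<le> ?N * B2 * (K * norm z)" using Du_bound[OF t] B2(1) by (intro mult_left_mono) auto
    also have "\<dots> \<le> K' * norm z" using mult_right_mono[OF K'0(3), of "norm z"] by (simp add: mult.assoc)
    finally show "norm (Du t x z) \<le> K' * norm z" .
  next
    fix s t x assume st: "s \<in> {0..T}" "t \<in> {0..T}"
    have "norm (V (w s x) - V (w t x)) \<le> B3 * norm (w s x - w t x)"
      by (rule B3(2)) (use wK st in auto)
    also have "\<dots> \<le> B3 * (K * d s t)" using B3(1) u_close[OF st] by (intro mult_left_mono)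
    also have "\<dots> \<le> K' * d s t" using mult_right_mono[OF K'0(4) d_nonneg[of s t]] by (simp add: mult.assoc)
    finally show "norm (V (w s x) - V (w t x)) \<le> K' * d s t" .
    fix y z
    let ?e = "d s t + norm (x - y)"
    have e0: "0 \<le> ?e" using d_nonneg[of s t] by simp
    have ww: "norm (w s x - w t y) \<le> K * ?e"
    proof -
      have "norm (w s x - w t y) \<le> norm (w s x - w t x) + norm (w t x - w t y)"
        using norm_triangle_ineq[of "w s x - w t x" "w t x - w t y"] by simp
      also have "\<dots> \<le> K * d s t + K * norm (x - y)"
        by (intro add_mono u_close u_Lipschitz st)
      finally show ?thesis by (simp add: distrib_left)
    qed
    have split: "Du s x z - Du t y z = (\<Sum>b\<in>Basis. ((Dw s x z - Dw t y z) \<bullet> b) *\<^sub>R partial b V (w s x)) +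
        (\<Sum>b\<in>Basis. (Dw t y z \<bullet> b) *\<^sub>R (partial b V (w s x) - partial b V (w t y)))"
      by (simp add: Du_def inner_diff_left scaleR_diff_left scaleR_diff_right sum_subtractf)
    have "norm (\<Sum>b\<in>Basis. ((Dw s x z - Dw t y z) \<bullet> b) *\<^sub>R partial b V (w s x)) \<le> ?N * B2 * norm (Dw s x z - Dw t y z)"
      by (rule sum_inner_scaleR_bound) (use B2(2) wK st in auto)
    also have "\<dots> \<le> ?N * B2 * (K * ?e * norm z)" using Du_close[OF st] B2(1) by (intro mult_left_mono) auto
    finally have 1: "norm (\<Sum>b\<in>Basis. ((Dw s x z - Dw t y z) \<bullet> b) *\<^sub>R partial b V (w s x)) \<le> ?N * B2 * (K * ?e * norm z)" .
    have "norm (\<Sum>b\<in>Basis. (Dw t y z \<bullet> b) *\<^sub>R (partial b V (w s x) - partial b V (w t y))) \<le> ?N * (B4 * (K * ?e)) * norm (Dw t y z)"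
    proof (rule sum_inner_scaleR_bound)
      fix b :: 'b assume b: "b \<in> Basis"
      have "norm (partial b V (w s x) - partial b V (w t y)) \<le> B4 * norm (w s x - w t y)"
        by (rule B4[OF b]) (use wK st in auto)
      also have "\<dots> \<le> B4 * (K * ?e)" using ww B40 by (intro mult_left_mono)
      finally show "norm (partial b V (w s x) - partial b V (w t y)) \<le> B4 * (K * ?e)" .
    qed
    also have "\<dots> \<le> ?N * (B4 * (K * ?e)) * (K * norm z)"
      using Du_bound[OF st(2)] B40 K e0 by (intro mult_left_mono) auto
    finally have "norm (Du s x z - Du t y z) \<le> ?N * B2 * (K * ?e * norm z) + ?N * (B4 * (K * ?e)) * (K * norm z)"
      unfolding split using 1 by (intro norm_triangle_le add_mono)
    also have "\<dots> = (?N * B2 * K + ?N * (B4 * K) * K) * (?e * norm z)" by (simp add: algebra_simps)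
    also have "\<dots> \<le> K' * (?e * norm z)" using K'0(5) e0 by (intro mult_right_mono) auto
    finally show "norm (Du s x z - Du t y z) \<le> K' * ?e * norm z" by (simp add: mult.assoc)
  qed
  then show ?thesis by blast
qed

section \<open>Supports\<close>

text \<open>By the Lindelof property, countably many null open sets already cover the complement of the support.\<close>

lemma spt_AE_zero: "AE y in lebesgue. y \<notin> spt f \<longrightarrow> f y = 0"
proof -
  let ?F = "{U. open U \<and> (AE x in lebesgue. x \<in> U \<longrightarrow> f x = 0)}"
  obtain F where F: "F \<subseteq> ?F" "countable F" "\<Union>F = \<Union>?F"
    using Lindelof[of ?F] by blast
  have "AE x in lebesgue. \<forall>U\<in>F. x \<in> U \<longrightarrow> f x = 0"
    by (subst AE_ball_countable[OF F(2)]) (use F(1) in auto)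
  then show ?thesis
  proof eventually_elim
    case (elim x)
    then have "x \<in> \<Union>F \<longrightarrow> f x = 0" by blast
    then show ?case unfolding F(3) spt_def by blast
  qed
qed

lemma spt_subset_closed: "closed S \<Longrightarrow> (AE y in lebesgue. y \<notin> S \<longrightarrow> f y = 0) \<Longrightarrow> spt f \<subseteq> S"
  unfolding spt_def by (auto intro!: exI[of _ "- S"])

lemma closed_spt: "closed (spt f)"
  unfolding spt_def by (intro closed_Compl open_Union) auto

lemma continuous_zero_outside_spt:
  fixes f :: "'a::euclidean_space \<Rightarrow> real"
  assumes f: "continuous_on UNIV f" and s: "s \<notin> spt f"
  shows "f s = 0"
proof (rule ccontr)
  assume "f s \<noteq> 0"
  obtain U where U: "open U" "s \<in> U" "AE x in lebesgue. x \<in> U \<longrightarrow> f x = 0" using s unfolding spt_def by blast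
  let ?W = "U \<inter> {x. f x \<noteq> 0}"
  have "open ?W" using f U(1) by (intro open_Int open_Collect_neq continuous_intros)
  moreover have "?W \<noteq> {}" using U(2) \<open>f s \<noteq> 0\<close> by blast
  moreover have "negligible ?W"
  proof -
    have "{x \<in> space lebesgue. \<not> (x \<in> U \<longrightarrow> f x = 0)} \<in> null_sets lebesgue"
      using U(3) unfolding completion.AE_iff_null_sets .
    moreover have "{x \<in> space lebesgue. \<not> (x \<in> U \<longrightarrow> f x = 0)} = ?W" by auto
    ultimately show ?thesis by (simp add: negligible_iff_null_sets)
  qed
  ultimately show False using open_not_negligible by blast
qed

text \<open>The unions of the open balls with radii \<open>r h - \<epsilon>\<close>, for \<open>\<epsilon> > 0\<close>, form an open cover that increases as \<open>\<epsilon>\<close>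
decreases.\<close>

lemma compact_subset_shrunk_balls:
  fixes x :: "'i \<Rightarrow> 'a::metric_space"
  assumes S: "compact S" "S \<subseteq> (\<Union>h\<in>H. ball (x h) (r h))"
  shows "\<exists>\<epsilon>>0. S \<subseteq> (\<Union>h\<in>H. cball (x h) (r h - \<epsilon>))"
proof -
  have "S \<subseteq> (\<Union>\<epsilon>\<in>{0::real<..}. \<Union>h\<in>H. ball (x h) (r h - \<epsilon>))"
  proof
    fix y assume "y \<in> S"
    then obtain h where h: "h \<in> H" "dist (x h) y < r h" using S(2) by auto
    then have "y \<in> ball (x h) (r h - (r h - dist (x h) y) / 2)" by (simp add: field_simps)
    moreover have "(r h - dist (x h) y) / 2 \<in> {0<..}" using h by simp
    ultimately show "y \<in> (\<Union>\<epsilon>\<in>{0::real<..}. \<Union>h\<in>H. ball (x h) (r h - \<epsilon>))" using h(1) by blast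
  qed
  then obtain C where C: "C \<subseteq> {0::real<..}" "finite C" "S \<subseteq> (\<Union>\<epsilon>\<in>C. \<Union>h\<in>H. ball (x h) (r h - \<epsilon>))"
    by (rule compactE_image[OF S(1), rotated]) auto
  define \<epsilon> where "\<epsilon> = Min (insert 1 C)"
  have "0 < \<epsilon>" unfolding \<epsilon>_def using C by (subst Min_gr_iff) auto
  moreover have "S \<subseteq> (\<Union>h\<in>H. cball (x h) (r h - \<epsilon>))"
  proof
    fix y assume "y \<in> S"
    then obtain c h where ch: "c \<in> C" "h \<in> H" "dist (x h) y < r h - c" using C(3) by auto
    moreover have "\<epsilon> \<le> c" unfolding \<epsilon>_def using ch(1) C(2) by (intro Min_le) auto
    ultimately show "y \<in> (\<Union>h\<in>H. cball (x h) (r h - \<epsilon>))" by force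
  qed
  ultimately show ?thesis by blast
qed

section \<open>Attraction towards the mass\<close>

lemma sum_Basis_axis:
  fixes f :: "real^'n \<Rightarrow> 'b::comm_monoid_add"
  shows "(\<Sum>b\<in>Basis. f b) = (\<Sum>j\<in>UNIV. f (axis j 1))"
proof -
  have B: "(Basis :: (real^'n) set) = range (\<lambda>j. axis j 1)" by (auto simp: Basis_vec_def)
  have inj: "inj (\<lambda>j::'n. axis j (1::real))" by (auto simp: inj_on_def axis_eq_axis)
  show ?thesis unfolding B sum.reindex[OF inj] by simp
qed

text \<open>The gradient of \<open>\<eta>\<close> at \<open>z\<close> is \<open>- \<kappa> z * z\<close> with \<open>\<kappa> z = - \<eta>t' (norm z) / norm z\<close>. It vanishes at the origin
because \<open>\<eta>\<close> is even, so the Lipschitz bound of the gradient bounds \<open>\<kappa>\<close>.\<close>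

lemma radial_kernel_gradient:
  fixes \<eta> :: "'a::euclidean_space \<Rightarrow> real" and \<eta>t :: "real \<Rightarrow> real" and C l :: real
  assumes \<eta>: "\<And>y. \<eta> y = \<eta>t (norm y)" "\<And>s. \<eta>t (- s) = \<eta>t s" "\<And>s. 0 \<le> s \<Longrightarrow> deriv \<eta>t s \<le> 0"
    and diff: "\<And>x. \<eta> differentiable (at x)"
    and Lip: "\<And>b. b \<in> Basis \<Longrightarrow> bounded_Lipschitz C (partial b \<eta>)"
    and supp: "\<And>x. l < norm x \<Longrightarrow> \<eta> x = 0" and l: "0 < l"
  shows "\<exists>\<kappa>::'a \<Rightarrow> real. (\<forall>z. 0 \<le> \<kappa> z \<and> \<kappa> z \<le> DIM('a) * C \<and> (l < norm z \<longrightarrow> \<kappa> z = 0)) \<and>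
    (\<forall>z y. (\<Sum>b\<in>Basis. (y \<bullet> b) * partial b \<eta> z) = - \<kappa> z * (z \<bullet> y))"
proof -
  obtain e :: 'a where e: "e \<in> Basis" using nonempty_Basis by blast
  have \<eta>t: "\<eta>t s = \<eta> (s *\<^sub>R e)" for s
    using \<eta>(1)[of "s *\<^sub>R e"] \<eta>(2)[of s] e by (cases "0 \<le> s") auto
  have C0: "0 \<le> C" using Lip[OF e] abs_ge_zero order_trans unfolding bounded_Lipschitz_def by blast
  define g where "g z y = (\<Sum>b\<in>Basis. (y \<bullet> b) * partial b \<eta> z)" for z y
  have der: "(\<eta> has_derivative g z) (at z)" for z
    using has_derivative_partials[OF diff] by (simp add: g_def [abs_def])
  have glin: "linear (g z)" for z using der has_derivative_linear by blast
  have \<eta>t_der: "(\<eta>t has_real_derivative deriv \<eta>t s) (at s)" for s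
  proof -
    have "((\<lambda>s. s *\<^sub>R e) has_derivative (\<lambda>s. s *\<^sub>R e)) (at s)" by (intro derivative_eq_intros) auto
    from diff_chain_at[OF this der] have "(\<eta>t has_derivative (\<lambda>h. g (s *\<^sub>R e) (h *\<^sub>R e))) (at s)"
      by (simp add: o_def \<eta>t [abs_def])
    moreover have "(\<lambda>h. g (s *\<^sub>R e) (h *\<^sub>R e)) = (*) (g (s *\<^sub>R e) e)"
      by (auto simp: linear_cmul[OF glin] mult.commute)
    ultimately have "(\<eta>t has_real_derivative g (s *\<^sub>R e) e) (at s)" by (simp add: has_field_derivative_def)
    then show ?thesis using DERIV_imp_deriv by metis
  qed
  define \<kappa> where "\<kappa> z = - deriv \<eta>t (norm z) / norm z" for z :: 'a
  have g0: "g 0 y = 0" for y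
  proof -
    have "((\<lambda>z. - z) has_derivative (\<lambda>z::'a. - z)) (at 0)" by (intro derivative_eq_intros) auto
    from diff_chain_at[OF this, of \<eta> "g 0"] der[of 0]
    have "(\<eta> \<circ> uminus has_derivative (\<lambda>y. g 0 (- y))) (at 0)" by (simp add: o_def)
    moreover have "\<eta> \<circ> uminus = \<eta>" by (auto simp: \<eta>(1))
    ultimately have "(\<eta> has_derivative (\<lambda>y. g 0 (- y))) (at 0)" by simp
    then have "g 0 = (\<lambda>y. g 0 (- y))" using der has_derivative_unique by blast
    then have "g 0 y = g 0 (- y)" by metis
    then show ?thesis by (simp add: linear_neg[OF glin])
  qed
  have grad: "g z y = - \<kappa> z * (z \<bullet> y)" for z y
  proof (cases "z = 0")
    case True
    then show ?thesis by (simp add: g0)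
  next
    case False
    have "(norm has_derivative (\<lambda>y. y \<bullet> sgn z)) (at z)" using has_derivative_norm[OF False] .
    from diff_chain_at[OF this, of \<eta>t "(*) (deriv \<eta>t (norm z))"] \<eta>t_der[of "norm z"]
    have "(\<eta> has_derivative (\<lambda>y. deriv \<eta>t (norm z) * (y \<bullet> sgn z))) (at z)"
      by (simp add: o_def \<eta>(1) [abs_def] has_field_derivative_def)
    then have "g z = (\<lambda>y. deriv \<eta>t (norm z) * (y \<bullet> sgn z))" using der has_derivative_unique by blast
    then show ?thesis by (simp add: \<kappa>_def sgn_div_norm inner_commute divide_inverse)
  qed
  have \<kappa>0: "0 \<le> \<kappa> z" for z using \<eta>(3)[of "norm z"] by (simp add: \<kappa>_def divide_nonpos_nonneg)
  have \<kappa>C: "\<kappa> z \<le> DIM('a) * C" for z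
  proof (cases "z = 0")
    case True
    then show ?thesis using C0 by (simp add: \<kappa>_def)
  next
    case False
    have "\<bar>partial b \<eta> z\<bar> \<le> C * norm z" if b: "b \<in> Basis" for b
    proof -
      have "partial b \<eta> 0 = 0" using partial_eq[OF der] g0 by metis
      then show ?thesis using Lip[OF b] unfolding bounded_Lipschitz_def by (metis diff_zero)
    qed
    then have "norm (\<Sum>b\<in>Basis. (z \<bullet> b) *\<^sub>R partial b \<eta> z) \<le> DIM('a) * (C * norm z) * norm z"
      by (intro sum_inner_scaleR_bound) auto
    then have "\<bar>g z z\<bar> \<le> DIM('a) * C * (norm z)\<^sup>2" by (simp add: g_def power2_eq_square mult_ac)
    then have "\<kappa> z * (norm z)\<^sup>2 \<le> DIM('a) * C * (norm z)\<^sup>2"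
      using \<kappa>0[of z] by (simp add: grad power2_norm_eq_inner abs_mult)
    then show ?thesis using False by simp
  qed
  have \<kappa>l: "\<kappa> z = 0" if "l < norm z" for z
  proof -
    have "g z z = 0" using partial_outside_support[OF supp that] by (simp add: g_def)
    then show ?thesis using that l by (auto simp: grad)
  qed
  show ?thesis using \<kappa>0 \<kappa>C \<kappa>l grad unfolding g_def by blast
qed

text \<open>Each point \<open>\<xi>\<close> of the mass contributes \<open>- \<kappa> (x - \<xi>) (x - \<xi>) \<bullet> (x - c)\<close>. If \<open>\<xi>\<close> were not farther from \<open>c\<close>
than \<open>x\<close>, this would be nonpositive; in general it exceeds zero by at most \<open>\<kappa>\<close> times half the difference of
the squared distances.\<close>

lemma inward_drift:
  fixes u :: "real^'n \<Rightarrow> real^'m" and \<eta> \<kappa> :: "real^'n \<Rightarrow> real" and B l m :: real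
  assumes u: "integrable lebesgue (\<lambda>\<xi>. u \<xi> $ i)" "AE \<xi> in lebesgue. 0 \<le> u \<xi> $ i"
    and \<eta>: "\<And>x. \<eta> differentiable (at x)" "bounded_Lipschitz C \<eta>"
      "\<And>b. b \<in> Basis \<Longrightarrow> bounded_Lipschitz C (partial b \<eta>)"
    and \<kappa>: "\<And>z. 0 \<le> \<kappa> z" "\<And>z. \<kappa> z \<le> B" "\<And>z. l < norm z \<Longrightarrow> \<kappa> z = 0"
      "\<And>z y. (\<Sum>b\<in>Basis. (y \<bullet> b) * partial b \<eta> z) = - \<kappa> z * (z \<bullet> y)"
    and near: "AE \<xi> in lebesgue. u \<xi> $ i \<noteq> 0 \<longrightarrow> l < norm (x - \<xi>) \<or> (norm (\<xi> - c))\<^sup>2 \<le> m"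
    and x: "(norm (x - c))\<^sup>2 \<le> m"
  shows "column i (grad_convolution u \<eta> x) \<bullet> (x - c)
    \<le> B * ((m - (norm (x - c))\<^sup>2) / 2) * (LINT \<xi>|lebesgue. \<bar>u \<xi> $ i\<bar>)"
proof -
  let ?y = "x - c" and ?D = "(m - (norm (x - c))\<^sup>2) / 2"
  let ?k = "\<lambda>\<xi>. \<Sum>b\<in>Basis. (?y \<bullet> b) * partial b \<eta> (x - \<xi>)"
  have int: "integrable lebesgue (\<lambda>\<xi>. u \<xi> $ i * partial b \<eta> (x - \<xi>))" if "b \<in> Basis" for b
    by (rule convolution_integrable[OF u(1) bounded_Lipschitz_continuous[OF \<eta>(3)[OF that]]])
      (use \<eta>(3)[OF that] in \<open>auto simp: bounded_Lipschitz_def\<close>)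
  have k: "u \<xi> $ i * ?k \<xi> = (\<Sum>b\<in>Basis. (?y \<bullet> b) * (u \<xi> $ i * partial b \<eta> (x - \<xi>)))" for \<xi>
    by (simp add: sum_distrib_left mult.left_commute)
  have "column i (grad_convolution u \<eta> x) \<bullet> ?y = (\<Sum>j\<in>UNIV. column i (grad_convolution u \<eta> x) $ j * ?y $ j)"
    by (simp add: inner_vec_def)
  also have "\<dots> =
      (\<Sum>b\<in>Basis. (?y \<bullet> b) * (LINT \<xi>|lebesgue. u \<xi> $ i * partial b \<eta> (x - \<xi>)))"
    by (simp add: sum_Basis_axis column_def inner_axis mult.commute
        grad_convolution_entry[OF u(1) \<eta>] convolution_def)
  also have "\<dots> = (LINT \<xi>|lebesgue. u \<xi> $ i * ?k \<xi>)"
    unfolding k by (subst Bochner_Integration.integral_sum) (auto intro: int)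
  also have "\<dots> \<le> (LINT \<xi>|lebesgue. B * ?D * \<bar>u \<xi> $ i\<bar>)"
  proof (rule integral_mono_AE)
    show "integrable lebesgue (\<lambda>\<xi>. u \<xi> $ i * ?k \<xi>)"
      unfolding k by (intro Bochner_Integration.integrable_sum integrable_mult_right int)
    show "integrable lebesgue (\<lambda>\<xi>. B * ?D * \<bar>u \<xi> $ i\<bar>)" using u(1) by auto
    show "AE \<xi> in lebesgue. u \<xi> $ i * ?k \<xi> \<le> B * ?D * \<bar>u \<xi> $ i\<bar>"
      using u(2) near
    proof eventually_elim
      case (elim \<xi>)
      have "?k \<xi> \<le> B * ?D" if "u \<xi> $ i \<noteq> 0"
      proof -
        have D0: "0 \<le> ?D" using x by simp
        have k': "?k \<xi> = - \<kappa> (x - \<xi>) * ((x - \<xi>) \<bullet> ?y)" by (rule \<kappa>(4))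
        have "- \<kappa> (x - \<xi>) * ((x - \<xi>) \<bullet> ?y) \<le> \<kappa> (x - \<xi>) * ?D"
        proof (cases "l < norm (x - \<xi>)")
          case True
          then show ?thesis by (simp add: \<kappa>(3))
        next
          case False
          then have m: "(norm (\<xi> - c))\<^sup>2 \<le> m" using elim(2) that by blast
          \<comment> \<open>Cosine rule in the triangle with vertices \<open>x\<close>, \<open>\<xi>\<close> and \<open>c\<close>.\<close>
          have "2 * ((x - \<xi>) \<bullet> ?y) = (norm ?y)\<^sup>2 + (norm (x - \<xi>))\<^sup>2 - (norm (\<xi> - c))\<^sup>2"
            by (simp add: power2_norm_eq_inner inner_diff_left inner_diff_right inner_commute algebra_simps)
          moreover have "- p \<le> (m - a) / 2" if "2 * p = a + b - e" "e \<le> m" "0 \<le> b" for p a b e :: real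
            using that by (simp add: field_simps)
          ultimately have "- ((x - \<xi>) \<bullet> ?y) \<le> ?D" using m zero_le_power2 by blast
          then show ?thesis using mult_left_mono[OF _ \<kappa>(1)[of "x - \<xi>"]] by fastforce
        qed
        also have "\<dots> \<le> B * ?D" using \<kappa>(2) D0 by (rule mult_right_mono)
        finally show ?thesis unfolding k' .
      qed
      then show ?case using mult_left_mono[of "?k \<xi>" "B * ?D" "u \<xi> $ i"] elim(1)
        by (cases "u \<xi> $ i = 0") (auto simp: mult.commute)
    qed
  qed
  finally show ?thesis by simp
qed

section \<open>Invariance of balls\<close>

context regular_flow begin

text \<open>The hypothesis \<open>drift\<close> may be used only while all particles are in the larger balls of radii \<open>r\<close>. Since the
speed is at most \<open>K\<close>, this is guaranteed on a time interval of length \<open>\<epsilon> / (K + 1)\<close> after any time at which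
the particles are in the balls of radii \<open>R\<close>. On such an interval the supremum argument shows that the
particles are still in the smaller balls at the end, and finitely many intervals cover \<open>{0..T}\<close>.\<close>

lemma invariant_balls:
  fixes c :: "'i \<Rightarrow> 'a" and R r :: "'i \<Rightarrow> real"
  assumes \<epsilon>: "0 < \<epsilon>" "\<And>h. h \<in> H \<Longrightarrow> R h + \<epsilon> \<le> r h" and \<kappa>: "0 \<le> \<kappa>"
    and drift: "\<And>t h m y. t \<in> {0..T} \<Longrightarrow> h \<in> H \<Longrightarrow> y \<in> cball (c h) (R h) \<Longrightarrow>
      (\<And>j y. j \<in> H \<Longrightarrow> y \<in> cball (c j) (R j) \<Longrightarrow> X t 0 y \<in> cball (c j) (r j)) \<Longrightarrow>
      (\<And>y. y \<in> cball (c h) (R h) \<Longrightarrow> (norm (X t 0 y - c h))\<^sup>2 \<le> m) \<Longrightarrow>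
      2 * (u t (X t 0 y) \<bullet> (X t 0 y - c h)) \<le> \<kappa> * (m - (norm (X t 0 y - c h))\<^sup>2)"
    and t: "t \<in> {0..T}" and h: "h \<in> H" and y: "y \<in> cball (c h) (R h)"
  shows "X t 0 y \<in> cball (c h) (R h)"
proof -
  define inv where "inv t \<longleftrightarrow> (\<forall>h\<in>H. \<forall>y\<in>cball (c h) (R h). X t 0 y \<in> cball (c h) (R h))" for t
  have step: "inv t1" if inv0: "inv t0" and t01: "0 \<le> t0" "t0 \<le> t1" "t1 \<le> T" "K * (t1 - t0) \<le> \<epsilon>" for t0 t1
    unfolding inv_def
  proof (intro ballI)
    have outer: "X s 0 y \<in> cball (c j) (r j)" if "s \<in> {t0..t1}" "j \<in> H" "y \<in> cball (c j) (R j)" for s j y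
    proof -
      have "norm (X s 0 y - X t0 0 y) \<le> K * \<bar>s - t0\<bar>" by (rule X_displacement) (use that t01 T in auto)
      also have "\<dots> \<le> K * (t1 - t0)" using that K by (intro mult_left_mono) auto
      finally have "dist (X t0 0 y) (X s 0 y) \<le> \<epsilon>" using t01 by (simp add: dist_norm norm_minus_commute)
      moreover have "dist (c j) (X t0 0 y) \<le> R j" using inv0 that by (auto simp: inv_def)
      ultimately show ?thesis using dist_triangle[of "c j" "X s 0 y" "X t0 0 y"] \<epsilon>(2)[OF that(2)] by auto
    qed
    fix h y assume h: "h \<in> H" and y: "y \<in> cball (c h) (R h)"
    have R0: "0 \<le> R h" using y by (meson dist_not_less_zero mem_cball not_less order_trans zero_le_dist)
    define b where "b y s = (norm (X s 0 y - c h))\<^sup>2" for y s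
    define S where "S = (\<lambda>(y, s). b y s) ` (cball (c h) (R h) \<times> {t0..t1})"
    define m where "m = Sup S"
    have bdd: "bdd_above S"
    proof (rule bdd_aboveI)
      fix a assume "a \<in> S"
      then obtain y s where "a = b y s" "y \<in> cball (c h) (R h)" "s \<in> {t0..t1}" by (auto simp: S_def)
      then show "a \<le> (r h)\<^sup>2" using outer[OF _ h, of s y]
        by (auto simp: b_def dist_norm norm_minus_commute intro!: power_mono)
    qed
    have bm: "b y s \<le> m" if "y \<in> cball (c h) (R h)" "s \<in> {t0..t1}" for y s
      unfolding m_def using that by (intro cSup_upper[OF _ bdd]) (auto simp: S_def)
    have b0: "b y t0 \<le> (R h)\<^sup>2" if "y \<in> cball (c h) (R h)" for y
      using inv0 h that by (auto simp: b_def inv_def dist_norm norm_minus_commute intro!: power_mono)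
    have "m \<le> (R h)\<^sup>2"
    proof (rule ccontr)
      assume "\<not> m \<le> (R h)\<^sup>2"
      then have mR: "(R h)\<^sup>2 < m" by simp
      let ?q = "exp (- (\<kappa> * (t1 - t0)))"
      \<comment> \<open>Every particle stays below the supremum by a fixed amount.\<close>
      have "b y s \<le> m - ?q * (m - (R h)\<^sup>2)" if y: "y \<in> cball (c h) (R h)" and s: "s \<in> {t0..t1}" for y s
      proof -
        let ?b' = "\<lambda>s. 2 * (u s (X s 0 y) \<bullet> (X s 0 y - c h))"
        have "exp (\<kappa> * s) * (b y s - m) \<le> exp (\<kappa> * t0) * (b y t0 - m)"
        proof (rule derivative_nonpos_imp_decreasing[where S="{0..T}" and a=t0 and b=s and
              f="\<lambda>s. exp (\<kappa> * s) * (b y s - m)" and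
              f'="\<lambda>s. exp (\<kappa> * s) * (?b' s - \<kappa> * (m - b y s))"])
          fix a assume a: "a \<in> {t0..s}"
          then have aT: "a \<in> {0..T}" and a1: "a \<in> {t0..t1}" using s t01 by auto
          have Xc: "((\<lambda>s. X s 0 y - c h) has_vector_derivative u a (X a 0 y)) (at a within {0..T})"
            using has_vector_derivative_diff[OF X_deriv[OF zero_in aT, of y] has_vector_derivative_const[of "c h"]] by simp
          have "(b y has_vector_derivative ?b' a) (at a within {0..T})"
            using bounded_bilinear.has_vector_derivative[OF bounded_bilinear_inner Xc Xc]
            by (simp add: b_def [abs_def] power2_norm_eq_inner inner_commute)
          then show "((\<lambda>s. exp (\<kappa> * s) * (b y s - m)) has_vector_derivative exp (\<kappa> * a) * (?b' a - \<kappa> * (m - b y a)))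
              (at a within {0..T})"
            unfolding has_real_derivative_iff_has_vector_derivative[symmetric]
            by (auto intro!: derivative_eq_intros simp: algebra_simps)
          have bm': "(norm (X a 0 z - c h))\<^sup>2 \<le> m" if "z \<in> cball (c h) (R h)" for z
            using bm[OF that a1] by (simp add: b_def)
          have "?b' a \<le> \<kappa> * (m - (norm (X a 0 y - c h))\<^sup>2)"
            by (rule drift[OF aT h y]) (fact outer[OF a1], fact bm')
          then show "exp (\<kappa> * a) * (?b' a - \<kappa> * (m - b y a)) \<le> 0"
            by (auto simp: b_def intro!: mult_nonneg_nonpos)
        qed (use s t01 in auto)
        also have "\<dots> \<le> exp (\<kappa> * t0) * ((R h)\<^sup>2 - m)" using b0[OF y] by simp
        finally have "exp (- (\<kappa> * s)) * (exp (\<kappa> * s) * (b y s - m)) \<le> exp (- (\<kappa> * s)) * (exp (\<kappa> * t0) * ((R h)\<^sup>2 - m))"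
          by (rule mult_left_mono) auto
        then have "b y s - m \<le> exp (- (\<kappa> * (s - t0))) * ((R h)\<^sup>2 - m)"
          by (simp add: mult.assoc[symmetric] right_diff_distrib flip: exp_add)
        also have "\<dots> \<le> ?q * ((R h)\<^sup>2 - m)"
          using mR s \<kappa> by (intro mult_right_mono_neg) (auto intro!: mult_left_mono)
        finally show ?thesis by (simp add: algebra_simps)
      qed
      then have "a \<le> m - ?q * (m - (R h)\<^sup>2)" if "a \<in> S" for a using that by (auto simp: S_def)
      moreover have "b y t0 \<in> S"
        unfolding S_def using y t01 by (intro image_eqI[of _ _ "(y, t0)"]) auto
      ultimately have "Sup S \<le> m - ?q * (m - (R h)\<^sup>2)" by (intro cSup_least) auto
      then have "m \<le> m - ?q * (m - (R h)\<^sup>2)" by (simp add: m_def)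
      then have "?q * (m - (R h)\<^sup>2) \<le> 0" by simp
      then show False using mR by (simp add: mult_le_0_iff)
    qed
    then have "(norm (X t1 0 y - c h))\<^sup>2 \<le> (R h)\<^sup>2" using bm[OF y, of t1] t01 by (simp add: b_def)
    then show "X t1 0 y \<in> cball (c h) (R h)"
      using power2_le_imp_le[OF _ R0] by (simp add: dist_norm norm_minus_commute)
  qed
  define \<tau> where "\<tau> = \<epsilon> / (K + 1)"
  have \<tau>: "0 < \<tau>" using \<epsilon> K by (simp add: \<tau>_def)
  have K\<tau>: "K * \<tau> \<le> \<epsilon>" using \<epsilon>(1) K by (simp add: \<tau>_def divide_simps)
  have "inv t" if "t \<in> {0..T}" "t \<le> real k * \<tau>" for k t
    using that
  proof (induction k arbitrary: t)
    case 0
    then have "t = 0" by simp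
    then show ?case using zero_in by (simp add: inv_def X_init)
  next
    case (Suc k)
    let ?t0 = "max 0 (t - \<tau>)"
    have "inv ?t0" by (rule Suc.IH) (use Suc.prems \<tau> in \<open>auto simp: algebra_simps\<close>)
    moreover have "K * (t - ?t0) \<le> K * \<tau>" using K by (intro mult_left_mono) auto
    ultimately show ?case using K\<tau> \<tau> Suc.prems by (intro step[of ?t0 t]) auto
  qed
  moreover obtain k where "t \<le> real k * \<tau>" using reals_Archimedean3[OF \<tau>] less_imp_le by blast
  ultimately have "inv t" using t by blast
  then show ?thesis using h y by (simp add: inv_def)
qed

end

section \<open>Confinement and conservation of mass\<close>

lemma norm_column_le:
  fixes A :: "real^'m^'n"
  shows "norm (column i A) \<le> norm A"
proof -
  have "norm (column i A) = L2_set (\<lambda>j. \<bar>A $ j $ i\<bar>) UNIV" by (simp add: norm_vec_def column_def)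
  also have "\<dots> \<le> L2_set (\<lambda>j. norm (A $ j)) UNIV"
    by (intro L2_set_mono) (auto intro: component_le_norm_cart)
  also have "\<dots> = norm A" by (simp add: norm_vec_def)
  finally show ?thesis .
qed

lemma bounded_linear_column: "bounded_linear (column i :: real^'m^'n \<Rightarrow> real^'n)"
  unfolding linear_conv_bounded_linear[symmetric]
  by (rule linearI) (simp_all add: column_def vec_eq_iff)

text \<open>The profile is continuous, being the restriction of \<open>\<eta>\<close> to a line, so it vanishes everywhere outside its
essential support.\<close>

lemma radial_profile_zero:
  fixes \<eta> :: "'a::euclidean_space \<Rightarrow> real" and \<eta>t :: "real \<Rightarrow> real"
  assumes \<eta>: "\<And>y. \<eta> y = \<eta>t (norm y)" "\<And>s. \<eta>t (- s) = \<eta>t s" and cont: "continuous_on UNIV \<eta>"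
    and l: "0 < l" "spt \<eta>t = {- l..l}" and x: "l < norm x"
  shows "\<eta> x = 0"
proof -
  obtain e :: 'a where e: "e \<in> Basis" using nonempty_Basis by blast
  have "\<eta>t s = \<eta> (s *\<^sub>R e)" for s
    using \<eta>(1)[of "s *\<^sub>R e"] \<eta>(2)[of s] e by (cases "0 \<le> s") auto
  then have "\<eta>t = (\<lambda>s. \<eta> (s *\<^sub>R e))" by blast
  then have "continuous_on UNIV \<eta>t"
    using continuous_on_compose2[OF cont, of UNIV "\<lambda>s. s *\<^sub>R e"] by (simp add: continuous_intros)
  then have "\<eta>t (norm x) = 0" by (rule continuous_zero_outside_spt) (use l x in auto)
  then show ?thesis by (simp add: \<eta>(1))
qed

theorem corollary2p6:
  fixes V :: "real^'m^'n \<Rightarrow> real^'m^'n"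
    and \<eta> :: "real^'n \<Rightarrow> real"
    and v :: "real \<Rightarrow> real"
    and \<eta>t :: "real \<Rightarrow> real"
    and l :: real
    and \<rho>0 :: "real^'n \<Rightarrow> real^'m"
    and \<rho> :: "real \<Rightarrow> real^'n \<Rightarrow> real^'m"
    and i :: 'm
    and k :: nat
    and x :: "nat \<Rightarrow> real^'n"
    and r :: "nat \<Rightarrow> real"
  assumes V: "assumption_V V"
    and eta: "assumption_eta \<eta>"
    and datum: "L_one \<rho>0" "L_infty \<rho>0" "\<forall>j. BV (\<lambda>y. \<rho>0 y $ j)"
    and V_radial: "\<forall>w. V w = v (norm w) *\<^sub>R w" "\<forall>s>0. v s > 0"
    and eta_radial: "\<forall>y. \<eta> y = \<eta>t (norm y)" "\<forall>s. \<eta>t (- s) = \<eta>t s"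
      "\<forall>s\<ge>0. deriv \<eta>t s \<le> 0" "l > 0" "spt \<eta>t = {- l..l}"
    and nonneg: "\<forall>j. AE y in lebesgue. \<rho>0 y $ j \<ge> 0"
    and radii: "\<forall>h\<in>{1..k}. r h > 0"
    and initial_support: "spt (\<lambda>y. \<rho>0 y $ i) \<subseteq> (\<Union>h\<in>{1..k}. ball (x h) (r h))"
    and separated: "\<forall>h\<in>{1..k}. \<forall>j\<in>{1..k}. h \<noteq> j \<longrightarrow> norm (x h - x j) > r h + r j + l"
    and solution: "system_solution UNIV V \<eta> \<rho>0 \<rho>"
  shows "\<forall>t\<ge>0. spt (\<lambda>y. \<rho> t y $ i) \<subseteq> (\<Union>h\<in>{1..k}. ball (x h) (r h)) \<and>
    (\<forall>h\<in>{1..k}. (LINT y:ball (x h) (r h)|lebesgue. \<rho> t y $ i)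
                 = (LINT y:ball (x h) (r h)|lebesgue. \<rho>0 y $ i))"
proof (intro allI impI)
  fix T :: real assume T: "0 \<le> T"
  let ?H = "{1..k}"
  let ?\<rho>0 = "\<lambda>y. \<rho>0 y $ i"
  have \<rho>: "continuous_into_L_one UNIV \<rho>" and "lagrangian_solution UNIV (velocity V \<eta> \<rho> i) ?\<rho>0 (\<lambda>t y. \<rho> t y $ i)"
    using solution by (auto simp: system_solution_def)
  then obtain X where X: "characteristics UNIV (velocity V \<eta> \<rho> i) X"
    and sol: "\<And>t. AE y in lebesgue. \<rho> t y $ i =
      ?\<rho>0 (X 0 t y) * exp (- (LBINT \<tau>=0..t. divergence (velocity V \<eta> \<rho> i \<tau>) (X \<tau> t y)))"
    unfolding lagrangian_solution_def by auto
  have CV: "C_k 2 V" and C\<eta>: "C_k 3 \<eta>" using V eta by (auto simp: assumption_V_def assumption_eta_def)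
  have supp: "\<eta> y = 0" if "l < norm y" for y
    by (rule radial_profile_zero[of \<eta> \<eta>t l]) (use eta_radial C_k_continuous[OF C\<eta>] that in auto)
  have d\<eta>: "\<eta> differentiable (at y)" for y using C\<eta> by (simp add: numeral_3_eq_3)

  obtain Kw Dw where w_reg: "regular_field (\<lambda>t. grad_convolution (\<rho> t) \<eta>) Dw (L1_dist \<rho>) T Kw"
    using grad_convolution_regular[of \<rho> T \<eta> l] \<rho> T C\<eta> supp by metis
  obtain K DV where V_reg: "regular_field (\<lambda>t y. V (grad_convolution (\<rho> t) \<eta> y)) DV (L1_dist \<rho>) T K"
    using regular_field_compose[OF w_reg CV] by blast
  interpret w: regular_field "\<lambda>t. grad_convolution (\<rho> t) \<eta>" Dw "L1_dist \<rho>" T Kw by (rule w_reg)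
  define u where "u = velocity V \<eta> \<rho> i"
  define Du where "Du t y z = column i (DV t y z)" for t y z
  have u_reg: "regular_field u Du (L1_dist \<rho>) T K"
    using regular_field_linear[OF V_reg bounded_linear_column norm_column_le]
    by (simp add: u_def velocity_def [abs_def] Du_def [abs_def])
  interpret regular_flow u Du "L1_dist \<rho>" T K X
  proof (intro regular_flow.intro u_reg regular_flow_axioms.intro)
    show "X t t y = y" for t y using X by (simp add: characteristics_def)
    show "((\<lambda>t. X t s y) has_vector_derivative u t (X t s y)) (at t within {0..T})" for s t y
      using X by (auto simp: characteristics_def u_def intro: has_vector_derivative_at_within)
  qed

  have div: "divergence (u t) y = dvg t y" if "t \<in> {0..T}" for t y
    by (simp add: divergence_def dvg_def sum_Basis_axis inner_axis partial_eq[OF der[OF that]])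
  have weight: "exp (- (LBINT \<tau>=0..t. divergence (u \<tau>) (X \<tau> t y))) = weight t y" if t: "t \<in> {0..T}" for t y
  proof -
    have cont: "continuous_on {0..t} (\<lambda>\<tau>. divergence (u \<tau>) (X \<tau> t y))"
      using continuous_on_subset[OF continuous_dvg[OF t, of y], of "{0..t}"] t
      by (subst continuous_on_cong[OF refl div]) auto
    then have "set_integrable lborel {0..t} (\<lambda>\<tau>. divergence (u \<tau>) (X \<tau> t y))"
      by (rule borel_integrable_atLeastAtMost')
    then have "(LBINT \<tau>=0..t. divergence (u \<tau>) (X \<tau> t y)) = integral {0..t} (\<lambda>\<tau>. divergence (u \<tau>) (X \<tau> t y))"
      using interval_integral_eq_integral[of 0 t] t by (simp add: zero_ereal_def)
    also have "\<dots> = integral {0..t} (\<lambda>\<tau>. dvg \<tau> (X \<tau> t y))"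
      by (intro integral_cong div) (use t in auto)
    finally show ?thesis by (simp add: weight_def)
  qed
  have \<rho>_eq: "AE y in lebesgue. \<rho> t y $ i = ?\<rho>0 (X 0 t y) * weight t y" if "t \<in> {0..T}" for t
    using sol[of t] weight[OF that] by (simp add: u_def)

  have "bounded (\<Union>h\<in>?H. ball (x h) (r h))" by (intro bounded_UN) auto
  then have "compact (spt ?\<rho>0)"
    using closed_spt initial_support bounded_subset compact_eq_bounded_closed by blast
  then obtain \<epsilon> where \<epsilon>: "0 < \<epsilon>" and shrunk: "spt ?\<rho>0 \<subseteq> (\<Union>h\<in>?H. cball (x h) (r h - \<epsilon>))"
    using compact_subset_shrunk_balls[OF _ initial_support] by blast
  let ?R = "\<lambda>h. r h - \<epsilon>"
  have start: "AE y in lebesgue. ?\<rho>0 y \<noteq> 0 \<longrightarrow> (\<exists>h\<in>?H. y \<in> cball (x h) (?R h))"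
    using spt_AE_zero[of ?\<rho>0] by eventually_elim (use shrunk in blast)

  obtain C where C: "0 \<le> C" "bounded_Lipschitz C \<eta>" "\<forall>b\<in>Basis. bounded_Lipschitz C (partial b \<eta>)"
    using kernel_constant[of \<eta> l] C\<eta> supp by metis
  have "\<exists>\<kappa>::real^'n \<Rightarrow> real. (\<forall>z. 0 \<le> \<kappa> z \<and> \<kappa> z \<le> DIM(real^'n) * C \<and> (l < norm z \<longrightarrow> \<kappa> z = 0)) \<and>
      (\<forall>z y. (\<Sum>b\<in>Basis. (y \<bullet> b) * partial b \<eta> z) = - \<kappa> z * (z \<bullet> y))"
    by (rule radial_kernel_gradient[where \<eta>t=\<eta>t]) (use eta_radial d\<eta> C(3) supp in auto)
  then obtain \<kappa> where \<kappa>: "\<And>z. 0 \<le> \<kappa> z" "\<And>z. \<kappa> z \<le> CARD('n) * C" "\<And>z. l < norm z \<Longrightarrow> \<kappa> z = 0"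
    "\<And>z y. (\<Sum>b\<in>Basis. (y \<bullet> b) * partial b \<eta> z) = - \<kappa> z * (z \<bullet> y)"
    by auto
  obtain M where M: "0 \<le> M" "\<forall>t\<in>{0..T}. \<forall>i. (LINT y|lebesgue. \<bar>\<rho> t y $ i\<bar>) \<le> M"
    using component_L1_bounded[OF \<rho>, of T] by blast
  have "V differentiable (at a)" "b \<in> Basis \<Longrightarrow> C_k 1 (partial b V)" for a b
    using CV by (auto simp: numeral_2_eq_2)
  then obtain L where L: "0 \<le> L" "\<forall>a\<in>cball 0 Kw. \<forall>b\<in>cball 0 Kw. norm (V a - V b) \<le> L * norm (a - b)"
    using C1_Lipschitz_on_ball[of V Kw] C_k_continuous[of 1] by blast
  \<comment> \<open>\<open>V\<close> is Lipschitz on the range of the gradient and \<open>V 0 = 0\<close>, so \<open>v (norm a) * norm a \<le> L * norm a\<close>.\<close>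
  have v_bound: "v (norm a) \<le> L" if "a \<noteq> 0" "norm a \<le> Kw" for a :: "real^'m^'n"
  proof -
    have "norm (V a - V 0) \<le> L * norm (a - 0)" using L(2) that(2) w.K by (intro L(2)[rule_format]) auto
    then have "v (norm a) * norm a \<le> L * norm a" using V_radial that(1) by (simp add: less_imp_le)
    then show ?thesis using that(1) by simp
  qed

  have drift: "2 * (u t (X t 0 y) \<bullet> (X t 0 y - x h)) \<le> (L * (CARD('n) * C) * M) * (m - (norm (X t 0 y - x h))\<^sup>2)"
    if t: "t \<in> {0..T}" and h: "h \<in> ?H" and y: "y \<in> cball (x h) (?R h)"
      and outer: "\<And>j y. j \<in> ?H \<Longrightarrow> y \<in> cball (x j) (?R j) \<Longrightarrow> X t 0 y \<in> cball (x j) (r j)"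
      and m: "\<And>y. y \<in> cball (x h) (?R h) \<Longrightarrow> (norm (X t 0 y - x h))\<^sup>2 \<le> m" for t h m y
  proof -
    let ?p = "X t 0 y" and ?w = "grad_convolution (\<rho> t) \<eta> (X t 0 y)"
    let ?D = "m - (norm (?p - x h))\<^sup>2"
    have D0: "0 \<le> ?D" using m[OF y] by simp
    have pos: "AE \<xi> in lebesgue. 0 \<le> \<rho> t \<xi> $ i"
      using \<rho>_eq[OF t] flow_AE[OF t nonneg[rule_format, of i]]
      by eventually_elim (simp add: less_imp_le[OF weight_pos])
    \<comment> \<open>Mass from another ball is out of the range of the kernel.\<close>
    have near: "AE \<xi> in lebesgue. \<rho> t \<xi> $ i \<noteq> 0 \<longrightarrow> l < norm (?p - \<xi>) \<or> (norm (\<xi> - x h))\<^sup>2 \<le> m"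
      using \<rho>_eq[OF t] flow_AE[OF t start]
    proof eventually_elim
      case (elim \<xi>)
      show ?case
      proof
        assume "\<rho> t \<xi> $ i \<noteq> 0"
        then obtain j where j: "j \<in> ?H" "X 0 t \<xi> \<in> cball (x j) (?R j)" using elim by auto
        have \<xi>: "X t 0 (X 0 t \<xi>) = \<xi>" using X_cocycle[OF t t zero_in] t by (simp add: X_init)
        show "l < norm (?p - \<xi>) \<or> (norm (\<xi> - x h))\<^sup>2 \<le> m"
        proof (cases "j = h")
          case True
          then show ?thesis using m[of "X 0 t \<xi>"] j \<xi> by simp
        next
          case False
          have "r h + r j + l < norm (x h - x j)" using separated h j(1) False by auto
          moreover have "dist (x j) \<xi> \<le> r j" using outer[OF j] \<xi> by simp
          moreover have "dist (x h) ?p \<le> r h" using outer[OF h y] by simp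
          moreover have "dist (x h) (x j) \<le> dist (x h) ?p + dist ?p \<xi> + dist \<xi> (x j)"
            using dist_triangle[of "x h" "x j" ?p] dist_triangle[of ?p "x j" \<xi>] by linarith
          ultimately show ?thesis by (simp add: dist_norm norm_minus_commute)
        qed
      qed
    qed
    have "column i ?w \<bullet> (?p - x h) \<le> (CARD('n) * C) * (?D / 2) * (LINT \<xi>|lebesgue. \<bar>\<rho> t \<xi> $ i\<bar>)"
      by (rule inward_drift[where u="\<rho> t" and \<eta>=\<eta> and l=l and \<kappa>=\<kappa> and C=C])
        (use rho_component_integrable[OF \<rho>] pos d\<eta> C \<kappa> near m[OF y] in auto)
    also have "\<dots> \<le> (CARD('n) * C) * (?D / 2) * M"
      using M(2) t C(1) D0 by (intro mult_left_mono) auto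
    finally have col: "column i ?w \<bullet> (?p - x h) \<le> (CARD('n) * C) * (?D / 2) * M" .
    have u: "u t ?p = v (norm ?w) *\<^sub>R column i ?w"
      using V_radial(1) by (simp add: u_def velocity_def column_def vec_eq_iff)
    show ?thesis
    proof (cases "?w = 0")
      case True
      then have "column i ?w = 0" by (simp add: column_def vec_eq_iff)
      then show ?thesis using u L(1) C(1) M(1) D0 by simp
    next
      case False
      have "v (norm ?w) \<le> L" "0 \<le> v (norm ?w)"
        using v_bound[OF False] w.u_bound[OF t] V_radial(2) False by (auto simp: less_imp_le)
      then have "v (norm ?w) * (column i ?w \<bullet> (?p - x h)) \<le> L * ((CARD('n) * C) * (?D / 2) * M)"
        using col C(1) D0 M(1)
        by (intro order_trans[OF mult_left_mono[OF col] mult_right_mono]) auto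
      then show ?thesis by (simp add: u mult_ac)
    qed
  qed
  have inv: "X T 0 y \<in> cball (x h) (?R h)" if "h \<in> ?H" "y \<in> cball (x h) (?R h)" for h y
    by (rule invariant_balls[where H="?H" and r=r and \<epsilon>=\<epsilon> and \<kappa>="L * (CARD('n) * C) * M"])
      (use \<epsilon> L(1) C(1) M(1) drift T that in auto)

  have TT: "T \<in> {0..T}" using T by simp
  have there_and_back: "X T 0 (X 0 T y) = y" for y using X_cocycle[OF TT TT zero_in] T by (simp add: X_init)
  \<comment> \<open>A point where the density is positive at time \<open>T\<close> and the start of its characteristic lie in the same ball.\<close>
  have \<rho>T: "AE y in lebesgue. \<rho> T y $ i = ?\<rho>0 (X 0 T y) * weight T y \<and>
      (?\<rho>0 (X 0 T y) \<noteq> 0 \<longrightarrow> (\<exists>h\<in>?H. X 0 T y \<in> cball (x h) (?R h) \<and> y \<in> cball (x h) (?R h)))"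
    using \<rho>_eq[OF TT] flow_AE[OF TT start]
  proof eventually_elim
    case (elim y)
    then show ?case using inv[of _ "X 0 T y"] there_and_back[of y] by metis
  qed
  have sub: "cball (x h) (?R h) \<subseteq> ball (x h) (r h)" for h using \<epsilon> by auto
  have "spt (\<lambda>y. \<rho> T y $ i) \<subseteq> (\<Union>h\<in>?H. cball (x h) (?R h))"
  proof (rule spt_subset_closed)
    show "AE y in lebesgue. y \<notin> (\<Union>h\<in>?H. cball (x h) (?R h)) \<longrightarrow> \<rho> T y $ i = 0"
      using \<rho>T by eventually_elim auto
  qed (auto intro: closed_UN)
  then have "spt (\<lambda>y. \<rho> T y $ i) \<subseteq> (\<Union>h\<in>?H. ball (x h) (r h))" using sub by blast
  moreover have "(LINT y:ball (x h) (r h)|lebesgue. \<rho> T y $ i) = (LINT y:ball (x h) (r h)|lebesgue. ?\<rho>0 y)"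
    if h: "h \<in> ?H" for h
  proof -
    let ?B = "ball (x h) (r h)"
    define g where "g y = indicator ?B y * ?\<rho>0 y" for y
    have \<rho>0i: "integrable lebesgue ?\<rho>0"
      using datum(1) unfolding L_one_def by (rule integrable_bounded_linear[OF bounded_linear_vec_nth])
    have g: "integrable lebesgue g"
      using integrable_mult_indicator[OF _ \<rho>0i, of ?B] by (simp add: g_def [abs_def])
    have same_ball: "j = h" if "j \<in> ?H" "y \<in> cball (x j) (?R j)" "y \<in> ?B" for j y
    proof (rule ccontr)
      assume "j \<noteq> h"
      then have "r h + r j + l < dist (x h) (x j)" using separated h that(1) by (auto simp: dist_norm)
      then show False
        using dist_triangle[of "x h" "x j" y] that(2,3) \<epsilon> eta_radial(4) by (auto simp: dist_commute)
    qed
    have ae: "AE y in lebesgue. indicator ?B y * \<rho> T y $ i = g (X 0 T y) * weight T y"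
      using \<rho>T
    proof eventually_elim
      case (elim y)
      show ?case
      proof (cases "?\<rho>0 (X 0 T y) = 0")
        case True
        then show ?thesis using elim by (simp add: g_def)
      next
        case False
        then obtain j where j: "j \<in> ?H" "X 0 T y \<in> cball (x j) (?R j)" "y \<in> cball (x j) (?R j)" using elim by auto
        have "y \<in> ?B \<longleftrightarrow> X 0 T y \<in> ?B"
          using same_ball[OF j(1,2)] same_ball[OF j(1,3)] sub[of j] j by blast
        then show ?thesis using elim by (simp add: g_def indicator_def)
      qed
    qed
    have meas: "(\<lambda>y. indicator ?B y * \<rho> T y $ i) \<in> borel_measurable lebesgue"
      using integrable_mult_indicator[OF _ rho_component_integrable[OF \<rho>, of T i], of ?B]
      by (simp add: borel_measurable_integrable)
    have "(LINT y:?B|lebesgue. \<rho> T y $ i) = (LINT y|lebesgue. indicator ?B y * \<rho> T y $ i)"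
      by (simp add: set_lebesgue_integral_def)
    also have "\<dots> = (LINT y|lebesgue. g (X 0 T y) * weight T y)"
      by (rule integral_cong_AE[OF meas borel_measurable_AE[OF meas ae] ae])
    also have "\<dots> = integral\<^sup>L lebesgue g" by (rule flow_integral[OF TT g])
    also have "\<dots> = (LINT y:?B|lebesgue. ?\<rho>0 y)" by (simp add: set_lebesgue_integral_def g_def [abs_def])
    finally show ?thesis .
  qed
  ultimately show "spt (\<lambda>y. \<rho> T y $ i) \<subseteq> (\<Union>h\<in>?H. ball (x h) (r h)) \<and>
    (\<forall>h\<in>?H. (LINT y:ball (x h) (r h)|lebesgue. \<rho> T y $ i) = (LINT y:ball (x h) (r h)|lebesgue. ?\<rho>0 y))"
    by blast
qed

end
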